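(* Let $\Gamma$ be a finitely generated torsion-free amenable group and $K$ a field such that the group algebra $K\Gamma$ has no zero divisors. Then $K\Gamma$ is weakly stable if and only if $\Gamma$ is residually finite.
   Context: Let $A$ be a finitely generated unital associative $K$-algebra (here $A=K\Gamma$), with a fixed finite generating set $S$ with $1\in S$. For $r\in\mathbb{N}$, $S^r$ is the set of all monomials of length at most $r$ in $S$, and $A_{\le r}=\mathrm{span}_K(S^r)$. For $X\in M_n(K)$, $rk(X)=\frac1n\mathrm{rank}(X)$. $d$-approximation ($d\in\mathbb{N}$, $d\ge1$): a $K$-linear map $\phi:A\to M_n(K)$ is a $d$-approximation of $(A,S)$ if there is a subspace $U\le K^n$ such that: (i) $\phi(xy)u=\phi(x)\phi(y)u$ for all $x,y\in A_{\le d}$ and $u\in U$; (ii) $\dim U\ge(1-\frac1d)n$; (iii) $rk(\phi(a))\ge 1-\frac1d$ for every nonzero $a\in A_{\le d}$. A representation $\psi:A\to M_n(K)$ is a $K$-linear multiplicative map, not necessarily unital. Weakly stable: $A$ is weakly stable if for every $\varepsilon>0$ there is $d\in\mathbb{N}$ such that for any $n$ and any $d$-approximation $\phi:A\to M_n(K)$ there is a representation $\psi:A\to M_n(K)$ with $rk(\phi(s)-\psi(s))<\varepsilon$ for all $s\in S$. *)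

theory Defs
  imports
    "HOL-Algebra.Coset"
    "HOL-Algebra.Generated_Groups"
    "HOL-Library.Poly_Mapping"
    "Jordan_Normal_Form.DL_Rank"
begin

section \<open>Group-theoretic hypotheses\<close>

definition finitely_generated :: "('g, 'b) monoid_scheme \<Rightarrow> bool" where
  "finitely_generated G \<longleftrightarrow>
     (\<exists>T. finite T \<and> T \<subseteq> carrier G \<and> generate G T = carrier G)"

definition torsion_free :: "('g, 'b) monoid_scheme \<Rightarrow> bool" where
  "torsion_free G \<longleftrightarrow>
     (\<forall>x\<in>carrier G. \<forall>k::nat. k > 0 \<longrightarrow> x [^]\<^bsub>G\<^esub> k = \<one>\<^bsub>G\<^esub> \<longrightarrow> x = \<one>\<^bsub>G\<^esub>)"

text \<open>
  Amenability of a discrete group in the sense of von Neumann: there is a finitely additive,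
  left-invariant probability measure defined on all subsets of the group.
\<close>

definition amenable :: "('g, 'b) monoid_scheme \<Rightarrow> bool" where
  "amenable G \<longleftrightarrow>
     (\<exists>\<mu> :: 'g set \<Rightarrow> real.
        (\<forall>A \<subseteq> carrier G. 0 \<le> \<mu> A) \<and>
        \<mu> (carrier G) = 1 \<and>
        (\<forall>A \<subseteq> carrier G. \<forall>B \<subseteq> carrier G. A \<inter> B = {} \<longrightarrow> \<mu> (A \<union> B) = \<mu> A + \<mu> B) \<and>
        (\<forall>g\<in>carrier G. \<forall>A \<subseteq> carrier G. \<mu> (g <#\<^bsub>G\<^esub> A) = \<mu> A))"

definition residually_finite :: "('g, 'b) monoid_scheme \<Rightarrow> bool" where
  "residually_finite G \<longleftrightarrow>
     (\<forall>g\<in>carrier G. g \<noteq> \<one>\<^bsub>G\<^esub> \<longrightarrow>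
        (\<exists>N. N \<lhd> G \<and> finite (rcosets\<^bsub>G\<^esub> N) \<and> g \<notin> N))"


section \<open>Weak stability of finitely generated algebras\<close>

text \<open>The normalised rank; the \<open>n\<close> of \<^const>\<open>vec_space.rank\<close> is the number of rows.\<close>

definition rk :: "nat \<Rightarrow> 'k::field mat \<Rightarrow> real" where
  "rk n X = real (vec_space.rank n X) / real n"

abbreviation subspace_of_Kn :: "nat \<Rightarrow> 'k::field vec set \<Rightarrow> bool" where
  "subspace_of_Kn n U \<equiv> VectorSpace.subspace class_ring U (module_vec TYPE('k) n)"

abbreviation subspace_dim :: "nat \<Rightarrow> 'k::field vec set \<Rightarrow> nat" where
  "subspace_dim n U \<equiv> vectorspace.dim class_ring ((module_vec TYPE('k) n)\<lparr>carrier := U\<rparr>)"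

locale K_algebra = Vector_Spaces.vector_space scale
  for scale :: "'k::field \<Rightarrow> 'a::ring_1 \<Rightarrow> 'a" +
  assumes scale_mult_left: "scale c x * y = scale c (x * y)"
    and scale_mult_right: "x * scale c y = scale c (x * y)"
begin

definition generating_set :: "'a set \<Rightarrow> bool" where
  "generating_set S \<longleftrightarrow> span {prod_list w |w. set w \<subseteq> S} = UNIV"

definition monomials_upto :: "'a set \<Rightarrow> nat \<Rightarrow> 'a set" where
  "monomials_upto S r = {prod_list w |w. set w \<subseteq> S \<and> length w \<le> r}"

definition A_upto :: "'a set \<Rightarrow> nat \<Rightarrow> 'a set" where
  "A_upto S r = span (monomials_upto S r)"

definition linear_to_mat :: "nat \<Rightarrow> ('a \<Rightarrow> 'k mat) \<Rightarrow> bool" where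
  "linear_to_mat n \<phi> \<longleftrightarrow>
     (\<forall>x. \<phi> x \<in> carrier_mat n n) \<and>
     (\<forall>x y. \<phi> (x + y) = \<phi> x + \<phi> y) \<and>
     (\<forall>c x. \<phi> (scale c x) = c \<cdot>\<^sub>m \<phi> x)"

definition approximation_of :: "'a set \<Rightarrow> nat \<Rightarrow> nat \<Rightarrow> ('a \<Rightarrow> 'k mat) \<Rightarrow> bool" where
  "approximation_of S d n \<phi> \<longleftrightarrow>
     linear_to_mat n \<phi> \<and>
     (\<exists>U. subspace_of_Kn n U \<and>
        (\<forall>x \<in> A_upto S d. \<forall>y \<in> A_upto S d. \<forall>u \<in> U.
            \<phi> (x * y) *\<^sub>v u = \<phi> x *\<^sub>v (\<phi> y *\<^sub>v u)) \<and>
        real (subspace_dim n U) \<ge> (1 - 1 / real d) * real n) \<and>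
     (\<forall>a \<in> A_upto S d. a \<noteq> 0 \<longrightarrow> rk n (\<phi> a) \<ge> 1 - 1 / real d)"

text \<open>Representations need not be unital: \<open>\<psi> 1\<close> may be any idempotent matrix.\<close>

definition algebra_representation :: "nat \<Rightarrow> ('a \<Rightarrow> 'k mat) \<Rightarrow> bool" where
  "algebra_representation n \<psi> \<longleftrightarrow> linear_to_mat n \<psi> \<and> (\<forall>x y. \<psi> (x * y) = \<psi> x * \<psi> y)"

definition weakly_stable :: "'a set \<Rightarrow> bool" where
  "weakly_stable S \<longleftrightarrow>
     (\<forall>\<epsilon>::real. \<epsilon> > 0 \<longrightarrow>
        (\<exists>d::nat. d \<ge> 1 \<and>
           (\<forall>n::nat. n \<ge> 1 \<longrightarrow>
              (\<forall>\<phi>. approximation_of S d n \<phi> \<longrightarrow>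
                 (\<exists>\<psi>. algebra_representation n \<psi> \<and>
                      (\<forall>s\<in>S. rk n (\<phi> s - \<psi> s) < \<epsilon>))))))"

end


section \<open>The group algebra\<close>

text \<open>
  The not necessarily commutative group underlying a type of class \<^class>\<open>group_add\<close>. It is
  written additively because the product of the ring \<open>'g \<Rightarrow>\<^sub>0 'k\<close> of finitely supported functions
  is convolution with respect to \<open>+\<close> on \<open>'g\<close>; thus \<open>'g \<Rightarrow>\<^sub>0 'k\<close> is the group algebra of
  \<open>group_of_type\<close>, the group element \<open>g\<close> being \<open>Poly_Mapping.single g 1\<close>.
\<close>

definition group_of_type :: "'g::group_add monoid" where
  "group_of_type = \<lparr>carrier = UNIV, monoid.mult = (+), one = 0\<rparr>"

lemma group_group_of_type: "group (group_of_type :: 'g::group_add monoid)"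
proof (rule groupI)
  fix x :: 'g
  show "\<exists>y\<in>carrier group_of_type. y \<otimes>\<^bsub>group_of_type\<^esub> x = \<one>\<^bsub>group_of_type\<^esub>"
    by (rule bexI[of _ "- x"]) (simp_all add: group_of_type_def)
qed (simp_all add: group_of_type_def add.assoc)

lemma group_element_mult:
  "Poly_Mapping.single g (1::'k::field) * Poly_Mapping.single h 1 =
   Poly_Mapping.single (g \<otimes>\<^bsub>group_of_type\<^esub> h) 1"
  by (simp add: mult_single group_of_type_def)

definition scale_ga :: "'k::field \<Rightarrow> ('g::group_add \<Rightarrow>\<^sub>0 'k) \<Rightarrow> ('g \<Rightarrow>\<^sub>0 'k)" where
  "scale_ga c = Poly_Mapping.map ((*) c)"

lemma lookup_scale_ga: "Poly_Mapping.lookup (scale_ga c p) g = c * Poly_Mapping.lookup p g"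
  by (simp add: scale_ga_def map.rep_eq when_def)

lemma scale_ga_add: "scale_ga c (p + q) = scale_ga c p + scale_ga c q"
  by (rule poly_mapping_eqI) (simp add: lookup_scale_ga lookup_add distrib_left)

lemma scale_ga_single: "scale_ga c (Poly_Mapping.single g a) = Poly_Mapping.single g (c * a)"
  by (rule poly_mapping_eqI) (simp add: lookup_scale_ga lookup_single when_def)

lemma group_algebra_induct [case_names zero add_single]:
  fixes p :: "'g::group_add \<Rightarrow>\<^sub>0 'k::field"
  assumes "P 0" and "\<And>p g a. P p \<Longrightarrow> P (p + Poly_Mapping.single g a)"
  shows "P p"
proof (induction p rule: update_induct)
  case const
  show ?case by (rule assms(1))
next
  case (update p g a)
  have "Poly_Mapping.update g a p = p + Poly_Mapping.single g a"
    using update by (intro poly_mapping_eqI)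
      (auto simp: lookup_update lookup_add lookup_single when_def in_keys_iff)
  then show ?case using assms(2) update by simp
qed

lemma scale_ga_zero: "scale_ga c 0 = 0"
  by (rule poly_mapping_eqI) (simp add: lookup_scale_ga)

lemma scale_ga_eq_single_times: "scale_ga c p = Poly_Mapping.single 0 c * p"
  by (induction p rule: group_algebra_induct)
     (simp_all add: scale_ga_zero scale_ga_single scale_ga_add mult_single distrib_left)

lemma scale_ga_eq_times_single: "scale_ga c p = p * Poly_Mapping.single 0 c"
  by (induction p rule: group_algebra_induct)
     (simp_all add: scale_ga_zero scale_ga_single scale_ga_add mult_single distrib_right mult.commute)

global_interpretation group_algebra: K_algebra "scale_ga :: 'k::field \<Rightarrow> ('g::group_add \<Rightarrow>\<^sub>0 'k) \<Rightarrow> _"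
proof
  fix c d :: 'k and p q :: "'g \<Rightarrow>\<^sub>0 'k"
  show "scale_ga c (p + q) = scale_ga c p + scale_ga c q"
    by (rule scale_ga_add)
  show "scale_ga (c + d) p = scale_ga c p + scale_ga d p"
    by (rule poly_mapping_eqI) (simp add: lookup_scale_ga lookup_add distrib_right)
  show "scale_ga c (scale_ga d p) = scale_ga (c * d) p"
    by (rule poly_mapping_eqI) (simp add: lookup_scale_ga mult.assoc)
  show "scale_ga 1 p = p"
    by (rule poly_mapping_eqI) (simp add: lookup_scale_ga)
  show "scale_ga c p * q = scale_ga c (p * q)"
    by (simp add: scale_ga_eq_single_times mult.assoc)
  show "p * scale_ga c q = scale_ga c (p * q)"
    by (simp add: scale_ga_eq_times_single mult.assoc)
qed

end

theory Submission
  imports Defs "HOL-Library.Function_Algebras"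
begin

text \<open>
  Write $A = K\<Gamma>$. For large $d$, a $d$-approximation of $A$ in $M_n(K)$ is unique up to conjugation
  and a small error in rank. So $A$ is weakly stable as soon as true representations are available as
  models, which is the case if $\<Gamma>$ is residually finite.

  Uniqueness rests on tilings. Let $F$ be a Folner set of $\<Gamma>$ and $\<phi>$ a $d$-approximation.
  As every nonzero element of the span of $F$ acts with almost full rank, one finds vectors
  $u_1, \<dots>, u_k$ such that all $\<phi>(f) u_i$ with $f \<in> F$ are linearly independent and span almost all
  of $K^n$ (\<open>exists_tiles\<close>). The vectors are found one by one, by the fact that operators which are
  linearly dependent at every vector have a nontrivial combination of bounded rank, valid over all
  fields (\<open>exists_separating_vector\<close>). On a tile, multiplication with a fixed generator is left
  multiplication in $\<Gamma>$ except at the few boundary points of $F$. So two approximations of the same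
  size are conjugate up to small rank by a map that matches their tiles (\<open>matching_tiles_close\<close>).

  If $\<Gamma>$ is residually finite, the models are permutation representations on copies of a finite
  quotient. That a nonzero $a$ acts with almost full rank is proved by averaging: locally, a kernel
  vector is an element of $K\<Gamma>$ supported on a Folner set whose product with $a$ is supported on the
  boundary, and multiplication with $a$ is injective because $K\<Gamma>$ is a domain
  (\<open>perm_rep_rank\<close>).

  Conversely, compressing the regular representation to Folner sets gives $d$-approximations for every
  $d$ (\<open>exists_approximation\<close>). By weak stability there is a representation $\<psi>$ nearby; given
  $\<gamma> \<noteq> 1$, the matrix of $\<gamma> - 1$ has almost full rank, so $\<psi>(\<gamma>) \<noteq> \<psi>(1)$, and
  Malcev's theorem (\<open>malcev\<close>) separates $\<gamma>$ from 1 in a finite quotient of $\<Gamma>$. Its ring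
  theoretic input is that finitely generated subrings of a field have enough finite quotients
  (\<open>finitely_generated_subring\<close>).

  Folner sets are obtained from the invariant mean: if every finite set at least doubled under
  translation by a fixed finite set, the marriage theorem would give a paradoxical decomposition
  (\<open>amenable_no_doubling\<close>).
\<close>

section \<open>Folner sets from an invariant mean\<close>

text \<open>The pairs of the relation join an index to its admissible representatives.\<close>

definition hall_condition :: "('i \<times> 'x) set \<Rightarrow> bool" where
  "hall_condition R \<longleftrightarrow> (\<forall>J. finite J \<longrightarrow> card J \<le> card (R `` J))"

text \<open>
  This is where compactness enters. For a finite set $J$ of indices only finitely many pairs matter,
  so a chain of relations contains a member that already agrees over $J$ with the intersection of
  the chain; hence the intersection inherits Hall's condition and Zorn's lemma applies. The chain is
  written in terms of the removed pairs $D$.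
\<close>

lemma hall_condition_minimal:
  assumes fin: "\<And>i. finite (R `` {i})" and hall: "hall_condition R"
  obtains R' where "R' \<subseteq> R" "hall_condition R'"
    "\<And>D. D \<subseteq> R' \<Longrightarrow> hall_condition (R' - D) \<Longrightarrow> D = {}"
proof -
  define \<A> where "\<A> = {D. D \<subseteq> R \<and> hall_condition (R - D)}"
  have finJ: "finite (R `` J)" if "finite J" for J
  proof -
    have "R `` J = (\<Union>i\<in>J. R `` {i})" by auto
    then show ?thesis using that fin by simp
  qed
  have "\<exists>M\<in>\<A>. \<forall>X\<in>\<A>. M \<subseteq> X \<longrightarrow> X = M"
  proof (rule subset_Zorn_nonempty)
    show "\<A> \<noteq> {}" using hall unfolding \<A>_def by auto
    fix C assume C: "C \<noteq> {}" "subset.chain \<A> C"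
    have sub: "D \<subseteq> R" "hall_condition (R - D)" if "D \<in> C" for D
      using C that unfolding \<A>_def subset.chain_def by auto
    have "card J \<le> card ((R - \<Union>C) `` J)" if J: "finite J" for J
    proof -
      define part where "part D = (R - D) \<inter> (J \<times> UNIV)" for D
      have finp: "finite (part D)" for D
      proof (rule finite_subset)
        show "part D \<subseteq> J \<times> (R `` J)" unfolding part_def by auto
        show "finite (J \<times> (R `` J))" using J finJ by simp
      qed
      obtain D where D: "D \<in> C" and least: "\<And>D'. D' \<in> C \<Longrightarrow> card (part D) \<le> card (part D')"
        using C(1) ex_has_least_nat[of "\<lambda>D. D \<in> C" _ "\<lambda>D. card (part D)"] by blast
      have "part D \<subseteq> part D'" if D': "D' \<in> C" for D'
      proof (cases "D' \<subseteq> D")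
        case True
        then show ?thesis unfolding part_def by auto
      next
        case False
        then have "D \<subseteq> D'" using C(2) D D' unfolding subset.chain_def by blast
        then have "part D' \<subseteq> part D" unfolding part_def by auto
        then show ?thesis using card_seteq[OF finp] least[OF D'] by blast
      qed
      then have sub_part: "part D \<subseteq> part D'" if "D' \<in> C" for D' using that by blast
      have "(R - D) `` J \<subseteq> (R - \<Union>C) `` J"
      proof
        fix z assume "z \<in> (R - D) `` J"
        then obtain j where j: "j \<in> J" "(j, z) \<in> R - D" by blast
        then have "(j, z) \<in> part D" unfolding part_def by blast
        then have "(j, z) \<in> part D'" if "D' \<in> C" for D'
          using sub_part[OF that] by blast
        then have "\<forall>D'\<in>C. (j, z) \<notin> D'" unfolding part_def by simp
        then have "(j, z) \<in> R - \<Union>C" using j(2) by auto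
        then show "z \<in> (R - \<Union>C) `` J" using j(1) by (rule ImageI)
      qed
      moreover have "finite ((R - \<Union>C) `` J)" 
        by (rule finite_subset[OF Image_mono[OF Diff_subset subset_refl] finJ[OF J]])
      ultimately have "card ((R - D) `` J) \<le> card ((R - \<Union>C) `` J)" by (rule card_mono[rotated])
      moreover have "card J \<le> card ((R - D) `` J)"
        using sub(2)[OF D] J unfolding hall_condition_def by blast
      ultimately show ?thesis by linarith
    qed
    moreover have "\<Union>C \<subseteq> R" using sub by blast
    ultimately show "\<Union>C \<in> \<A>" unfolding \<A>_def hall_condition_def by blast
  qed
  then obtain M where M: "M \<in> \<A>" "\<And>X. X \<in> \<A> \<Longrightarrow> M \<subseteq> X \<Longrightarrow> X = M" by blast
  show ?thesis
  proof (rule that[of "R - M"])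
    show "R - M \<subseteq> R" "hall_condition (R - M)" using M(1) unfolding \<A>_def by auto
    fix D assume D: "D \<subseteq> R - M" "hall_condition (R - M - D)"
    have "R - (M \<union> D) = R - M - D" by blast
    then have "M \<union> D \<in> \<A>" using D M(1) unfolding \<A>_def by auto
    then show "D = {}" using M(2)[of "M \<union> D"] D(1) by blast
  qed
qed

text \<open>
  Rado's argument. In a minimal relation every index has exactly one representative: if $i$ had two,
  removing either pair would violate the condition on finite sets $J_1$, $J_2$ containing $i$, and
  adding the two violations contradicts the condition for $J_1 \<union> J_2$ and for
  $J_1 \<inter> J_2$ without $i$.
\<close>

lemma hall_locally_finite:
  assumes fin: "\<And>i. finite (R `` {i})" and hall: "hall_condition R"
  obtains f where "inj f" "\<And>i. (i, f i) \<in> R"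
proof -
  obtain R' where R': "R' \<subseteq> R" and hall': "hall_condition R'"
    and minimal: "\<And>D. D \<subseteq> R' \<Longrightarrow> hall_condition (R' - D) \<Longrightarrow> D = {}"
    using hall_condition_minimal[OF assms] by metis
  have hallJ: "card J \<le> card (R' `` J)" if "finite J" for J
    using hall' that unfolding hall_condition_def by blast
  have finJ: "finite (R'' `` J)" if "finite J" "R'' \<subseteq> R" for R'' J
  proof (rule finite_subset)
    show "R'' `` J \<subseteq> (\<Union>i\<in>J. R `` {i})" using that(2) by auto
    show "finite (\<Union>i\<in>J. R `` {i})" using that(1) fin by simp
  qed
  have violation: "\<exists>J. finite J \<and> i \<in> J \<and> card ((R' - {(i, x)}) `` J) < card J"
    if "(i, x) \<in> R'" for i x
  proof -
    have "\<not> hall_condition (R' - {(i, x)})" using minimal[of "{(i, x)}"] that by auto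
    then obtain J where J: "finite J" "card ((R' - {(i, x)}) `` J) < card J"
      unfolding hall_condition_def by (meson not_le)
    have "i \<in> J"
    proof (rule ccontr)
      assume "i \<notin> J"
      then have "(R' - {(i, x)}) `` J = R' `` J" by auto
      then show False using J hallJ[of J] by simp
    qed
    then show ?thesis using J by blast
  qed
  have single: "x = y" if xy: "(i, x) \<in> R'" "(i, y) \<in> R'" for i x y
  proof (rule ccontr)
    assume ne: "x \<noteq> y"
    obtain J1 where J1: "finite J1" "i \<in> J1" "card ((R' - {(i, x)}) `` J1) < card J1"
      using violation[OF xy(1)] by blast
    obtain J2 where J2: "finite J2" "i \<in> J2" "card ((R' - {(i, y)}) `` J2) < card J2"
      using violation[OF xy(2)] by blast
    define X where "X = (R' - {(i, x)}) `` J1"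
    define Y where "Y = (R' - {(i, y)}) `` J2"
    have finXY: "finite X" "finite Y"
      unfolding X_def Y_def using J1(1) J2(1) R' by (auto intro!: finJ)
    have "R' `` (J1 \<union> J2) \<subseteq> X \<union> Y" unfolding X_def Y_def using J1(2) J2(2) ne by auto
    then have "card (R' `` (J1 \<union> J2)) \<le> card (X \<union> Y)" using finXY by (intro card_mono) auto
    then have 1: "card (J1 \<union> J2) \<le> card (X \<union> Y)"
      using hallJ[of "J1 \<union> J2"] J1(1) J2(1) by simp
    have "R' `` (J1 \<inter> J2 - {i}) \<subseteq> X \<inter> Y" unfolding X_def Y_def by auto
    then have "card (R' `` (J1 \<inter> J2 - {i})) \<le> card (X \<inter> Y)" using finXY by (intro card_mono) auto
    then have 2: "card (J1 \<inter> J2 - {i}) \<le> card (X \<inter> Y)"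
      using hallJ[of "J1 \<inter> J2 - {i}"] J1(1) by simp
    have "card (J1 \<inter> J2 - {i}) = card (J1 \<inter> J2) - 1" "card (J1 \<inter> J2) > 0"
      using J1 J2 by (auto simp: card_gt_0_iff)
    then show False
      using 1 2 J1(3) J2(3) card_Un_Int[OF finXY] card_Un_Int[OF J1(1) J2(1)]
      unfolding X_def[symmetric] Y_def[symmetric] by linarith
  qed
  have "\<exists>x. (i, x) \<in> R'" for i
  proof -
    have "card {i} \<le> card (R' `` {i})" by (rule hallJ) simp
    then have "R' `` {i} \<noteq> {}" by auto
    then show ?thesis by blast
  qed
  then obtain f where f: "\<And>i. (i, f i) \<in> R'" by metis
  have "inj f"
  proof (rule injI, rule ccontr)
    fix i j assume ij: "f i = f j" "i \<noteq> j"
    have "x = f i" if "x \<in> R' `` {i, j}" for x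
      using that single[OF f] ij(1) by (metis ImageE insertE singletonD)
    then have "R' `` {i, j} \<subseteq> {f i}" by blast
    then have "card (R' `` {i, j}) \<le> 1" using card_mono[of "{f i}"] by simp
    moreover have "card {i, j} \<le> card (R' `` {i, j})" by (rule hallJ) simp
    ultimately show False using ij(2) by simp
  qed
  then show ?thesis using that f R' by blast
qed

definition sumset :: "'g::plus set \<Rightarrow> 'g set \<Rightarrow> 'g set" where
  "sumset E F = (\<Union>e\<in>E. (+) e ` F)"

lemma in_sumset: "e \<in> E \<Longrightarrow> f \<in> F \<Longrightarrow> e + f \<in> sumset E F"
  unfolding sumset_def by blast

lemma finite_sumset [simp]: "finite E \<Longrightarrow> finite F \<Longrightarrow> finite (sumset E F)"
  unfolding sumset_def by simp

lemma subset_sumset: "0 \<in> E \<Longrightarrow> F \<subseteq> sumset E (F :: 'g::monoid_add set)"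
  unfolding sumset_def by force

lemma sumset_assoc: "sumset (sumset A B) C = sumset A (sumset B (C :: 'g::semigroup_add set))"
  unfolding sumset_def by (force simp: add.assoc image_iff)

text \<open>
  If $|T + F| \<ge> 2 |F|$ for all finite $F$, Hall's theorem gives an injection of two copies of the
  group into the group that moves every point by an element of $T$. Cutting both copies according to
  the translation used is a paradoxical decomposition: an invariant mean would give the two copies
  total mass 2 inside a set of mass 1.
\<close>

lemma amenable_no_doubling:
  assumes am: "amenable (group_of_type :: 'g::group_add monoid)" and T: "finite T"
  shows "\<exists>F :: 'g set. finite F \<and> card (sumset T F) < 2 * card F"
proof (rule ccontr)
  assume "\<not> ?thesis"
  then have dbl: "2 * card F \<le> card (sumset T F)" if "finite F" for F :: "'g set"
    using that by (meson not_le)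
  define R :: "(('g \<times> bool) \<times> 'g) set" where "R = {((g, b), t + g) |g b t. t \<in> T}"
  have R_Im: "R `` J = sumset T (fst ` J)" for J
    unfolding R_def sumset_def by force
  have "hall_condition R"
    unfolding hall_condition_def
  proof (intro allI impI)
    fix J :: "('g \<times> bool) set" assume J: "finite J"
    have "card J \<le> card (fst ` J \<times> (UNIV :: bool set))"
    proof (rule card_mono)
      show "J \<subseteq> fst ` J \<times> UNIV" by (simp add: subset_fst_snd subsetI mem_Times_iff)
      show "finite (fst ` J \<times> (UNIV :: bool set))" using J by simp
    qed
    also have "\<dots> = 2 * card (fst ` J)" by (simp add: card_cartesian_product)
    also have "\<dots> \<le> card (R `` J)" unfolding R_Im using J by (intro dbl) simp
    finally show "card J \<le> card (R `` J)" .
  qed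
  moreover have "finite (R `` {i})" for i unfolding R_Im using T by simp
  ultimately obtain f where f: "inj f" "\<And>i. (i, f i) \<in> R" using hall_locally_finite by blast
  define B where "B = (\<lambda>(t, b). {g. f (g, b) = t + g})"
  have fT: "\<exists>t\<in>T. f (g, b) = t + g" for g b using f(2)[of "(g, b)"] unfolding R_def by auto
  obtain \<mu> :: "'g set \<Rightarrow> real" where
    pos: "\<And>A. 0 \<le> \<mu> A" and one: "\<mu> UNIV = 1"
    and add: "\<And>A B. A \<inter> B = {} \<Longrightarrow> \<mu> (A \<union> B) = \<mu> A + \<mu> B"
    and inv: "\<And>g A. \<mu> ((+) g ` A) = \<mu> A"
  proof -
    have l: "g <#\<^bsub>group_of_type\<^esub> A = (+) g ` A" for g :: 'g and A
      unfolding l_coset_def group_of_type_def by auto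
    obtain \<mu> :: "'g set \<Rightarrow> real" where
      "(\<forall>A. 0 \<le> \<mu> A) \<and> \<mu> UNIV = 1 \<and>
       (\<forall>A B. A \<inter> B = {} \<longrightarrow> \<mu> (A \<union> B) = \<mu> A + \<mu> B) \<and> (\<forall>g A. \<mu> ((+) g ` A) = \<mu> A)"
      using am unfolding amenable_def l by (auto simp: group_of_type_def)
    then show ?thesis using that by blast
  qed
  have empty: "\<mu> {} = 0" using add[of "{}" "{}"] by simp
  have fam: "\<mu> (\<Union>i\<in>I. A i) = (\<Sum>i\<in>I. \<mu> (A i))"
    if "finite I" "disjoint_family_on A I" for A :: "'i \<Rightarrow> 'g set" and I
    using that
  proof (induction I rule: finite_induct)
    case empty
    then show ?case using \<open>\<mu> {} = 0\<close> by simp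
  next
    case (insert i I)
    have "A i \<inter> (\<Union>i\<in>I. A i) = {}"
      using insert.prems insert.hyps(2) by (simp add: disjoint_family_on_insert)
    moreover have "disjoint_family_on A I"
      using insert.prems by (rule disjoint_family_on_mono[rotated]) auto
    ultimately show ?case using insert by (simp add: add)
  qed
  define I where "I = T \<times> (UNIV :: bool set)"
  have finI: "finite I" unfolding I_def using T by simp
  have disj: "disjoint_family_on (\<lambda>p. (+) (fst p) ` B p) I"
    unfolding disjoint_family_on_def
  proof (intro ballI impI)
    fix p p' :: "'g \<times> bool" assume ne: "p \<noteq> p'"
    show "(+) (fst p) ` B p \<inter> (+) (fst p') ` B p' = {}"
    proof (rule ccontr)
      assume "\<not> ?thesis"
      then obtain g h where gh: "g \<in> B p" "h \<in> B p'" "fst p + g = fst p' + h" by blast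
      then have "f (g, snd p) = f (h, snd p')" unfolding B_def by (auto split: prod.splits)
      then have "g = h" "snd p = snd p'" using f(1) by (auto dest: injD)
      then show False using ne gh(3) by (simp add: prod_eq_iff)
    qed
  qed
  have "(\<Sum>p\<in>I. \<mu> (B p)) = \<mu> (\<Union>p\<in>I. (+) (fst p) ` B p)"
    unfolding fam[OF finI disj] inv ..
  also have "\<mu> A \<le> 1" for A
    using add[of A "- A"] pos[of "- A"] one by (simp add: Compl_partition)
  finally have le: "(\<Sum>p\<in>I. \<mu> (B p)) \<le> 1" .
  have "(\<Sum>t\<in>T. \<mu> (B (t, b))) = 1" for b
  proof -
    have "disjoint_family_on (\<lambda>t. B (t, b)) T" unfolding disjoint_family_on_def B_def by auto
    then have "(\<Sum>t\<in>T. \<mu> (B (t, b))) = \<mu> (\<Union>t\<in>T. B (t, b))" using fam[OF T] by simp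
    also have "(\<Union>t\<in>T. B (t, b)) = UNIV" unfolding B_def using fT by auto
    finally show ?thesis using one by simp
  qed
  then have "(\<Sum>b\<in>UNIV. \<Sum>t\<in>T. \<mu> (B (t, b))) = 2" by simp
  moreover have "(\<Sum>p\<in>I. \<mu> (B p)) = (\<Sum>b\<in>UNIV. \<Sum>t\<in>T. \<mu> (B (t, b)))"
    unfolding I_def by (subst sum.swap) (simp add: sum.cartesian_product)
  ultimately show False using le by simp
qed

text \<open>
  Otherwise adding $E$ multiplies all cardinalities by more than $1 + \<delta>$, and adding $E$ often
  enough doubles them.
\<close>

lemma amenable_folner:
  fixes E :: "'g::group_add set"
  assumes am: "amenable (group_of_type :: 'g monoid)"
    and E: "finite E" and \<delta>: "\<delta> > (0::real)"
  obtains F :: "'g set" where "finite F" "F \<noteq> {}" "real (card (sumset E F)) \<le> (1 + \<delta>) * real (card F)"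
proof -
  have "\<exists>F. finite F \<and> F \<noteq> {} \<and> real (card (sumset E F)) \<le> (1 + \<delta>) * real (card F)"
  proof (rule ccontr)
    assume no: "\<not> ?thesis"
    have grow: "(1 + \<delta>) * real (card F) \<le> real (card (sumset E F))" if "finite F" for F
    proof (cases "F = {}")
      case True
      then show ?thesis by simp
    next
      case False
      then show ?thesis using no that by (meson not_le less_imp_le)
    qed
    define pow where "pow k = (sumset E ^^ k) {0}" for k
    have fin: "finite (pow k)" for k unfolding pow_def using E by (induction k) auto
    have pow_grow: "(1 + \<delta>) ^ k * real (card F) \<le> real (card (sumset (pow k) F))"
      if F: "finite F" for k F
    proof (induction k)
      case 0
      then show ?case unfolding pow_def sumset_def by simp
    next
      case (Suc k)
      have "(1 + \<delta>) ^ Suc k * real (card F) \<le> (1 + \<delta>) * real (card (sumset (pow k) F))"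
        using mult_left_mono[OF Suc, of "1 + \<delta>"] \<delta> by (simp add: mult.assoc)
      also have "\<dots> \<le> real (card (sumset E (sumset (pow k) F)))"
        using fin F by (intro grow) simp
      also have "sumset E (sumset (pow k) F) = sumset (pow (Suc k)) F"
        unfolding pow_def by (simp add: sumset_assoc)
      finally show ?case .
    qed
    obtain k where k: "2 < (1 + \<delta>) ^ k" using real_arch_pow[of "1 + \<delta>" 2] \<delta> by auto
    obtain F :: "'g set" where F: "finite F" "card (sumset (pow k) F) < 2 * card F"
      using amenable_no_doubling[OF am fin] by blast
    have "2 * real (card F) \<le> (1 + \<delta>) ^ k * real (card F)" using k by (intro mult_right_mono) auto
    also have "\<dots> \<le> real (card (sumset (pow k) F))" by (rule pow_grow[OF F(1)])
    finally show False using F(2) by linarith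
  qed
  then show ?thesis using that by blast
qed


section \<open>Finite quotients of finitely generated subrings of a field\<close>

definition subring_of :: "'r::comm_ring_1 set \<Rightarrow> bool" where
  "subring_of A \<longleftrightarrow> 1 \<in> A \<and> (\<forall>x\<in>A. \<forall>y\<in>A. x - y \<in> A \<and> x * y \<in> A)"

definition ideal_of :: "'r::comm_ring_1 set \<Rightarrow> 'r set \<Rightarrow> bool" where
  "ideal_of I A \<longleftrightarrow>
     I \<subseteq> A \<and> 0 \<in> I \<and> (\<forall>x\<in>I. \<forall>y\<in>I. x - y \<in> I) \<and> (\<forall>a\<in>A. \<forall>x\<in>I. a * x \<in> I)"

definition finite_index_in :: "'r::comm_ring_1 set \<Rightarrow> 'r set \<Rightarrow> bool" where
  "finite_index_in I A \<longleftrightarrow> (\<exists>R. finite R \<and> R \<subseteq> A \<and> (\<forall>a\<in>A. \<exists>r\<in>R. a - r \<in> I))"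

text \<open>
  This is residual finiteness of a ring in a form that is inherited by simple extensions: a nonzero
  element does not merely survive in a finite quotient, it becomes a unit there, so several nonzero
  elements of a domain can be treated at once through their product.
\<close>

definition finite_quotients_detect_units :: "'r::comm_ring_1 set \<Rightarrow> bool" where
  "finite_quotients_detect_units A \<longleftrightarrow> subring_of A \<and>
     (\<forall>r\<in>A. r \<noteq> 0 \<longrightarrow>
        (\<exists>I. ideal_of I A \<and> 1 \<notin> I \<and> finite_index_in I A \<and> (\<exists>b\<in>A. b * r - 1 \<in> I)))"

lemma subring_ofD:
  assumes "subring_of A"
  shows "0 \<in> A" "1 \<in> A" "x \<in> A \<Longrightarrow> - x \<in> A" "x \<in> A \<Longrightarrow> y \<in> A \<Longrightarrow> x + y \<in> A"
    "x \<in> A \<Longrightarrow> y \<in> A \<Longrightarrow> x - y \<in> A" "x \<in> A \<Longrightarrow> y \<in> A \<Longrightarrow> x * y \<in> A" "x \<in> A \<Longrightarrow> x ^ k \<in> A"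
proof -
  have one: "1 \<in> A" using assms unfolding subring_of_def by blast
  have diff: "x - y \<in> A" and mult: "x * y \<in> A" if "x \<in> A" "y \<in> A" for x y
    using assms that unfolding subring_of_def by blast+
  have zero: "0 \<in> A" using diff[OF one one] by simp
  have minus: "- x \<in> A" if "x \<in> A" for x using diff[OF zero that] by simp
  have "x ^ k \<in> A" if "x \<in> A" for x k using that mult one by (induction k) auto
  moreover have "x + y \<in> A" if "x \<in> A" "y \<in> A" for x y
    using diff[OF that(1) minus[OF that(2)]] by simp
  ultimately show "0 \<in> A" "1 \<in> A" "x \<in> A \<Longrightarrow> - x \<in> A"
    "x \<in> A \<Longrightarrow> y \<in> A \<Longrightarrow> x + y \<in> A" "x \<in> A \<Longrightarrow> y \<in> A \<Longrightarrow> x - y \<in> A"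
    "x \<in> A \<Longrightarrow> y \<in> A \<Longrightarrow> x * y \<in> A" "x \<in> A \<Longrightarrow> x ^ k \<in> A"
    using zero one minus diff mult by auto
qed

lemma ideal_ofD:
  assumes "ideal_of I A"
  shows "x \<in> I \<Longrightarrow> x \<in> A" "0 \<in> I" "x \<in> I \<Longrightarrow> - x \<in> I" "x \<in> I \<Longrightarrow> y \<in> I \<Longrightarrow> x + y \<in> I"
    "x \<in> I \<Longrightarrow> y \<in> I \<Longrightarrow> x - y \<in> I" "a \<in> A \<Longrightarrow> x \<in> I \<Longrightarrow> a * x \<in> I" "a \<in> A \<Longrightarrow> x \<in> I \<Longrightarrow> x * a \<in> I"
proof -
  have sub: "x \<in> A" if "x \<in> I" for x using assms that unfolding ideal_of_def by blast
  have zero: "0 \<in> I" using assms unfolding ideal_of_def by blast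
  have diff: "x - y \<in> I" if "x \<in> I" "y \<in> I" for x y
    using assms that unfolding ideal_of_def by blast
  have mult: "a * x \<in> I" if "a \<in> A" "x \<in> I" for a x
    using assms that unfolding ideal_of_def by blast
  have minus: "- x \<in> I" if "x \<in> I" for x using diff[OF zero that] by simp
  have "x + y \<in> I" if "x \<in> I" "y \<in> I" for x y using diff[OF that(1) minus[OF that(2)]] by simp
  then show "x \<in> I \<Longrightarrow> x \<in> A" "0 \<in> I" "x \<in> I \<Longrightarrow> - x \<in> I" "x \<in> I \<Longrightarrow> y \<in> I \<Longrightarrow> x + y \<in> I"
    "x \<in> I \<Longrightarrow> y \<in> I \<Longrightarrow> x - y \<in> I" "a \<in> A \<Longrightarrow> x \<in> I \<Longrightarrow> a * x \<in> I" "a \<in> A \<Longrightarrow> x \<in> I \<Longrightarrow> x * a \<in> I"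
    using sub zero diff mult minus by (auto simp: mult.commute)
qed

lemma sum_in_ideal:
  assumes "ideal_of I A" "\<And>i. i \<in> X \<Longrightarrow> f i \<in> I"
  shows "sum f X \<in> I"
  using assms(2)
  by (induction X rule: infinite_finite_induct) (auto intro: ideal_ofD[OF assms(1)])

lemma subring_ideal_self: "subring_of A \<Longrightarrow> ideal_of A A"
  unfolding ideal_of_def by (auto dest: subring_ofD)

lemma ideal_power_minus_one:
  assumes "subring_of A" "ideal_of I A" "x \<in> A" "x - 1 \<in> I"
  shows "x ^ k - 1 \<in> I"
proof (induction k)
  case 0
  show ?case using ideal_ofD(2)[OF assms(2)] by simp
next
  case (Suc k)
  have "x ^ Suc k - 1 = x * (x ^ k - 1) + (x - 1)" by (simp add: algebra_simps)
  then show ?case using Suc assms ideal_ofD(4,6)[OF assms(2)] by metis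
qed

definition polys :: "'r::comm_ring_1 set \<Rightarrow> 'r poly set" where
  "polys A = {p. \<forall>i. coeff p i \<in> A}"

lemma polys_ideal:
  assumes A: "subring_of A" and I: "ideal_of I A"
  shows "subring_of (polys A)" "ideal_of (polys I) (polys A)"
proof -
  have mult: "p * q \<in> polys J" if "ideal_of J A" "p \<in> polys A" "q \<in> polys J" for p q J
    using that unfolding polys_def
    by (auto simp: coeff_mult intro!: sum_in_ideal[OF that(1)] ideal_ofD(6)[OF that(1)])
  show "subring_of (polys A)"
    unfolding subring_of_def
    using mult[OF subring_ideal_self[OF A]]
    by (auto simp: polys_def subring_ofD[OF A] coeff_1)
  show "ideal_of (polys I) (polys A)"
    unfolding ideal_of_def using mult[OF I] ideal_ofD[OF I] by (auto simp: polys_def)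
qed

lemma polys_monom: "0 \<in> A \<Longrightarrow> a \<in> A \<Longrightarrow> monom a n \<in> polys A"
  unfolding polys_def by simp

lemma polys_smult: "subring_of A \<Longrightarrow> a \<in> A \<Longrightarrow> p \<in> polys A \<Longrightarrow> Polynomial.smult a p \<in> polys A"
  unfolding polys_def by (simp add: subring_ofD)

text \<open>
  Over a ring one may divide by $g$ only after multiplying with a power of its leading coefficient.
  Later this coefficient is invertible modulo an ideal, so the power does no harm.
\<close>

lemma pseudo_division:
  fixes f g :: "'r::idom poly"
  assumes A: "subring_of A" and g: "g \<in> polys A" "g \<noteq> 0" and f: "f \<in> polys A"
  shows "\<exists>k t \<rho>. t \<in> polys A \<and> \<rho> \<in> polys A \<and> Polynomial.smult (lead_coeff g ^ k) f = g * t + \<rho> \<and>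
    (\<rho> = 0 \<or> degree \<rho> < degree g)"
  using f
proof (induction "degree f" arbitrary: f rule: less_induct)
  case less
  note PA = polys_ideal(1)[OF A subring_ideal_self[OF A]]
  show ?case
  proof (cases "f = 0 \<or> degree f < degree g")
    case True
    then show ?thesis using less.prems subring_ofD(1)[OF PA]
      by (intro exI[of _ 0] exI[of _ "0 :: 'r poly"] exI[of _ f]) auto
  next
    case False
    then have f0: "f \<noteq> 0" and deg: "degree g \<le> degree f" by auto
    define m where "m = monom (lead_coeff f) (degree f - degree g)"
    define f' where "f' = Polynomial.smult (lead_coeff g) f - g * m"
    have lc: "lead_coeff f \<in> A" "lead_coeff g \<in> A" using less.prems g(1) by (auto simp: polys_def)
    have m: "m \<in> polys A" unfolding m_def using lc subring_ofD(1)[OF A] by (intro polys_monom)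
    have f': "f' \<in> polys A" unfolding f'_def
      using m g(1) lc less.prems PA A by (intro subring_ofD(5,6)[OF PA] polys_smult)
    have "m \<noteq> 0" "degree m = degree f - degree g" "lead_coeff m = lead_coeff f"
      using f0 unfolding m_def by (auto simp: degree_monom_eq)
    then have "degree (g * m) = degree f" "coeff (g * m) (degree f) = lead_coeff g * lead_coeff f"
      using g(2) deg by (simp_all add: degree_mult_eq) (metis coeff_mult_degree_sum le_add_diff_inverse)
    then have "degree f' \<le> degree f" "coeff f' (degree f) = 0"
      unfolding f'_def by (auto intro!: degree_diff_le)
    then have small: "f' = 0 \<or> degree f' < degree f" by (rule eq_zero_or_degree_less)
    obtain k t \<rho> where IH: "t \<in> polys A" "\<rho> \<in> polys A" "Polynomial.smult (lead_coeff g ^ k) f' = g * t + \<rho>"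
      "\<rho> = 0 \<or> degree \<rho> < degree g"
    proof (cases "f' = 0")
      case True
      then show ?thesis using that[of 0 0 0] subring_ofD(1)[OF PA] by simp
    next
      case False
      then show ?thesis using small less.hyps[OF _ f'] that by blast
    qed
    have "Polynomial.smult (lead_coeff g ^ Suc k) f = Polynomial.smult (lead_coeff g ^ k) (f' + g * m)"
      unfolding f'_def by (simp add: mult.commute)
    also have "\<dots> = g * (t + Polynomial.smult (lead_coeff g ^ k) m) + \<rho>"
      unfolding smult_add_right IH(3) by (simp add: algebra_simps)
    finally have "Polynomial.smult (lead_coeff g ^ Suc k) f = g * (t + Polynomial.smult (lead_coeff g ^ k) m) + \<rho>" .
    moreover have "t + Polynomial.smult (lead_coeff g ^ k) m \<in> polys A"
      using IH(1) m lc by (intro subring_ofD(4)[OF PA] polys_smult[OF A] subring_ofD(7)[OF A])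
    ultimately show ?thesis using IH(2,4) by blast
  qed
qed

text \<open>
  Modulo $I$ the polynomial $g$ has an invertible leading coefficient. Hence division by $g$ is
  possible, which leaves finitely many remainders, and $g$ of positive degree cannot divide 1. The
  ideal $J$ is the preimage of the ideal generated by $g$ in the polynomial ring over the quotient
  of $A$ by $I$.
\<close>

lemma polynomial_quotient:
  fixes g :: "'r::idom poly"
  assumes A: "subring_of A" and I: "ideal_of I A" and proper: "1 \<notin> I" and fin: "finite_index_in I A"
    and g: "g \<in> polys A" "degree g > 0" and b: "b \<in> A" "b * lead_coeff g - 1 \<in> I"
  defines "J \<equiv> {i + g * h |i h. i \<in> polys I \<and> h \<in> polys A}"
  shows "ideal_of J (polys A)" "1 \<notin> J" "finite_index_in J (polys A)"
proof -
  note PA = polys_ideal(1)[OF A I] and PI = polys_ideal(2)[OF A I]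
  have lcA: "lead_coeff g \<in> A" using g(1) by (simp add: polys_def)
  have JI: "i + g * h \<in> J" if "i \<in> polys I" "h \<in> polys A" for i h
    unfolding J_def using that by blast
  show J: "ideal_of J (polys A)"
    unfolding ideal_of_def
  proof (intro conjI ballI)
    show "J \<subseteq> polys A"
    proof
      fix x assume "x \<in> J"
      then obtain i h where *: "i \<in> polys I" "h \<in> polys A" "x = i + g * h" unfolding J_def by blast
      show "x \<in> polys A"
        unfolding *(3)
        by (rule subring_ofD(4)[OF PA ideal_ofD(1)[OF PI *(1)] subring_ofD(6)[OF PA g(1) *(2)]])
    qed
    show "0 \<in> J" using JI[OF ideal_ofD(2)[OF PI] subring_ofD(1)[OF PA]] by simp
    fix x y assume "x \<in> J" "y \<in> J"
    then obtain i h i' h' where *: "i \<in> polys I" "h \<in> polys A" "i' \<in> polys I" "h' \<in> polys A"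
      "x = i + g * h" "y = i' + g * h'" unfolding J_def by blast
    have "x - y = (i - i') + g * (h - h')" unfolding * by (simp add: algebra_simps)
    then show "x - y \<in> J" using JI * ideal_ofD(5)[OF PI] subring_ofD(5)[OF PA] by metis
  next
    fix a x assume a: "a \<in> polys A" and "x \<in> J"
    then obtain i h where *: "i \<in> polys I" "h \<in> polys A" "x = i + g * h" unfolding J_def by blast
    have "a * x = a * i + g * (a * h)" unfolding * by (simp add: algebra_simps)
    then show "a * x \<in> J" using JI * a ideal_ofD(6)[OF PI] subring_ofD(6)[OF PA] by metis
  qed
  have lead_in_I: "c \<in> I" if "c \<in> A" "lead_coeff g * c \<in> I" for c
  proof -
    have "c = b * (lead_coeff g * c) - c * (b * lead_coeff g - 1)" by (simp add: algebra_simps)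
    then show ?thesis using that b ideal_ofD(5,6)[OF I] by metis
  qed
  \<comment> \<open>the top coefficient of h lies in I and can be moved into i, so induct on the degree of h\<close>
  have no_unit: "1 \<noteq> i + g * h"
    if "h = 0 \<or> degree h < n" "i \<in> polys I" "h \<in> polys A" for n i h
    using that
  proof (induction n arbitrary: i h)
    case 0
    show ?case
    proof
      assume "1 = i + g * h"
      then have "coeff i 0 = 1" using 0(1) by simp
      then show False using 0(2) proper unfolding polys_def by (metis mem_Collect_eq)
    qed
  next
    case (Suc n)
    show ?case
    proof (cases "h = 0")
      case True
      then show ?thesis using Suc.IH[of h i] Suc.prems by simp
    next
      case False
      show ?thesis
      proof
        assume eq: "1 = i + g * h"
        define m where "m = monom (lead_coeff h) (degree h)"
        have "0 = coeff (1 :: 'r poly) (degree g + degree h)" using g(2) by (simp add: coeff_1)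
        also have "\<dots> = coeff i (degree g + degree h) + lead_coeff g * lead_coeff h"
          unfolding eq by (simp add: coeff_mult_degree_sum)
        finally have "lead_coeff g * lead_coeff h = - coeff i (degree g + degree h)"
          by (simp add: eq_neg_iff_add_eq_0 add.commute)
        then have "lead_coeff g * lead_coeff h \<in> I"
          using Suc.prems(2) ideal_ofD(3)[OF I] unfolding polys_def by simp
        then have "lead_coeff h \<in> I" using lead_in_I Suc.prems(3) unfolding polys_def by blast
        then have m: "m \<in> polys I" unfolding m_def using ideal_ofD(2)[OF I] by (intro polys_monom)
        have "degree (h - m) \<le> degree h"
          unfolding m_def by (intro degree_diff_le order_refl degree_monom_le)
        moreover have "coeff (h - m) (degree h) = 0" unfolding m_def by simp
        ultimately have "h - m = 0 \<or> degree (h - m) < degree h" by (rule eq_zero_or_degree_less)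
        then have "h - m = 0 \<or> degree (h - m) < n" using Suc.prems(1) False by auto
        moreover have "i + g * m \<in> polys I"
          using Suc.prems(2) m g(1) by (intro ideal_ofD(4,6)[OF PI])
        moreover have "h - m \<in> polys A"
          using Suc.prems(3) ideal_ofD(1)[OF PI m] by (rule subring_ofD(5)[OF PA])
        ultimately have "1 \<noteq> (i + g * m) + g * (h - m)" by (rule Suc.IH)
        then show False using eq by (simp add: algebra_simps)
      qed
    qed
  qed
  show "1 \<notin> J"
  proof
    assume "1 \<in> J"
    then obtain i h where "i \<in> polys I" "h \<in> polys A" "1 = i + g * h" unfolding J_def by blast
    then show False using no_unit[of h "Suc (degree h)" i] by simp
  qed
  obtain R where R: "finite R" "R \<subseteq> A" "\<And>a. a \<in> A \<Longrightarrow> \<exists>r\<in>R. a - r \<in> I"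
    using fin unfolding finite_index_in_def by blast
  define N where "N = degree g"
  define Q where "Q = (\<lambda>c. \<Sum>i<N. monom (c i) i) ` ({..<N} \<rightarrow>\<^sub>E R)"
  have "finite Q" unfolding Q_def using R(1) by (intro finite_imageI finite_PiE) auto
  moreover have "Q \<subseteq> polys A"
  proof
    fix p assume "p \<in> Q"
    then obtain c where c: "c \<in> {..<N} \<rightarrow>\<^sub>E R" "p = (\<Sum>i<N. monom (c i) i)" unfolding Q_def by blast
    show "p \<in> polys A" unfolding c(2)
      using c(1) R(2) subring_ofD(1)[OF A]
      by (intro sum_in_ideal[OF subring_ideal_self[OF PA]] polys_monom) auto
  qed
  moreover have "\<exists>q\<in>Q. f - q \<in> J" if f: "f \<in> polys A" for f
  proof -
    have "g \<noteq> 0" using g(2) by auto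
    then obtain k t \<rho> where div: "t \<in> polys A" "\<rho> \<in> polys A" "Polynomial.smult (lead_coeff g ^ k) f = g * t + \<rho>"
      "\<rho> = 0 \<or> degree \<rho> < degree g" using pseudo_division[OF A g(1) _ f] by blast
    define \<sigma> where "\<sigma> = Polynomial.smult (b ^ k) \<rho>"
    have bk: "b ^ k \<in> A" using b(1) by (rule subring_ofD(7)[OF A])
    have \<sigma>: "\<sigma> \<in> polys A" unfolding \<sigma>_def using A bk div(2) by (rule polys_smult)
    obtain rep where rep: "\<And>a. a \<in> A \<Longrightarrow> rep a \<in> R \<and> a - rep a \<in> I" using R(3) by metis
    define q where "q = (\<Sum>i<N. monom (restrict (\<lambda>i. rep (coeff \<sigma> i)) {..<N} i) i)"
    have coeffA: "coeff \<sigma> i \<in> A" for i using \<sigma> unfolding polys_def by simp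
    have "q \<in> Q" unfolding Q_def q_def by (rule imageI) (auto simp: rep coeffA split: if_splits)
    have coeffq: "coeff q i = (if i < N then rep (coeff \<sigma> i) else 0)" for i
      unfolding q_def by (auto simp: coeff_sum)
    have "coeff \<sigma> i = 0" if "\<not> i < N" for i
    proof -
      have "\<sigma> = 0 \<or> degree \<sigma> < N" using div(4) degree_smult_le[of "b ^ k" \<rho>] unfolding \<sigma>_def N_def by auto
      then show ?thesis using that by (auto intro: coeff_eq_0)
    qed
    then have 1: "\<sigma> - q \<in> polys I"
      unfolding polys_def using rep coeffA ideal_ofD(2)[OF I] by (auto simp: coeffq)
    define e where "e = 1 - (b * lead_coeff g) ^ k"
    have "(b * lead_coeff g) ^ k - 1 \<in> I"
      using A I subring_ofD(6)[OF A b(1) lcA] b(2) by (rule ideal_power_minus_one)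
    then have "e \<in> I" unfolding e_def using ideal_ofD(3)[OF I] by (metis minus_diff_eq)
    then have 2: "Polynomial.smult e f \<in> polys I"
      using f ideal_ofD(7)[OF I] unfolding polys_def by simp
    have "Polynomial.smult (b ^ k) (Polynomial.smult (lead_coeff g ^ k) f) = g * Polynomial.smult (b ^ k) t + \<sigma>"
      unfolding div(3) \<sigma>_def by (simp add: smult_add_right)
    then have "f = Polynomial.smult e f + (g * Polynomial.smult (b ^ k) t + \<sigma>)"
      unfolding e_def by (simp add: smult_diff_left power_mult_distrib)
    then have "f - q = (Polynomial.smult e f + (\<sigma> - q)) + g * Polynomial.smult (b ^ k) t" by (simp add: algebra_simps)
    also have "\<dots> \<in> J"
      by (rule JI[OF ideal_ofD(4)[OF PI 2 1] polys_smult[OF A bk div(1)]])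
    finally show ?thesis using \<open>q \<in> Q\<close> by blast
  qed
  ultimately show "finite_index_in J (polys A)" unfolding finite_index_in_def by blast
qed

definition adjoin :: "'k::field set \<Rightarrow> 'k \<Rightarrow> 'k set" where
  "adjoin A x = (\<lambda>p. poly p x) ` polys A"

lemma subring_adjoin:
  assumes A: "subring_of A"
  shows "subring_of (adjoin A x)"
proof -
  note PA = polys_ideal(1)[OF A subring_ideal_self[OF A]]
  show ?thesis
    unfolding subring_of_def adjoin_def
    using subring_ofD(5,6)[OF PA] image_eqI[of 1 "\<lambda>p. poly p x", OF _ subring_ofD(2)[OF PA]]
    by (auto simp flip: poly_diff poly_mult)
qed

lemma adjoin_superset:
  assumes "subring_of A"
  shows "A \<subseteq> adjoin A x" "x \<in> adjoin A x"
proof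
  fix a assume "a \<in> A"
  then show "a \<in> adjoin A x" unfolding adjoin_def using subring_ofD(1)[OF assms]
    by (intro image_eqI[of _ _ "monom a 0"] polys_monom) (auto simp: poly_monom)
next
  show "x \<in> adjoin A x" unfolding adjoin_def using subring_ofD(1,2)[OF assms]
    by (intro image_eqI[of _ _ "monom 1 1"] polys_monom) (auto simp: poly_monom)
qed

lemma ideal_adjoin:
  assumes A: "subring_of A" and J: "ideal_of J (polys A)" "1 \<notin> J" "finite_index_in J (polys A)"
    and ker: "\<And>f. f \<in> polys A \<Longrightarrow> poly f x = 0 \<Longrightarrow> f \<in> J"
  defines "J' \<equiv> (\<lambda>p. poly p x) ` J"
  shows "ideal_of J' (adjoin A x)" "1 \<notin> J'" "finite_index_in J' (adjoin A x)"
proof -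
  note PA = polys_ideal(1)[OF A subring_ideal_self[OF A]]
  show "ideal_of J' (adjoin A x)"
    unfolding ideal_of_def J'_def adjoin_def
    using ideal_ofD[OF J(1)]
    by (auto simp flip: poly_diff poly_mult intro!: image_eqI[of 0 _ 0])
  show "1 \<notin> J'"
  proof
    assume "1 \<in> J'"
    then obtain f where f: "f \<in> J" "poly f x = 1" unfolding J'_def by auto
    have "1 - f \<in> J"
      using f ideal_ofD(1)[OF J(1)] by (intro ker subring_ofD(2,5)[OF PA]) auto
    then have "(1 - f) + f \<in> J" using f(1) by (rule ideal_ofD(4)[OF J(1)])
    then show False using J(2) by simp
  qed
  obtain R where R: "finite R" "R \<subseteq> polys A" "\<And>a. a \<in> polys A \<Longrightarrow> \<exists>r\<in>R. a - r \<in> J"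
    using J(3) unfolding finite_index_in_def by blast
  show "finite_index_in J' (adjoin A x)"
    unfolding finite_index_in_def
  proof (intro exI[of _ "(\<lambda>p. poly p x) ` R"] conjI ballI)
    fix a assume "a \<in> adjoin A x"
    then obtain f where f: "f \<in> polys A" "a = poly f x" unfolding adjoin_def by blast
    obtain r where r: "r \<in> R" "f - r \<in> J" using R(3)[OF f(1)] by blast
    have "a - poly r x \<in> J'" unfolding J'_def using r(2) f(2) by (intro image_eqI[of _ _ "f - r"]) auto
    then show "\<exists>r\<in>(\<lambda>p. poly p x) ` R. a - r \<in> J'" using r(1) by blast
  qed (use R(1,2) in \<open>auto simp: adjoin_def\<close>)
qed

text \<open>
  The elimination behind the inverse of an algebraic element: dividing the minimal polynomial $g$ by
  $q$ expresses a multiple of $q(x)$ by the value at $x$ of a remainder of smaller degree. That value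
  is nonzero, because otherwise the cofactor would be a relation for $x$ of degree less than
  that of $g$.
\<close>

lemma algebraic_multiple_in_base:
  assumes A: "subring_of A" and g: "g \<in> polys A" "g \<noteq> 0" "poly g x = 0"
    and min: "\<And>p. p \<in> polys A \<Longrightarrow> poly p x = 0 \<Longrightarrow> p = 0 \<or> degree g \<le> degree p"
    and q: "q \<in> polys A" "poly q x \<noteq> 0"
  shows "\<exists>s\<in>adjoin A x. s * poly q x \<in> A \<and> s * poly q x \<noteq> (0::'k::field)"
proof -
  note PA = polys_ideal(1)[OF A subring_ideal_self[OF A]]
  note B = subring_adjoin[OF A, of x]
  have low: "\<exists>s\<in>adjoin A x. s * poly q x \<in> A \<and> s * poly q x \<noteq> 0"
    if "degree q < degree g" "q \<in> polys A" "poly q x \<noteq> 0" for q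
    using that
  proof (induction "degree q" arbitrary: q rule: less_induct)
    case less
    show ?case
    proof (cases "degree q = 0")
      case True
      then obtain c where c: "q = [:c:]" by (rule degree_eq_zeroE)
      then have "c \<in> A" using less.prems(2) unfolding polys_def by (auto dest: spec[of _ 0])
      then show ?thesis using c less.prems(3) subring_ofD(2)[OF B] by (intro bexI[of _ 1]) auto
    next
      case False
      have "q \<noteq> 0" using less.prems(3) by auto
      then obtain k t \<rho> where div: "t \<in> polys A" "\<rho> \<in> polys A"
        "Polynomial.smult (lead_coeff q ^ k) g = q * t + \<rho>" "\<rho> = 0 \<or> degree \<rho> < degree q"
        using pseudo_division[OF A less.prems(2) _ g(1)] by blast
      have zero: "poly \<rho> x = - (poly t x * poly q x)"
        using arg_cong[OF div(3), of "\<lambda>p. poly p x"] g(3)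
        by (simp add: eq_neg_iff_add_eq_0 algebra_simps)
      have "poly \<rho> x \<noteq> 0"
      proof
        assume \<rho>0: "poly \<rho> x = 0"
        then have "\<rho> = 0" using min[OF div(2)] div(4) less.prems(1) by auto
        then have eq: "Polynomial.smult (lead_coeff q ^ k) g = q * t" using div(3) by simp
        then have "t \<noteq> 0" using g(2) \<open>q \<noteq> 0\<close> by auto
        have "poly t x = 0" using zero \<rho>0 less.prems(3) by simp
        then have "degree g \<le> degree t" using min[OF div(1)] \<open>t \<noteq> 0\<close> by blast
        moreover have "degree g = degree q + degree t"
          using arg_cong[OF eq, of degree] \<open>q \<noteq> 0\<close> \<open>t \<noteq> 0\<close> by (simp add: degree_mult_eq)
        ultimately show False using False by linarith
      qed
      then obtain s where s: "s \<in> adjoin A x" "s * poly \<rho> x \<in> A" "s * poly \<rho> x \<noteq> 0"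
        using less.hyps[of \<rho>] div(2,4) less.prems(1) by fastforce
      have "poly t x \<in> adjoin A x" using div(1) unfolding adjoin_def by blast
      then have "- (s * poly t x) \<in> adjoin A x" using s(1) by (intro subring_ofD(3,6)[OF B])
      moreover have "- (s * poly t x) * poly q x = s * poly \<rho> x" unfolding zero by simp
      ultimately show ?thesis using s(2,3) by metis
    qed
  qed
  obtain k t \<rho> where div: "t \<in> polys A" "\<rho> \<in> polys A"
    "Polynomial.smult (lead_coeff g ^ k) q = g * t + \<rho>" "\<rho> = 0 \<or> degree \<rho> < degree g"
    using pseudo_division[OF A g(1,2) q(1)] by blast
  have val: "lead_coeff g ^ k * poly q x = poly \<rho> x"
    using arg_cong[OF div(3), of "\<lambda>p. poly p x"] g(3) by simp
  then have "poly \<rho> x \<noteq> 0" using q(2) g(2) by auto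
  then obtain s where s: "s \<in> adjoin A x" "s * poly \<rho> x \<in> A" "s * poly \<rho> x \<noteq> 0"
    using low[of \<rho>] div(2,4) by fastforce
  have "lead_coeff g \<in> adjoin A x" using g(1) adjoin_superset(1)[OF A] unfolding polys_def by auto
  then have "s * lead_coeff g ^ k \<in> adjoin A x" using s(1) by (intro subring_ofD(6,7)[OF B])
  moreover have "(s * lead_coeff g ^ k) * poly q x = s * poly \<rho> x" unfolding val[symmetric] by simp
  ultimately show ?thesis using s(2,3) by metis
qed

text \<open>
  If $x$ is transcendental and $r = q(x)$, take $g = 1 + X q$: in the quotient by $g$ the element
  $-x$ inverts $r$. If $x$ is algebraic, take its minimal polynomial for $g$, after choosing $I$ such
  that both the leading coefficient of $g$ and a multiple of $r$ lying in $A$ become units. In both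
  cases the relations of $x$ lie in the ideal given by \<open>polynomial_quotient\<close>.
\<close>

lemma finite_quotients_adjoin:
  fixes x :: "'k::field"
  assumes "finite_quotients_detect_units A"
  shows "finite_quotients_detect_units (adjoin A x)"
proof -
  have A: "subring_of A" and units: "\<And>r. r \<in> A \<Longrightarrow> r \<noteq> 0 \<Longrightarrow>
      \<exists>I. ideal_of I A \<and> 1 \<notin> I \<and> finite_index_in I A \<and> (\<exists>b\<in>A. b * r - 1 \<in> I)"
    using assms unfolding finite_quotients_detect_units_def by auto
  note PA = polys_ideal(1)[OF A subring_ideal_self[OF A]]
  note B = subring_adjoin[OF A, of x]
  have "\<exists>J. ideal_of J (adjoin A x) \<and> 1 \<notin> J \<and> finite_index_in J (adjoin A x) \<and>
      (\<exists>b\<in>adjoin A x. b * r - 1 \<in> J)" if rB: "r \<in> adjoin A x" and r0: "r \<noteq> 0" for r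
  proof -
    obtain q where q: "q \<in> polys A" "r = poly q x" using rB unfolding adjoin_def by blast
    show ?thesis
    proof (cases "\<exists>p\<in>polys A. p \<noteq> 0 \<and> poly p x = 0")
      case False
      have "q \<noteq> 0" using q r0 by auto
      define g where "g = pCons 1 q"
      have "lead_coeff q \<in> A" "lead_coeff q \<noteq> 0" using q \<open>q \<noteq> 0\<close> unfolding polys_def by auto
      then obtain I b where I: "ideal_of I A" "1 \<notin> I" "finite_index_in I A" "b \<in> A"
        "b * lead_coeff q - 1 \<in> I" using units by meson
      have g: "g \<in> polys A" "degree g > 0" "lead_coeff g = lead_coeff q"
        unfolding g_def polys_def using q \<open>q \<noteq> 0\<close> subring_ofD(2)[OF A]
        by (auto simp: polys_def coeff_pCons split: nat.splits)
      define J where "J = {i + g * h |i h. i \<in> polys I \<and> h \<in> polys A}"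
      note J = polynomial_quotient[OF A I(1-3) g(1,2) I(4) I(5)[folded g(3)], folded J_def]
      have ker: "f \<in> J" if "f \<in> polys A" "poly f x = 0" for f
        using that False ideal_ofD(2)[OF J(1)] by auto
      note J' = ideal_adjoin[OF A J ker, where x = x]
      have "g \<in> J"
        unfolding J_def using ideal_ofD(2)[OF polys_ideal(2)[OF A I(1)]] subring_ofD(2)[OF PA] by force
      then have "- g \<in> J" by (rule ideal_ofD(3)[OF J(1)])
      then have "(- x) * r - 1 \<in> (\<lambda>p. poly p x) ` J"
        by (rule image_eqI[rotated]) (simp add: g_def q)
      moreover have "- x \<in> adjoin A x" using adjoin_superset(2)[OF A] by (rule subring_ofD(3)[OF B])
      ultimately show ?thesis using J' by blast
    next
      case True
      obtain g where g: "g \<in> polys A" "g \<noteq> 0" "poly g x = 0"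
        and least: "\<And>p. p \<in> polys A \<Longrightarrow> p \<noteq> 0 \<and> poly p x = 0 \<Longrightarrow> degree g \<le> degree p"
        using ex_has_least_nat[of "\<lambda>p. p \<in> polys A \<and> p \<noteq> 0 \<and> poly p x = 0" _ degree] True by metis
      have deg: "degree g > 0"
      proof (rule ccontr)
        assume "\<not> ?thesis"
        then obtain c where "g = [:c:]" by (auto elim: degree_eq_zeroE)
        then show False using g by simp
      qed
      obtain s where s: "s \<in> adjoin A x" "s * r \<in> A" "s * r \<noteq> 0"
        using algebraic_multiple_in_base[OF A g _ q(1)] least q(2) r0 by blast
      define c where "c = s * r"
      have lcA: "lead_coeff g \<in> A" using g(1) unfolding polys_def by simp
      have "c * lead_coeff g \<in> A" "c * lead_coeff g \<noteq> 0"
        unfolding c_def using s g(2) lcA by (auto intro: subring_ofD(6)[OF A])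
      then obtain I b where I: "ideal_of I A" "1 \<notin> I" "finite_index_in I A" and b: "b \<in> A"
        "b * (c * lead_coeff g) - 1 \<in> I" using units by meson
      have bc: "b * c \<in> A" "b * c * lead_coeff g - 1 \<in> I"
        using b s(2) unfolding c_def by (auto intro: subring_ofD(6)[OF A] simp: mult.assoc)
      define J where "J = {i + g * h |i h. i \<in> polys I \<and> h \<in> polys A}"
      note J = polynomial_quotient[OF A I g(1) deg bc, folded J_def]
      note PI = polys_ideal(2)[OF A I(1)]
      have ker: "f \<in> J" if f: "f \<in> polys A" "poly f x = 0" for f
      proof -
        obtain k t \<rho> where div: "t \<in> polys A" "\<rho> \<in> polys A"
          "Polynomial.smult (lead_coeff g ^ k) f = g * t + \<rho>" "\<rho> = 0 \<or> degree \<rho> < degree g"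
          using pseudo_division[OF A g(1,2) f(1)] by blast
        have "poly \<rho> x = 0" using arg_cong[OF div(3), of "\<lambda>p. poly p x"] g(3) f(2) by simp
        then have "\<rho> = 0" using least[OF div(2)] div(4) by fastforce
        define e where "e = (b * c * lead_coeff g) ^ k - 1"
        have "e \<in> I" unfolding e_def
          using A I(1) subring_ofD(6)[OF A bc(1) lcA] bc(2) by (rule ideal_power_minus_one)
        then have 1: "Polynomial.smult (- e) f \<in> polys I"
          using f ideal_ofD(3,7)[OF I(1)] unfolding polys_def by simp
        have 2: "Polynomial.smult ((b * c) ^ k) t \<in> polys A"
          using div(1) bc(1) A by (intro polys_smult subring_ofD(7)[OF A])
        have "Polynomial.smult ((b * c) ^ k) (Polynomial.smult (lead_coeff g ^ k) f) = g * Polynomial.smult ((b * c) ^ k) t"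
          unfolding div(3) \<open>\<rho> = 0\<close> by simp
        then have "f = Polynomial.smult (- e) f + g * Polynomial.smult ((b * c) ^ k) t"
          unfolding e_def by (simp add: smult_diff_left power_mult_distrib)
        then show ?thesis unfolding J_def using 1 2 by blast
      qed
      note J' = ideal_adjoin[OF A J ker, where x = x]
      define i where "i = b * (c * lead_coeff g) - 1"
      have "[:i:] \<in> polys I"
        using b(2) ideal_ofD(2)[OF I(1)] unfolding polys_def i_def by (auto simp: coeff_pCons split: nat.splits)
      then have "[:i:] \<in> J" unfolding J_def using subring_ofD(1)[OF PA] by force
      then have "i \<in> (\<lambda>p. poly p x) ` J" by (rule image_eqI[rotated]) simp
      then have "(b * lead_coeff g * s) * r - 1 \<in> (\<lambda>p. poly p x) ` J"
        unfolding i_def c_def by (simp add: mult_ac)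
      moreover have "b * lead_coeff g * s \<in> adjoin A x"
        using b(1) lcA s(1) adjoin_superset(1)[OF A] by (intro subring_ofD(6)[OF B]) auto
      ultimately show ?thesis using J' by blast
    qed
  qed
  then show ?thesis using B unfolding finite_quotients_detect_units_def by blast
qed

text \<open>
  In positive characteristic the prime ring is a finite domain, in which some power of $r$ is 1.
  In characteristic 0 an integer $z \<noteq> 0$ is congruent to $1$ or $-1$ modulo $|z| + 1$, hence a
  unit there.
\<close>

lemma finite_quotients_prime_ring: "finite_quotients_detect_units (range of_int :: 'k::field set)"
proof -
  let ?A = "range of_int :: 'k set"
  have A: "subring_of ?A"
    unfolding subring_of_def
    by (auto simp flip: of_int_diff of_int_mult intro: range_eqI[of _ _ 1])
  have "\<exists>I. ideal_of I ?A \<and> 1 \<notin> I \<and> finite_index_in I ?A \<and> (\<exists>b\<in>?A. b * r - 1 \<in> I)"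
    if r: "r \<in> ?A" "r \<noteq> 0" for r
  proof (cases "finite ?A")
    case True
    have "\<not> inj (\<lambda>k::nat. r ^ k)"
    proof
      assume "inj (\<lambda>k::nat. r ^ k)"
      then have "infinite (range (\<lambda>k::nat. r ^ k))" by (rule range_inj_infinite)
      moreover have "range (\<lambda>k::nat. r ^ k) \<subseteq> ?A" using subring_ofD(7)[OF A r(1)] by blast
      ultimately show False using True finite_subset by blast
    qed
    then obtain k l :: nat where kl: "r ^ k = r ^ l" "k < l"
      unfolding inj_def by (metis linorder_neq_iff)
    have "r ^ l = r ^ k * r ^ (l - k)" using kl(2) by (simp flip: power_add)
    then have "r ^ k * r ^ (l - k) = r ^ k * 1" using kl(1) by simp
    then have "r ^ (l - k) = 1" using r(2) by simp
    then have "r ^ (l - k - 1) * r - 1 = 0" using kl(2) power_minus_mult[of "l - k" r] by simp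
    moreover have "r ^ (l - k - 1) \<in> ?A" using subring_ofD(7)[OF A r(1)] .
    moreover have "finite_index_in {0} ?A" unfolding finite_index_in_def using True by auto
    moreover have "ideal_of {0} ?A" unfolding ideal_of_def using subring_ofD(1)[OF A] by auto
    ultimately show ?thesis by (intro exI[of _ "{0}"]) auto
  next
    case False
    obtain z where z: "r = of_int z" using r(1) by blast
    define n where "n = \<bar>z\<bar> + 1"
    have n: "n > 1" using r(2) z unfolding n_def by auto
    define I where "I = (range (\<lambda>m. of_int (n * m)) :: 'k set)"
    have inI: "of_int m \<in> I" if "n dvd m" for m using that unfolding I_def by (auto elim!: dvdE)
    have ideal: "ideal_of I ?A"
      unfolding ideal_of_def
    proof (intro conjI ballI)
      show "I \<subseteq> ?A" unfolding I_def by blast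
      show "0 \<in> I" using inI[of 0] by simp
      fix x y assume "x \<in> I" "y \<in> I"
      then obtain k l where "x = of_int (n * k)" "y = of_int (n * l)" unfolding I_def by blast
      then have "x - y = of_int (n * (k - l))" by (simp add: algebra_simps)
      then show "x - y \<in> I" unfolding I_def by blast
    next
      fix a x assume "a \<in> ?A" "x \<in> I"
      then obtain k l where "a = of_int k" "x = of_int (n * l)" unfolding I_def by blast
      then have "a * x = of_int (n * (k * l))" by (simp add: algebra_simps)
      then show "a * x \<in> I" unfolding I_def by blast
    qed
    have red: "of_int m - of_int (m mod n) \<in> I" for m
    proof -
      have "n dvd m - m mod n" by (simp add: dvd_minus_mod)
      then show ?thesis using inI by (metis of_int_diff)
    qed
    have "1 \<notin> I"
    proof
      assume "1 \<in> I"
      then obtain m where m: "of_int (n * m) = (1 :: 'k)" unfolding I_def by auto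
      define d where "d = \<bar>n * m - 1\<bar>"
      have "n * m \<noteq> 1" using n by (auto simp: zmult_eq_1_iff)
      then have d: "d > 0" unfolding d_def by simp
      have d0: "of_int d = (0 :: 'k)" using m unfolding d_def by (auto simp: abs_if)
      have "?A \<subseteq> of_int ` {0..<d}"
      proof
        fix y assume "y \<in> ?A"
        then obtain j where j: "y = of_int j" by blast
        have "of_int j = of_int (d * (j div d) + j mod d)" by simp
        also have "\<dots> = (of_int (j mod d) :: 'k)"
          unfolding of_int_add of_int_mult d0 by simp
        finally show "y \<in> of_int ` {0..<d}" using j d by auto
      qed
      then show False using False finite_subset by blast
    qed
    moreover have "finite_index_in I ?A"
      unfolding finite_index_in_def
    proof (intro exI[of _ "of_int ` {0..<n}"] conjI ballI)
      fix a assume "a \<in> ?A"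
      then obtain m where "a = of_int m" by blast
      moreover have "m mod n \<in> {0..<n}" using n by simp
      ultimately show "\<exists>r\<in>of_int ` {0..<n}. a - r \<in> I" using red by blast
    qed auto
    moreover have "\<exists>b\<in>?A. b * r - 1 \<in> I"
    proof -
      have "- (sgn z) * z - 1 = - n" unfolding n_def by (simp add: abs_sgn mult.commute)
      then have "n dvd - (sgn z) * z - 1" by (metis dvd_minus_iff dvd_refl)
      then have "of_int (- (sgn z)) * r - 1 \<in> I" using inI[of "- (sgn z) * z - 1"] z by simp
      then show ?thesis by blast
    qed
    ultimately show ?thesis using ideal by blast
  qed
  then show ?thesis using A unfolding finite_quotients_detect_units_def by simp
qed

lemma finitely_generated_subring:
  assumes "finite (X :: 'k::field set)"
  obtains A where "finite_quotients_detect_units A" "X \<subseteq> A"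
proof -
  have "\<exists>A. finite_quotients_detect_units A \<and> X \<subseteq> A" using assms
  proof (induction X rule: finite_induct)
    case empty
    then show ?case using finite_quotients_prime_ring by blast
  next
    case (insert x X)
    then obtain A where A: "finite_quotients_detect_units A" "X \<subseteq> A" by blast
    have "subring_of A" using A(1) unfolding finite_quotients_detect_units_def by blast
    then have "insert x X \<subseteq> adjoin A x" using adjoin_superset A(2) by blast
    then show ?case using finite_quotients_adjoin[OF A(1)] by blast
  qed
  then show ?thesis using that by blast
qed


section \<open>Linear algebra of matrices acting on sequences\<close>

text \<open>
  The spaces $K^n$ for all $n$ are realised as subspaces \<open>Kn n\<close> of the one vector space of
  sequences in $K$, so that the theory of vector spaces on a type applies to them and $n$ stays an
  ordinary variable.
\<close>

definition scale_fun :: "'k::field \<Rightarrow> (nat \<Rightarrow> 'k) \<Rightarrow> nat \<Rightarrow> 'k" where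
  "scale_fun c v = (\<lambda>i. c * v i)"

lemma scale_fun_apply [simp]: "scale_fun c v i = c * v i"
  unfolding scale_fun_def by simp

lemma vector_space_scale_fun: "Vector_Spaces.vector_space (scale_fun :: 'k::field \<Rightarrow> _)"
  by standard (auto simp: fun_eq_iff distrib_left distrib_right)

global_interpretation fs: Vector_Spaces.vector_space "scale_fun :: 'k::field \<Rightarrow> _"
  by (rule vector_space_scale_fun)

global_interpretation fs: Vector_Spaces.vector_space_pair "scale_fun :: 'k::field \<Rightarrow> _" scale_fun
  by standard

lemma sum_fun_apply [simp]: "(\<Sum>x\<in>A. f x) i = (\<Sum>x\<in>A. f x i)" for f :: "'x \<Rightarrow> nat \<Rightarrow> 'k::field"
  by (induction A rule: infinite_finite_induct) auto

definition Kn :: "nat \<Rightarrow> (nat \<Rightarrow> 'k::field) set" where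
  "Kn n = {v. \<forall>i\<ge>n. v i = 0}"

definition unit_fun :: "nat \<Rightarrow> nat \<Rightarrow> 'k::field" where
  "unit_fun j = (\<lambda>i. if i = j then 1 else 0)"

lemma unit_fun_in_Kn: "j < n \<Longrightarrow> unit_fun j \<in> Kn n"
  unfolding Kn_def unit_fun_def by auto

lemma inj_unit_fun: "inj unit_fun"
  unfolding inj_def unit_fun_def fun_eq_iff by (metis zero_neq_one)

lemma subspace_Kn: "fs.subspace (Kn n)"
  unfolding fs.subspace_def Kn_def by auto

lemma Kn_expand: "v \<in> Kn n \<Longrightarrow> v = (\<Sum>j<n. scale_fun (v j) (unit_fun j))"
  unfolding Kn_def unit_fun_def by (auto simp: fun_eq_iff if_distrib cong: if_cong)

lemma span_unit_fun: "fs.span (unit_fun ` {..<n}) = (Kn n :: (nat \<Rightarrow> 'k::field) set)"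
proof
  show "fs.span (unit_fun ` {..<n}) \<subseteq> (Kn n :: (nat \<Rightarrow> 'k) set)"
    using unit_fun_in_Kn by (intro fs.span_minimal subspace_Kn) auto
  show "(Kn n :: (nat \<Rightarrow> 'k) set) \<subseteq> fs.span (unit_fun ` {..<n})"
  proof
    fix v :: "nat \<Rightarrow> 'k" assume "v \<in> Kn n"
    moreover have "(\<Sum>j<n. scale_fun (v j) (unit_fun j)) \<in> fs.span (unit_fun ` {..<n})"
      by (intro fs.span_sum fs.span_scale fs.span_base) auto
    ultimately show "v \<in> fs.span (unit_fun ` {..<n})" using Kn_expand by metis
  qed
qed

lemma independent_unit_fun: "fs.independent (unit_fun ` J :: (nat \<Rightarrow> 'k::field) set)"
proof
  assume "fs.dependent (unit_fun ` J :: (nat \<Rightarrow> 'k) set)"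
  then obtain T u and v :: "nat \<Rightarrow> 'k" where T: "finite T" "T \<subseteq> unit_fun ` J"
    and zero: "(\<Sum>v\<in>T. scale_fun (u v) v) = 0" and v: "v \<in> T" "u v \<noteq> 0"
    unfolding fs.dependent_explicit by blast
  obtain J' where J': "J' \<subseteq> J" "finite J'" "T = unit_fun ` J'"
    using finite_subset_image[OF T] by blast
  obtain j where j: "j \<in> J'" "v = unit_fun j" using v(1) J'(3) by blast
  have "(\<Sum>i\<in>J'. scale_fun (u (unit_fun i)) (unit_fun i)) = (\<Sum>v\<in>T. scale_fun (u v) v)"
    unfolding J'(3) by (subst sum.reindex) (auto intro: inj_on_subset[OF inj_unit_fun])
  then have "(\<Sum>i\<in>J'. scale_fun (u (unit_fun i)) (unit_fun i)) j = (0 :: 'k)"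
    unfolding zero by simp
  then have "u (unit_fun j) = 0"
    using j(1) J'(2) by (simp add: unit_fun_def if_distrib cong: if_cong)
  then show False using v(2) j(2) by simp
qed

lemma card_unit_fun: "card (unit_fun ` {..<n} :: (nat \<Rightarrow> 'k::field) set) = n"
  by (subst card_image) (auto intro: inj_on_subset[OF inj_unit_fun])

lemma card_le_Kn:
  fixes B :: "(nat \<Rightarrow> 'k::field) set"
  assumes "fs.independent B" "B \<subseteq> Kn n"
  shows "finite B" "card B \<le> n"
proof -
  have "finite B \<and> card B \<le> card (unit_fun ` {..<n} :: (nat \<Rightarrow> 'k) set)"
    using assms by (intro fs.independent_span_bound) (auto simp: span_unit_fun)
  then show "finite B" "card B \<le> n" by (auto simp: card_unit_fun)
qed

lemma card_basis_Kn:
  fixes B :: "(nat \<Rightarrow> 'k::field) set"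
  assumes "fs.independent B" "fs.span B = Kn n"
  shows "card B = n"
proof -
  have B: "B \<subseteq> Kn n" using fs.span_superset assms(2) by blast
  have "n \<le> card B"
    using fs.independent_span_bound[OF card_le_Kn(1)[OF assms(1) B] independent_unit_fun, of "{..<n}"]
      fs.span_superset[of "unit_fun ` {..<n}"]
    by (simp add: assms(2) card_unit_fun span_unit_fun)
  then show ?thesis using card_le_Kn(2)[OF assms(1) B] by simp
qed

lemma extend_to_basis_Kn:
  fixes B :: "(nat \<Rightarrow> 'k::field) set"
  assumes "fs.independent B" "B \<subseteq> Kn n"
  obtains C where "C \<subseteq> Kn n" "finite C" "B \<inter> C = {}" "fs.independent (B \<union> C)" "fs.span (B \<union> C) = Kn n"
    "card B + card C = n"
proof -
  obtain D where D: "B \<subseteq> D" "D \<subseteq> Kn n" "fs.independent D" "Kn n \<subseteq> fs.span D"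
    using fs.maximal_independent_subset_extend[OF assms(2,1)] by blast
  have sp: "fs.span D = Kn n" using D(2,4) fs.span_minimal[OF _ subspace_Kn] by blast
  have fin: "finite D" using card_le_Kn(1)[OF D(3,2)] .
  show ?thesis
  proof (rule that[of "D - B"])
    show "card B + card (D - B) = n"
      using card_basis_Kn[OF D(3) sp] D(1) fin card_mono[OF fin D(1)]
      by (simp add: card_Diff_subset finite_subset)
  qed (use D fin sp in \<open>auto simp: Un_absorb1\<close>)
qed

definition of_vec :: "'k::field vec \<Rightarrow> nat \<Rightarrow> 'k" where
  "of_vec v = (\<lambda>i. if i < dim_vec v then v $ i else 0)"

definition mat_act :: "'k::field mat \<Rightarrow> (nat \<Rightarrow> 'k) \<Rightarrow> nat \<Rightarrow> 'k" where
  "mat_act X v = (\<lambda>i. if i < dim_row X then \<Sum>j<dim_col X. X $$ (i, j) * v j else 0)"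

definition mat_of :: "nat \<Rightarrow> ((nat \<Rightarrow> 'k::field) \<Rightarrow> nat \<Rightarrow> 'k) \<Rightarrow> 'k mat" where
  "mat_of n L = mat n n (\<lambda>(i, j). L (unit_fun j) i)"

lemma of_vec_in_Kn: "v \<in> carrier_vec n \<Longrightarrow> of_vec v \<in> Kn n"
  unfolding of_vec_def Kn_def by auto

lemma of_vec_vec: "f \<in> Kn n \<Longrightarrow> of_vec (vec n f) = f"
  unfolding of_vec_def Kn_def by (auto simp: fun_eq_iff)

lemma of_vec_inj:
  assumes "v \<in> carrier_vec n" "w \<in> carrier_vec n" "of_vec v = of_vec w"
  shows "v = w"
proof (rule eq_vecI)
  show "dim_vec v = dim_vec w" using assms by simp
  show "v $ i = w $ i" if "i < dim_vec w" for i
    using fun_cong[OF assms(3), of i] that assms unfolding of_vec_def by simp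
qed

lemma inj_on_of_vec: "inj_on of_vec (carrier_vec n)"
  using of_vec_inj by (auto intro: inj_onI)

lemma of_vec_add:
  "v \<in> carrier_vec n \<Longrightarrow> w \<in> carrier_vec n \<Longrightarrow> of_vec (v + w) = of_vec v + of_vec w"
  unfolding of_vec_def by (auto simp: fun_eq_iff)

lemma of_vec_smult: "of_vec (c \<cdot>\<^sub>v v) = scale_fun c (of_vec v)"
  unfolding of_vec_def by (auto simp: fun_eq_iff)

lemma of_vec_mult:
  "X \<in> carrier_mat n n \<Longrightarrow> v \<in> carrier_vec n \<Longrightarrow> of_vec (X *\<^sub>v v) = mat_act X (of_vec v)"
  unfolding of_vec_def mat_act_def
  by (auto simp: fun_eq_iff scalar_prod_def row_def intro!: sum.cong)

lemma mat_act_add: "mat_act X (v + w) = mat_act X v + mat_act X w"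
  unfolding mat_act_def by (auto simp: fun_eq_iff sum.distrib distrib_left)

lemma mat_act_scale: "mat_act X (scale_fun c v) = scale_fun c (mat_act X v)"
  unfolding mat_act_def by (auto simp: fun_eq_iff sum_distrib_left mult_ac)

lemma linear_mat_act: "Vector_Spaces.linear scale_fun scale_fun (mat_act X)"
  by (simp add: Vector_Spaces.linear_iff vector_space_scale_fun mat_act_add mat_act_scale)

lemma mat_act_in_Kn: "X \<in> carrier_mat n n \<Longrightarrow> mat_act X v \<in> Kn n"
  unfolding mat_act_def Kn_def by auto

lemma mat_act_plus:
  "X \<in> carrier_mat n n \<Longrightarrow> Y \<in> carrier_mat n n \<Longrightarrow> mat_act (X + Y) v = mat_act X v + mat_act Y v"
  unfolding mat_act_def by (auto simp: fun_eq_iff sum.distrib distrib_right)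

lemma mat_act_smult: "X \<in> carrier_mat n n \<Longrightarrow> mat_act (c \<cdot>\<^sub>m X) v = scale_fun c (mat_act X v)"
  unfolding mat_act_def by (auto simp: fun_eq_iff sum_distrib_left mult_ac)

lemma mat_act_minus:
  "X \<in> carrier_mat n n \<Longrightarrow> Y \<in> carrier_mat n n \<Longrightarrow> mat_act (X - Y) v = mat_act X v - mat_act Y v"
  unfolding mat_act_def by (auto simp: fun_eq_iff sum_subtractf left_diff_distrib)

lemma mat_act_mult:
  assumes "X \<in> carrier_mat n n" "Y \<in> carrier_mat n n"
  shows "mat_act (X * Y) v = mat_act X (mat_act Y v)"
proof
  fix i
  show "mat_act (X * Y) v i = mat_act X (mat_act Y v) i"
  proof (cases "i < n")
    case True
    have "mat_act (X * Y) v i = (\<Sum>j<n. (\<Sum>k<n. X $$ (i, k) * Y $$ (k, j)) * v j)"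
      using assms True unfolding mat_act_def
      by (auto simp: scalar_prod_def atLeast0LessThan intro!: sum.cong)
    also have "\<dots> = (\<Sum>k<n. \<Sum>j<n. X $$ (i, k) * Y $$ (k, j) * v j)"
      unfolding sum_distrib_right by (rule sum.swap)
    also have "\<dots> = mat_act X (mat_act Y v) i"
      using assms True unfolding mat_act_def by (auto simp: sum_distrib_left mult_ac)
    finally show ?thesis .
  qed (use assms in \<open>simp add: mat_act_def\<close>)
qed

lemma mat_act_unit: "X \<in> carrier_mat n n \<Longrightarrow> j < n \<Longrightarrow> mat_act X (unit_fun j) = of_vec (col X j)"
  unfolding mat_act_def of_vec_def unit_fun_def
  by (auto simp: fun_eq_iff if_distrib cong: if_cong)

lemma mat_of_carrier [simp]: "mat_of n L \<in> carrier_mat n n"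
  unfolding mat_of_def by simp

lemma mat_act_mat_of:
  assumes "Vector_Spaces.linear scale_fun scale_fun L" "L ` Kn n \<subseteq> Kn n" "v \<in> Kn n"
  shows "mat_act (mat_of n L) v = L v"
proof -
  have "L v = L (\<Sum>j<n. scale_fun (v j) (unit_fun j))" using Kn_expand[OF assms(3)] by simp
  also have "\<dots> = (\<Sum>j<n. scale_fun (v j) (L (unit_fun j)))"
    by (simp add: fs.linear_sum[OF assms(1)] fs.linear_scale[OF assms(1)])
  finally have L: "L v i = (\<Sum>j<n. v j * L (unit_fun j) i)" for i by simp
  have "L v \<in> Kn n" using assms(2,3) by blast
  then have out: "L v i = 0" if "i \<ge> n" for i using that unfolding Kn_def by blast
  show ?thesis
  proof
    fix i
    show "mat_act (mat_of n L) v i = L v i"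
      using L[of i] out[of i] unfolding mat_act_def mat_of_def by (simp add: mult.commute)
  qed
qed

lemma mat_of_cong: "(\<And>v. v \<in> Kn n \<Longrightarrow> L v = L' v) \<Longrightarrow> mat_of n L = mat_of n L'"
  unfolding mat_of_def by (intro cong_mat) (auto simp: unit_fun_in_Kn)

lemma mat_of_mult:
  assumes "Vector_Spaces.linear scale_fun scale_fun L" "L ` Kn n \<subseteq> Kn n" "L' ` Kn n \<subseteq> Kn n"
  shows "mat_of n (\<lambda>v. L (L' v)) = mat_of n L * mat_of n L'"
proof (rule eq_matI)
  fix i j assume "i < dim_row (mat_of n L * mat_of n L')" "j < dim_col (mat_of n L * mat_of n L')"
  then have ij: "i < n" "j < n" by (simp_all add: mat_of_def)
  define w where "w = L' (unit_fun j)"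
  have w: "w \<in> Kn n" unfolding w_def using assms(3) unit_fun_in_Kn[OF ij(2)] by blast
  have "L w i = mat_act (mat_of n L) w i" using mat_act_mat_of[OF assms(1,2) w] by simp
  also have "\<dots> = (\<Sum>k<n. L (unit_fun k) i * w k)" unfolding mat_act_def mat_of_def using ij by simp
  finally show "mat_of n (\<lambda>v. L (L' v)) $$ (i, j) = (mat_of n L * mat_of n L') $$ (i, j)"
    using ij unfolding w_def by (simp add: mat_of_def scalar_prod_def atLeast0LessThan)
qed (auto simp: mat_of_def)

lemma of_vec_lincomb:
  assumes "A \<subseteq> carrier_vec n"
  shows "of_vec (module.lincomb (module_vec TYPE('k::field) n) a A) = (\<Sum>x\<in>A. scale_fun (a x) (of_vec x))"
proof -
  interpret V: vec_space "TYPE('k)" n .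
  have dims: "dim_vec (V.lincomb a A) = n" "\<And>x. x \<in> A \<Longrightarrow> dim_vec x = n"
    using V.lincomb_closed[of A a] assms by (auto simp: module_vec_simps)
  show ?thesis
    unfolding of_vec_def using assms
    by (simp add: dims fun_eq_iff V.lincomb_index cong: sum.cong)
qed

text \<open>
  This transfers independence between vectors with a carrier and sequences; the rank of a matrix and
  the dimension of a subspace are reached through it.
\<close>

lemma lin_dep_iff_dependent:
  assumes "T \<subseteq> carrier_vec n"
  shows "module.lin_dep class_ring (module_vec TYPE('k::field) n) T \<longleftrightarrow> fs.dependent (of_vec ` T)"
proof -
  interpret V: vec_space "TYPE('k)" n .
  have inj: "inj_on of_vec A" if "A \<subseteq> T" for A using inj_on_subset[OF inj_on_of_vec] assms that by blast
  show ?thesis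
  proof
    assume "V.lin_dep T"
    then obtain A a v where A: "finite A" "A \<subseteq> T" "V.lincomb a A = 0\<^sub>v n" "v \<in> A" "a v \<noteq> 0"
      unfolding V.lin_dep_def by (auto simp: module_vec_simps)
    have "(\<Sum>x\<in>A. scale_fun (a x) (of_vec x)) = of_vec (0\<^sub>v n)"
      using of_vec_lincomb[of A n a] A assms by auto
    also have "\<dots> = 0" by (auto simp: of_vec_def)
    finally have z: "(\<Sum>x\<in>A. scale_fun (a x) (of_vec x)) = 0" .
    define u where "u = (\<lambda>w. a (the_inv_into A of_vec w))"
    have u: "u (of_vec x) = a x" if "x \<in> A" for x
      unfolding u_def using the_inv_into_f_f[OF inj[OF A(2)] that] by simp
    have "(\<Sum>w\<in>of_vec ` A. scale_fun (u w) w) = (\<Sum>x\<in>A. scale_fun (a x) (of_vec x))"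
      unfolding sum.reindex[OF inj[OF A(2)]] by (intro sum.cong) (auto simp: u)
    then show "fs.dependent (of_vec ` T)"
      unfolding fs.dependent_explicit
      using z A u by (intro exI[of _ "of_vec ` A"] exI[of _ u]) auto
  next
    assume "fs.dependent (of_vec ` T)"
    then obtain W u w where W: "finite W" "W \<subseteq> of_vec ` T" "(\<Sum>v\<in>W. scale_fun (u v) v) = 0" "w \<in> W" "u w \<noteq> 0"
      unfolding fs.dependent_explicit by blast
    obtain A where A: "A \<subseteq> T" "finite A" "W = of_vec ` A" using finite_subset_image[OF W(1,2)] by blast
    have Ac: "A \<subseteq> carrier_vec n" using A(1) assms by blast
    have "of_vec (V.lincomb (\<lambda>x. u (of_vec x)) A) = 0"
      using W(3) unfolding A(3) sum.reindex[OF inj[OF A(1)]] of_vec_lincomb[OF Ac] by (simp add: o_def)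
    also have "\<dots> = of_vec (0\<^sub>v n)" by (auto simp: of_vec_def)
    finally have "V.lincomb (\<lambda>x. u (of_vec x)) A = 0\<^sub>v n"
      using V.lincomb_closed[OF Ac] by (intro of_vec_inj) (auto simp: module_vec_simps)
    then show "V.lin_dep T"
      unfolding V.lin_dep_def using A W(4,5)
      by (intro exI[of _ A] exI[of _ "\<lambda>x. u (of_vec x)"]) (auto simp: module_vec_simps)
  qed
qed

lemma rank_basis:
  fixes X :: "'k::field mat"
  assumes X: "X \<in> carrier_mat n n"
  obtains G where "finite G" "G \<subseteq> mat_act X ` Kn n" "fs.independent G" "card G = vec_space.rank n X"
    "\<And>v. v \<in> Kn n \<Longrightarrow> mat_act X v \<in> fs.span G"
proof -
  interpret V: vec_space "TYPE('k)" n .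
  have cols: "set (cols X) \<subseteq> carrier_vec n" using X cols_dim by blast
  obtain S where S: "maximal S (\<lambda>T. T \<subseteq> set (cols X) \<and> V.lin_indpt T)"
    using maximal_exists_superset[of "set (cols X)" "\<lambda>T. T \<subseteq> set (cols X) \<and> V.lin_indpt T" "{}"]
    by (metis (no_types, lifting) List.finite_set V.finite_lin_indpt2 V.fin_dim_li_fin empty_subsetI finite.emptyI empty_iff)
  have Ssub: "S \<subseteq> set (cols X)" "V.lin_indpt S" using S unfolding maximal_def by auto
  have Sc: "S \<subseteq> carrier_vec n" using Ssub cols by blast
  have col: "of_vec c \<in> fs.span (of_vec ` S)" if c: "c \<in> set (cols X)" for c
  proof (rule ccontr)
    assume out: "of_vec c \<notin> fs.span (of_vec ` S)"
    then have "c \<notin> S" using fs.span_base imageI by metis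
    have "fs.independent (insert (of_vec c) (of_vec ` S))"
      using out Ssub(2) lin_dep_iff_dependent[OF Sc] by (intro fs.independent_insertI) auto
    then have "V.lin_indpt (insert c S)"
      using lin_dep_iff_dependent[of "insert c S" n] Sc c cols by auto
    then have "insert c S = S" using S c Ssub(1) unfolding maximal_def by blast
    then show False using \<open>c \<notin> S\<close> by blast
  qed
  show ?thesis
  proof (rule that[of "of_vec ` S"])
    show "finite (of_vec ` S)" using Ssub(1) finite_subset by blast
    show "of_vec ` S \<subseteq> mat_act X ` Kn n"
    proof
      fix w assume "w \<in> of_vec ` S"
      then obtain j where "j < n" "w = of_vec (col X j)" using Ssub(1) X by (auto simp: cols_def)
      then show "w \<in> mat_act X ` Kn n" using mat_act_unit[OF X] unit_fun_in_Kn by (metis imageI)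
    qed
    show "fs.independent (of_vec ` S)" using Ssub(2) lin_dep_iff_dependent[OF Sc] by blast
    have "card (of_vec ` S) = card S" using inj_on_subset[OF inj_on_of_vec Sc] by (rule card_image)
    then show "card (of_vec ` S) = vec_space.rank n X" using V.rank_card_indpt[OF X S] by simp
    fix v :: "nat \<Rightarrow> 'k" assume v: "v \<in> Kn n"
    have "mat_act X v = mat_act X (\<Sum>j<n. scale_fun (v j) (unit_fun j))" using Kn_expand[OF v] by simp
    also have "\<dots> = (\<Sum>j<n. scale_fun (v j) (of_vec (col X j)))"
      using mat_act_unit[OF X]
      by (simp add: fs.linear_sum[OF linear_mat_act] fs.linear_scale[OF linear_mat_act])
    also have "\<dots> \<in> fs.span (of_vec ` S)"
      using X by (intro fs.span_sum fs.span_scale col) (auto simp: cols_def)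
    finally show "mat_act X v \<in> fs.span (of_vec ` S)" .
  qed
qed

lemma rank_le_card:
  assumes X: "X \<in> carrier_mat n n" and G: "finite G" "\<And>v. v \<in> Kn n \<Longrightarrow> mat_act X v \<in> fs.span G"
  shows "vec_space.rank n X \<le> card G"
proof -
  obtain H where H: "finite H" "H \<subseteq> mat_act X ` Kn n" "fs.independent H" "card H = vec_space.rank n X"
    using rank_basis[OF X] by metis
  have "H \<subseteq> fs.span G" using H(2) G(2) by blast
  then show ?thesis using fs.independent_span_bound[OF G(1) H(3)] H(4) by simp
qed

lemma rank_ge_card:
  assumes X: "X \<in> carrier_mat n n" and B: "fs.independent B" "B \<subseteq> mat_act X ` Kn n"
  shows "card B \<le> vec_space.rank n X"
proof -
  obtain G where G: "finite G" "card G = vec_space.rank n X" "\<And>v. v \<in> Kn n \<Longrightarrow> mat_act X v \<in> fs.span G"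
    using rank_basis[OF X] by metis
  have "B \<subseteq> fs.span G" using G(3) B(2) by blast
  then show ?thesis using fs.independent_span_bound[OF G(1) B(1)] G(2) by simp
qed

lemma subspace_of_vec:
  assumes "subspace_of_Kn n U"
  shows "fs.subspace (of_vec ` (U :: 'k::field vec set))" "of_vec ` U \<subseteq> Kn n"
proof -
  have U: "U \<subseteq> carrier_vec n" "0\<^sub>v n \<in> U" "\<And>v w. v \<in> U \<Longrightarrow> w \<in> U \<Longrightarrow> v + w \<in> U"
    "\<And>c v. v \<in> U \<Longrightarrow> c \<cdot>\<^sub>v v \<in> U"
    using assms unfolding subspace_def submodule_def by (auto simp: module_vec_simps)
  show "of_vec ` U \<subseteq> Kn n" using U(1) of_vec_in_Kn by blast
  have "of_vec (0\<^sub>v n) = (0 :: nat \<Rightarrow> 'k)" by (auto simp: of_vec_def)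
  then have "(0 :: nat \<Rightarrow> 'k) \<in> of_vec ` U" using U(2) by (metis imageI)
  moreover have "of_vec v + of_vec w \<in> of_vec ` U" if "v \<in> U" "w \<in> U" for v w
    using of_vec_add[of v n w] U(1,3) that by (metis imageI subsetD)
  moreover have "scale_fun c (of_vec v) \<in> of_vec ` U" if "v \<in> U" for c v
    using of_vec_smult[of c v] U(4)[OF that] by (metis imageI)
  ultimately show "fs.subspace (of_vec ` U)" unfolding fs.subspace_def by auto
qed

lemma subspace_basis:
  assumes sub: "subspace_of_Kn n (U :: 'k::field vec set)"
  obtains B where "fs.independent B" "fs.span B = of_vec ` U" "card B = subspace_dim n U"
proof -
  interpret V: vec_space "TYPE('k)" n .
  have Uc: "U \<subseteq> carrier_vec n" using sub unfolding subspace_def submodule_def by auto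
  obtain B where B: "B \<subseteq> of_vec ` U" "fs.independent B" "of_vec ` U \<subseteq> fs.span B"
    using fs.maximal_independent_subset by blast
  have span: "fs.span B = of_vec ` U"
    using B(1,3) fs.span_minimal[OF _ subspace_of_vec(1)[OF sub]] by blast
  have fin: "finite B" using card_le_Kn(1)[OF B(2)] B(1) subspace_of_vec(2)[OF sub] by blast
  obtain T where T: "T \<subseteq> U" "B = of_vec ` T" using B(1) by (meson subset_imageE)
  have Tc: "T \<subseteq> carrier_vec n" using T(1) Uc by blast
  have inj: "inj_on of_vec T" using inj_on_subset[OF inj_on_of_vec Tc] .
  have finT: "finite T" using fin T(2) inj finite_imageD by blast
  have indep: "V.lin_indpt T" using B(2) T(2) lin_dep_iff_dependent[OF Tc] by blast
  have spanT: "V.span T = U"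
  proof
    show "V.span T \<subseteq> U"
      using V.span_is_subset[OF T(1)] sub unfolding subspace_def by blast
    show "U \<subseteq> V.span T"
    proof
      fix v assume v: "v \<in> U"
      then have "of_vec v \<in> fs.span B" using span by blast
      then obtain u where u: "of_vec v = (\<Sum>w\<in>B. scale_fun (u w) w)"
        unfolding fs.span_finite[OF fin] by auto
      have "of_vec v = of_vec (V.lincomb (\<lambda>x. u (of_vec x)) T)"
        unfolding u T(2) sum.reindex[OF inj] of_vec_lincomb[OF Tc] by simp
      then have "v = V.lincomb (\<lambda>x. u (of_vec x)) T"
        using v Uc V.lincomb_closed[OF Tc] by (intro of_vec_inj[of _ n]) (auto simp: module_vec_simps)
      then show "v \<in> V.span T" unfolding V.span_def using finT by auto
    qed
  qed
  have submod: "submodule class_ring U V.V" using sub unfolding subspace_def by blast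
  have vs: "vectorspace class_ring (V.vs U)" using V.subspace_is_vs[OF sub] .
  have "vectorspace.basis class_ring (V.vs U) T"
    unfolding vectorspace.basis_def[OF vs]
    using V.span_li_not_depend[OF T(1) submod] indep spanT T(1) by simp
  then have "subspace_dim n U = card T" using vectorspace.dim_basis[OF vs finT] by blast
  then show ?thesis using that[OF B(2) span] T(2) card_image[OF inj] by simp
qed

lemma subspace_complement:
  assumes sub: "subspace_of_Kn n (U :: 'k::field vec set)"
  obtains C where "finite C" "C \<subseteq> Kn n" "subspace_dim n U + card C = n" "fs.span (of_vec ` U \<union> C) = Kn n"
proof -
  obtain B where B: "fs.independent B" "fs.span B = of_vec ` U" "card B = subspace_dim n U"
    using subspace_basis[OF sub] .
  have BK: "B \<subseteq> Kn n" using B(2) fs.span_superset subspace_of_vec(2)[OF sub] by blast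
  obtain C where C: "C \<subseteq> Kn n" "finite C" "fs.span (B \<union> C) = Kn n" "card B + card C = n"
    using extend_to_basis_Kn[OF B(1) BK] by metis
  have "fs.span (of_vec ` U \<union> C) = Kn n"
  proof
    show "fs.span (of_vec ` U \<union> C) \<subseteq> Kn n"
      using C(1) subspace_of_vec(2)[OF sub] by (intro fs.span_minimal subspace_Kn) auto
    have "B \<union> C \<subseteq> of_vec ` U \<union> C" using fs.span_superset[of B] B(2) by blast
    then show "Kn n \<subseteq> fs.span (of_vec ` U \<union> C)" using fs.span_mono C(3) by blast
  qed
  then show ?thesis using that C B(3) by metis
qed

lemma subspace_dim_ge_card:
  assumes sub: "subspace_of_Kn n (U :: 'k::field vec set)" and B: "fs.independent B" "B \<subseteq> of_vec ` U"
  shows "card B \<le> subspace_dim n U"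
proof -
  obtain D where D: "fs.independent D" "fs.span D = of_vec ` U" "card D = subspace_dim n U"
    using subspace_basis[OF sub] .
  have DK: "D \<subseteq> Kn n" using D(2) fs.span_superset subspace_of_vec(2)[OF sub] by blast
  show ?thesis using fs.independent_span_bound[OF card_le_Kn(1)[OF D(1) DK] B(1)] B(2) D(2,3) by simp
qed

declare scale_fun_apply [simp del] sum_fun_apply [simp del]


section \<open>Separating vectors and tilings\<close>

abbreviation linear_fun :: "((nat \<Rightarrow> 'k::field) \<Rightarrow> nat \<Rightarrow> 'k) \<Rightarrow> bool" where
  "linear_fun \<equiv> Vector_Spaces.linear scale_fun scale_fun"

lemma span_union_image:
  fixes g :: "'i \<Rightarrow> nat \<Rightarrow> 'k::field"
  assumes "finite F" "x \<in> fs.span (V \<union> g ` F)"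
  shows "\<exists>b. x - (\<Sum>f\<in>F. scale_fun (b f) (g f)) \<in> fs.span V"
  using assms
proof (induction F arbitrary: x rule: finite_induct)
  case empty
  then show ?case by simp
next
  case (insert f F)
  then obtain k where "x - scale_fun k (g f) \<in> fs.span (V \<union> g ` F)"
    by (auto simp: fs.span_insert)
  then obtain b where b: "x - scale_fun k (g f) - (\<Sum>f\<in>F. scale_fun (b f) (g f)) \<in> fs.span V"
    using insert.IH by blast
  have "(\<Sum>h\<in>insert f F. scale_fun ((b(f := k)) h) (g h)) =
      scale_fun k (g f) + (\<Sum>h\<in>F. scale_fun (b h) (g h))"
    using insert.hyps by (simp add: sum.insert) (intro sum.cong, auto)
  then show ?case using b by (intro exI[of _ "b(f := k)"]) (simp only: diff_diff_eq)
qed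

definition combine :: "'i set \<Rightarrow> ('i \<Rightarrow> (nat \<Rightarrow> 'k::field) \<Rightarrow> nat \<Rightarrow> 'k) \<Rightarrow> ('i \<Rightarrow> 'k) \<Rightarrow> (nat \<Rightarrow> 'k) \<Rightarrow> nat \<Rightarrow> 'k"
  where "combine I Y c u = (\<Sum>i\<in>I. scale_fun (c i) (Y i u))"

definition separates :: "'i set \<Rightarrow> ('i \<Rightarrow> (nat \<Rightarrow> 'k::field) \<Rightarrow> nat \<Rightarrow> 'k) \<Rightarrow> (nat \<Rightarrow> 'k) set \<Rightarrow> (nat \<Rightarrow> 'k) \<Rightarrow> bool"
  where "separates I Y W u \<longleftrightarrow> (\<forall>c. combine I Y c u \<in> W \<longrightarrow> (\<forall>i\<in>I. c i = 0))"

lemma separatesD: "separates I Y W u \<Longrightarrow> combine I Y c u \<in> W \<Longrightarrow> i \<in> I \<Longrightarrow> c i = 0"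
  unfolding separates_def by blast

lemma separates_mono: "separates I Y W u \<Longrightarrow> W' \<subseteq> W \<Longrightarrow> separates I Y W' u"
  unfolding separates_def by blast

lemma linear_combine:
  fixes Y :: "'i \<Rightarrow> (nat \<Rightarrow> 'k::field) \<Rightarrow> nat \<Rightarrow> 'k"
  assumes "\<And>i. i \<in> I \<Longrightarrow> linear_fun (Y i)"
  shows "linear_fun (combine I Y c)"
  unfolding Vector_Spaces.linear_iff
proof (intro conjI allI vector_space_scale_fun)
  fix u v and b :: 'k
  show "combine I Y c (u + v) = combine I Y c u + combine I Y c v"
    unfolding combine_def sum.distrib[symmetric]
    by (intro sum.cong refl) (simp only: fs.linear_add[OF assms] fs.scale_right_distrib)
  show "combine I Y c (scale_fun b u) = scale_fun b (combine I Y c u)"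
    unfolding combine_def fs.scale_sum_right
    by (intro sum.cong refl) (simp only: fs.linear_scale[OF assms] fs.scale_scale mult.commute)
qed

lemma combine_coeff_diff: "combine I Y (\<lambda>i. a i - b i) u = combine I Y a u - combine I Y b u"
  unfolding combine_def by (simp add: fs.scale_left_diff_distrib sum_subtractf)

lemma combine_coeff_scale: "combine I Y (\<lambda>i. t * a i) u = scale_fun t (combine I Y a u)"
  unfolding combine_def by (simp add: fs.scale_sum_right)

lemma combine_in_span: "combine I Y c u \<in> fs.span ((\<lambda>i. Y i u) ` I)"
  unfolding combine_def by (intro fs.span_sum fs.span_scale fs.span_base) auto

text \<open>
  A locally linearly dependent family of operators has a nontrivial combination of small rank, over
  every field. Induct on the number of operators, working modulo $V$ throughout. Let $u_0$ separate all operators but $Y_j$; after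
  subtracting a combination $Y'$ of $Y_j$ with the others kills $u_0$. If no vector separates the
  whole family, compare the dependences at a generic vector $v$, at $u_0$ and at $v + u_0$: they
  force $Y' v = 0$. Applied to $u$ and $u + w$ with $u$ generic with respect to $u_0$ and $w$, this
  gives $Y' w = 0$ for all $w$, contrary to the assumption on ranks. The $i$-th of the
  $k$ steps reserves $2 (i - 1)$ further vectors, which explains the bound $k (k - 1)$.
\<close>

lemma exists_separating_vector:
  fixes Y :: "'i \<Rightarrow> (nat \<Rightarrow> 'k::field) \<Rightarrow> nat \<Rightarrow> 'k"
  assumes "finite I" and U: "fs.subspace U" and lin: "\<And>i. i \<in> I \<Longrightarrow> linear_fun (Y i)"
    and big: "\<And>c B. \<exists>i\<in>I. c i \<noteq> 0 \<Longrightarrow> finite B \<Longrightarrow> card B \<le> card I * (card I - 1) \<Longrightarrow>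
      \<exists>u\<in>U. combine I Y c u \<notin> fs.span (V \<union> B)"
  shows "\<exists>u\<in>U. separates I Y (fs.span V) u"
  using \<open>finite I\<close> lin big
proof (induction I arbitrary: V rule: finite_induct)
  case empty
  show ?case using fs.subspace_0[OF U] unfolding separates_def by blast
next
  case (insert j I)
  define k where "k = card I"
  have linI: "linear_fun (Y i)" if "i \<in> I" for i using insert.prems(1) that by simp
  have linj: "linear_fun (Y j)" using insert.prems(1) by simp
  have add_c: "combine I Y c (u + v) = combine I Y c u + combine I Y c v" for c u v
    using fs.linear_add[OF linear_combine[of I Y c]] linI by blast
  have ins: "combine (insert j I) Y c u = scale_fun (c j) (Y j u) + combine I Y c u" for c u
    unfolding combine_def using insert.hyps by simp
  have generic: "\<exists>u\<in>U. separates I Y (fs.span (V \<union> B')) u" if B': "finite B'" "card B' \<le> 2 * k" for B' :: "(nat \<Rightarrow> 'k) set"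
  proof (rule insert.IH)
    show "linear_fun (Y i)" if "i \<in> I" for i using linI that .
    fix c and B :: "(nat \<Rightarrow> 'k) set" assume c: "\<exists>i\<in>I. c i \<noteq> (0::'k)" and B: "finite B" "card B \<le> card I * (card I - 1)"
    have "card (B' \<union> B) \<le> 2 * k + k * (k - 1)"
      using card_Un_le[of B' B] B(2) B'(2) unfolding k_def by linarith
    also have "\<dots> = card (insert j I) * (card (insert j I) - 1)"
      using insert.hyps unfolding k_def[symmetric] by (cases k) (auto simp: k_def)
    finally have "card (B' \<union> B) \<le> card (insert j I) * (card (insert j I) - 1)" .
    moreover have "\<exists>i\<in>insert j I. (c(j := 0)) i \<noteq> 0" using c insert.hyps(2) by auto
    ultimately have "\<exists>u\<in>U. combine (insert j I) Y (c(j := 0)) u \<notin> fs.span (V \<union> (B' \<union> B))"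
      using B(1) B'(1) by (intro insert.prems(2)) auto
    then obtain u where u: "u \<in> U" "combine (insert j I) Y (c(j := 0)) u \<notin> fs.span (V \<union> (B' \<union> B))"
      by blast
    have "combine I Y (c(j := 0)) u = combine I Y c u"
      unfolding combine_def using insert.hyps(2) by (intro sum.cong) auto
    then show "\<exists>u\<in>U. combine I Y c u \<notin> fs.span (V \<union> B' \<union> B)"
      using u unfolding ins by (auto simp: Un_assoc)
  qed
  show ?case
  proof (rule ccontr)
    assume "\<not> ?case"
    then have none: "\<exists>c. combine (insert j I) Y c u \<in> fs.span V \<and> (\<exists>i\<in>insert j I. c i \<noteq> 0)"
      if "u \<in> U" for u using that unfolding separates_def by blast
    have solve: "\<exists>a. Y j u - combine I Y a u \<in> fs.span V"
      if u: "u \<in> U" "separates I Y (fs.span V) u" for u :: "nat \<Rightarrow> 'k"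
    proof -
      obtain c i where c: "combine (insert j I) Y c u \<in> fs.span V" "i \<in> insert j I" "c i \<noteq> 0"
        using none[OF u(1)] by blast
      have cj: "c j \<noteq> 0"
      proof
        assume "c j = 0"
        then have "combine I Y c u \<in> fs.span V" using c(1) unfolding ins by simp
        then have "c i = 0" if "i \<in> I" for i using separatesD[OF u(2)] that by blast
        then show False using c \<open>c j = 0\<close> by auto
      qed
      have "scale_fun (inverse (c j)) (combine (insert j I) Y c u) \<in> fs.span V"
        using c(1) by (rule fs.span_scale)
      moreover have "scale_fun (inverse (c j)) (combine (insert j I) Y c u) =
          Y j u - combine I Y (\<lambda>i. - inverse (c j) * c i) u"
        unfolding ins combine_coeff_scale using cj by (simp add: fs.scale_right_distrib)
      ultimately show ?thesis by metis
    qed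
    obtain u0 where u0: "u0 \<in> U" "separates I Y (fs.span V) u0" using generic[of "{}"] by auto
    obtain a where a: "Y j u0 - combine I Y a u0 \<in> fs.span V" using solve[OF u0] by blast
    define Y' where "Y' u = Y j u - combine I Y a u" for u
    have Y'_add: "Y' (u + v) = Y' u + Y' v" for u v
      unfolding Y'_def add_c using fs.linear_add[OF linj, of u v] by simp
    obtain w where w: "w \<in> U" "Y' w \<notin> fs.span V"
    proof -
      have "\<exists>u\<in>U. combine (insert j I) Y ((\<lambda>i. - a i)(j := 1)) u \<notin> fs.span (V \<union> {})"
        by (rule insert.prems(2)) auto
      moreover have "combine (insert j I) Y ((\<lambda>i. - a i)(j := 1)) u = Y' u" for u
      proof -
        have "combine I Y ((\<lambda>i. - a i)(j := 1)) u = combine I Y (\<lambda>i. - a i) u"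
          unfolding combine_def using insert.hyps(2) by (intro sum.cong) auto
        also have "\<dots> = - combine I Y a u" using combine_coeff_scale[of I Y "-1" a u] by simp
        finally show ?thesis unfolding ins Y'_def by simp
      qed
      ultimately show ?thesis using that by auto
    qed
    define B0 where "B0 = (\<lambda>i. Y i u0) ` I"
    define B1 where "B1 = (\<lambda>i. Y i w) ` I"
    \<comment> \<open>the dependences at v and at v + u0 have coefficients b and c; independence modulo V and B0 makes both vanish\<close>
    have vanish: "Y' v \<in> fs.span V" if v: "v \<in> U" "separates I Y (fs.span (V \<union> B0)) v" for v
    proof -
      have mono: "fs.span V \<subseteq> fs.span (V \<union> B0)" by (rule fs.span_mono) auto
      have B0: "combine I Y c u0 \<in> fs.span (V \<union> B0)" for c
        using combine_in_span[of I Y c u0] fs.span_mono[of B0 "V \<union> B0"] unfolding B0_def by blast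
      obtain b' where "Y j v - combine I Y b' v \<in> fs.span V"
        using solve[OF v(1) separates_mono[OF v(2) mono]] by blast
      then have b: "Y' v - combine I Y (\<lambda>i. b' i - a i) v \<in> fs.span V"
        unfolding Y'_def combine_coeff_diff by (simp add: algebra_simps)
      have sum_sep: "separates I Y (fs.span V) (v + u0)"
        unfolding separates_def
      proof (intro allI impI ballI)
        fix c i assume c: "combine I Y c (v + u0) \<in> fs.span V" and i: "i \<in> I"
        have "combine I Y c v = combine I Y c (v + u0) - combine I Y c u0" unfolding add_c by simp
        also have "\<dots> \<in> fs.span (V \<union> B0)" using c mono B0 by (intro fs.span_diff) auto
        finally show "c i = 0" using separatesD[OF v(2)] i by blast
      qed
      obtain c' where "Y j (v + u0) - combine I Y c' (v + u0) \<in> fs.span V"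
        using solve[OF fs.subspace_add[OF U v(1) u0(1)] sum_sep] by blast
      then have c: "Y' (v + u0) - combine I Y (\<lambda>i. c' i - a i) (v + u0) \<in> fs.span V"
        unfolding Y'_def combine_coeff_diff by (simp add: algebra_simps)
      define b where "b i = b' i - a i" for i
      define c where "c i = c' i - a i" for i
      have 1: "Y' v - combine I Y b v \<in> fs.span V" using b unfolding b_def .
      have 2: "Y' v + Y' u0 - combine I Y c v - combine I Y c u0 \<in> fs.span V"
        using \<open>Y' (v + u0) - combine I Y (\<lambda>i. c' i - a i) (v + u0) \<in> fs.span V\<close>
        unfolding c_def[symmetric] Y'_add add_c by (simp add: algebra_simps)
      have 3: "Y' u0 \<in> fs.span V" using a unfolding Y'_def .
      have "combine I Y (\<lambda>i. b i - c i) v =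
          (Y' v + Y' u0 - combine I Y c v - combine I Y c u0) - (Y' v - combine I Y b v) - Y' u0
          + combine I Y c u0"
        unfolding combine_coeff_diff by simp
      also have "\<dots> \<in> fs.span (V \<union> B0)"
        by (intro fs.span_add[OF fs.span_diff[OF fs.span_diff[OF
              subsetD[OF mono 2] subsetD[OF mono 1]] subsetD[OF mono 3]] B0])
      finally have bc: "b i = c i" if "i \<in> I" for i
        using separatesD[OF v(2), of "\<lambda>i. b i - c i"] that by simp
      have "combine I Y b v = combine I Y c v" unfolding combine_def by (intro sum.cong) (auto simp: bc)
      then have "combine I Y c u0 =
          (Y' v - combine I Y b v) + Y' u0 - (Y' v + Y' u0 - combine I Y c v - combine I Y c u0)"
        by simp
      also have "\<dots> \<in> fs.span V" by (rule fs.span_diff[OF fs.span_add[OF 1 3] 2])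
      finally have "c i = 0" if "i \<in> I" for i using separatesD[OF u0(2)] that by blast
      then have "combine I Y b v = 0" unfolding combine_def by (intro sum.neutral) (auto simp: bc)
      then show ?thesis using 1 by simp
    qed
    have "card (B0 \<union> B1) \<le> 2 * k"
      using card_Un_le[of B0 B1] card_image_le[OF insert.hyps(1), of "\<lambda>i. Y i u0"]
        card_image_le[OF insert.hyps(1), of "\<lambda>i. Y i w"]
      unfolding B0_def[symmetric] B1_def[symmetric] k_def[symmetric] by linarith
    moreover have "finite (B0 \<union> B1)" unfolding B0_def B1_def using insert.hyps(1) by simp
    ultimately obtain u where u: "u \<in> U" "separates I Y (fs.span (V \<union> (B0 \<union> B1))) u"
      using generic by blast
    have mono: "fs.span (V \<union> B0) \<subseteq> fs.span (V \<union> (B0 \<union> B1))" by (rule fs.span_mono) auto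
    have "separates I Y (fs.span (V \<union> B0)) (u + w)"
      unfolding separates_def
    proof (intro allI impI ballI)
      fix c i assume c: "combine I Y c (u + w) \<in> fs.span (V \<union> B0)" and i: "i \<in> I"
      have cw: "combine I Y c w \<in> fs.span (V \<union> (B0 \<union> B1))"
        using combine_in_span[of I Y c w] fs.span_mono[of B1 "V \<union> (B0 \<union> B1)"] unfolding B1_def by blast
      have "combine I Y c (u + w) - combine I Y c w \<in> fs.span (V \<union> (B0 \<union> B1))"
        by (rule fs.span_diff[OF subsetD[OF mono c] cw])
      then have "combine I Y c u \<in> fs.span (V \<union> (B0 \<union> B1))" unfolding add_c by simp
      then show "c i = 0" by (rule separatesD[OF u(2) _ i])
    qed
    then have "Y' (u + w) \<in> fs.span V" using vanish fs.subspace_add[OF U u(1) w(1)] by blast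
    moreover have "Y' u \<in> fs.span V" using vanish[OF u(1) separates_mono[OF u(2) mono]] .
    ultimately have "Y' (u + w) - Y' u \<in> fs.span V" by (rule fs.span_diff)
    then show False using w(2) unfolding Y'_add by simp
  qed
qed

lemma independent_union_separated:
  assumes "finite F" and V: "fs.independent V" and sep: "separates F Y (fs.span V) u"
  shows "inj_on (\<lambda>f. Y f u) F \<and> fs.independent (V \<union> (\<lambda>f. Y f u) ` F) \<and> V \<inter> (\<lambda>f. Y f u) ` F = {}"
  using \<open>finite F\<close> sep
proof (induction F rule: finite_induct)
  case empty
  then show ?case using V by simp
next
  case (insert h F)
  have ins: "combine (insert h F) Y c u = scale_fun (c h) (Y h u) + combine F Y c u" for c
    unfolding combine_def using insert.hyps by simp
  have "separates F Y (fs.span V) u"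
    unfolding separates_def
  proof (intro allI impI ballI)
    fix c i assume c: "combine F Y c u \<in> fs.span V" and i: "i \<in> F"
    have "combine F Y (c(h := 0)) u = combine F Y c u"
      unfolding combine_def using insert.hyps(2) by (intro sum.cong) auto
    then have "combine (insert h F) Y (c(h := 0)) u \<in> fs.span V" unfolding ins using c by simp
    then have "(c(h := 0)) i = 0" using separatesD[OF insert.prems] i by blast
    then show "c i = 0" using i insert.hyps(2) by (auto split: if_splits)
  qed
  note IH = insert.IH[OF this]
  have out: "Y h u \<notin> fs.span (V \<union> (\<lambda>f. Y f u) ` F)"
  proof
    assume "Y h u \<in> fs.span (V \<union> (\<lambda>f. Y f u) ` F)"
    then obtain b where b: "Y h u - (\<Sum>f\<in>F. scale_fun (b f) (Y f u)) \<in> fs.span V"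
      using span_union_image[OF insert.hyps(1)] by blast
    have "combine F Y ((\<lambda>i. - b i)(h := 1)) u = (\<Sum>f\<in>F. - scale_fun (b f) (Y f u))"
      unfolding combine_def using insert.hyps(2) by (intro sum.cong) (auto simp: fun_eq_iff)
    then have "combine (insert h F) Y ((\<lambda>i. - b i)(h := 1)) u \<in> fs.span V"
      unfolding ins using b by (simp add: sum_negf)
    then have "((\<lambda>i. - b i)(h := 1)) h = 0" using separatesD[OF insert.prems] by blast
    then show False by simp
  qed
  then have "Y h u \<notin> V \<union> (\<lambda>f. Y f u) ` F" using fs.span_base by metis
  then show ?case using IH fs.independent_insertI[OF out] by auto
qed

text \<open>A tile is the set of images of one vector $u_i$ under the maps $Y_f$.\<close>

definition tiles :: "'i set \<Rightarrow> ('i \<Rightarrow> (nat \<Rightarrow> 'k::field) \<Rightarrow> nat \<Rightarrow> 'k) \<Rightarrow> nat \<Rightarrow> (nat \<Rightarrow> nat \<Rightarrow> 'k) \<Rightarrow> bool" where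
  "tiles F Y k u \<longleftrightarrow> inj_on (\<lambda>(f, i). Y f (u i)) (F \<times> {..<k}) \<and>
     fs.independent ((\<lambda>(f, i). Y f (u i)) ` (F \<times> {..<k}))"

text \<open>
  Take a maximal number $k$ of tiles. If they left too much room, every nontrivial combination of
  the $Y_f$ would map $U$ outside the span of the tiles and of $|F| (|F| - 1)$ more vectors, and a
  separating vector would yield one more tile. This is a linear version of the quasi-tilings of
  Ornstein and Weiss.
\<close>

lemma exists_tiles:
  fixes Y :: "'i \<Rightarrow> (nat \<Rightarrow> 'k::field) \<Rightarrow> nat \<Rightarrow> 'k"
  assumes F: "finite F" "F \<noteq> {}" and lin: "\<And>f. f \<in> F \<Longrightarrow> linear_fun (Y f)"
    and Kn: "\<And>f v. f \<in> F \<Longrightarrow> v \<in> Kn n \<Longrightarrow> Y f v \<in> Kn n"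
    and U: "fs.subspace U" "U \<subseteq> Kn n" and C: "finite C" "card C \<le> \<kappa>" "fs.span (U \<union> C) = Kn n"
    and rank: "\<And>c G. \<exists>f\<in>F. c f \<noteq> 0 \<Longrightarrow> finite G \<Longrightarrow> (\<And>v. v \<in> Kn n \<Longrightarrow> combine F Y c v \<in> fs.span G) \<Longrightarrow>
      n \<le> card G + \<kappa>'"
  obtains k u where "tiles F Y k u" "\<And>i. i < k \<Longrightarrow> u i \<in> U"
    "n \<le> k * card F + card F * (card F - 1) + \<kappa> + \<kappa>'"
proof -
  define good where "good k u \<longleftrightarrow> tiles F Y k u \<and> (\<forall>i<k. u i \<in> U)" for k u
  have cardV: "card ((\<lambda>(f, i). Y f (u i)) ` (F \<times> {..<k})) = k * card F" if "good k u" for k u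
    using that unfolding good_def tiles_def by (simp add: card_image card_cartesian_product mult.commute)
  have bound: "k \<le> n" if g: "good k u" for k u
  proof -
    have "(\<lambda>(f, i). Y f (u i)) ` (F \<times> {..<k}) \<subseteq> Kn n"
    proof clarify
      fix f i assume "f \<in> F" "i < k"
      moreover have "u i \<in> Kn n" using g U(2) \<open>i < k\<close> unfolding good_def by auto
      ultimately show "Y f (u i) \<in> Kn n" by (intro Kn)
    qed
    then have "k * card F \<le> n" using card_le_Kn(2) cardV[OF g] g unfolding good_def tiles_def by metis
    moreover have "card F \<ge> 1" using F by (simp add: card_gt_0_iff Suc_le_eq)
    ultimately show ?thesis by (metis le_trans mult_le_mono2 nat_mult_1_right)
  qed
  have "good 0 (\<lambda>_. 0)" unfolding good_def tiles_def by (simp add: fs.independent_empty)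
  then obtain k where k: "\<exists>u. good k u" and max: "\<And>k'. \<exists>u. good k' u \<Longrightarrow> k' \<le> k"
    using GreatestI_ex_nat[of "\<lambda>k. \<exists>u. good k u" n] Greatest_le_nat[of "\<lambda>k. \<exists>u. good k u" _ n] bound
    by blast
  obtain u where u: "good k u" using k by blast
  define V where "V = (\<lambda>(f, i). Y f (u i)) ` (F \<times> {..<k})"
  have V: "fs.independent V" "finite V" "card V = k * card F"
    using u F(1) cardV[OF u] unfolding V_def good_def tiles_def by auto
  have "n \<le> k * card F + card F * (card F - 1) + \<kappa> + \<kappa>'"
  proof (rule ccontr)
    assume less: "\<not> ?thesis"
    have "\<exists>w\<in>U. separates F Y (fs.span V) w"
    proof (rule exists_separating_vector[OF F(1) U(1) lin])
      fix c and B :: "(nat \<Rightarrow> 'k) set" assume c: "\<exists>f\<in>F. c f \<noteq> (0::'k)" and B: "finite B" "card B \<le> card F * (card F - 1)"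
      show "\<exists>w\<in>U. combine F Y c w \<notin> fs.span (V \<union> B)"
      proof (rule ccontr)
        assume "\<not> ?thesis"
        then have inU: "combine F Y c w \<in> fs.span (V \<union> B)" if "w \<in> U" for w using that by blast
        define G where "G = V \<union> B \<union> combine F Y c ` C"
        have lc: "linear_fun (combine F Y c)" using lin by (rule linear_combine)
        have "combine F Y c v \<in> fs.span G" if v: "v \<in> Kn n" for v
        proof -
          have "combine F Y c ` (U \<union> C) \<subseteq> fs.span G"
            using inU fs.span_mono[of "V \<union> B" G] fs.span_superset[of G] unfolding G_def by blast
          then have "fs.span (combine F Y c ` (U \<union> C)) \<subseteq> fs.span G"
            by (rule fs.span_minimal) (rule fs.subspace_span)
          moreover have "combine F Y c v \<in> combine F Y c ` fs.span (U \<union> C)" using v C(3) by blast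
          ultimately show ?thesis using fs.linear_span_image[OF lc] by blast
        qed
        then have "n \<le> card G + \<kappa>'" using V(2) B(1) C(1) unfolding G_def by (intro rank[OF c]) auto
        moreover have "card G \<le> card V + card B + card (combine F Y c ` C)"
          unfolding G_def using card_Un_le[of "V \<union> B" "combine F Y c ` C"] card_Un_le[of V B] by linarith
        moreover have "card (combine F Y c ` C) \<le> \<kappa>" using card_image_le[OF C(1)] C(2) le_trans by blast
        ultimately show False using less V(3) B(2) by linarith
      qed
    qed
    then obtain w where w: "w \<in> U" "separates F Y (fs.span V) w" by blast
    note indep = independent_union_separated[OF F(1) V(1) w(2)]
    define u' where "u' = u(k := w)"
    have prod: "F \<times> {..<Suc k} = F \<times> {..<k} \<union> (\<lambda>f. (f, k)) ` F" by (auto simp: less_Suc_eq)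
    have old: "(\<lambda>(f, i). Y f (u' i)) ` (F \<times> {..<k}) = V"
      unfolding V_def u'_def by (intro image_cong) auto
    have new: "(\<lambda>(f, i). Y f (u' i)) ` (\<lambda>f. (f, k)) ` F = (\<lambda>f. Y f w) ` F"
      unfolding u'_def by (auto simp: image_image)
    have img: "(\<lambda>(f, i). Y f (u' i)) ` (F \<times> {..<Suc k}) = V \<union> (\<lambda>f. Y f w) ` F"
      unfolding prod image_Un old new ..
    have "inj_on (\<lambda>(f, i). Y f (u' i)) (F \<times> {..<Suc k})"
      unfolding prod inj_on_Un
    proof (intro conjI)
      have "inj_on (\<lambda>(f, i). Y f (u i)) (F \<times> {..<k})" using u unfolding good_def tiles_def by blast
      then show "inj_on (\<lambda>(f, i). Y f (u' i)) (F \<times> {..<k})"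
        unfolding u'_def by (rule inj_on_cong[THEN iffD1, rotated]) auto
      show "inj_on (\<lambda>(f, i). Y f (u' i)) ((\<lambda>f. (f, k)) ` F)"
        using indep unfolding u'_def by (auto simp: inj_on_def)
      have "V \<inter> (\<lambda>f. Y f w) ` F = {}" using indep by blast
      then show "(\<lambda>(f, i). Y f (u' i)) ` (F \<times> {..<k} - (\<lambda>f. (f, k)) ` F) \<inter>
          (\<lambda>(f, i). Y f (u' i)) ` ((\<lambda>f. (f, k)) ` F - F \<times> {..<k}) = {}"
        using old new by blast
    qed
    moreover have "\<forall>i<Suc k. u' i \<in> U" using u w(1) unfolding u'_def good_def by (auto simp: less_Suc_eq)
    ultimately have "good (Suc k) u'" unfolding good_def tiles_def img using indep by blast
    then show False using max[of "Suc k"] by auto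
  qed
  then show ?thesis using that u unfolding good_def by blast
qed


section \<open>Algebras, their filtrations and group algebras\<close>

lemma (in Vector_Spaces.vector_space) independent_family:
  assumes "finite I" and zero: "\<And>c. (\<Sum>i\<in>I. scale (c i) (f i)) = 0 \<Longrightarrow> \<forall>i\<in>I. c i = 0"
  shows "inj_on f I" "independent (f ` I)"
proof -
  show inj: "inj_on f I"
  proof (rule inj_onI, rule ccontr)
    fix i j assume ij: "i \<in> I" "j \<in> I" "f i = f j" "i \<noteq> j"
    define c :: "_ \<Rightarrow> 'a" where "c = (\<lambda>k. if k = i then 1 else if k = j then - 1 else 0)"
    have "(\<Sum>k\<in>I. scale (c k) (f k)) = (\<Sum>k\<in>{i, j}. scale (c k) (f k))"
      using ij \<open>finite I\<close> by (intro sum.mono_neutral_right) (auto simp: c_def)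
    also have "\<dots> = 0" using ij(3,4) by (simp add: c_def)
    finally have "c i = 0" using zero ij(1) by blast
    then show False by (simp add: c_def)
  qed
  show "independent (f ` I)"
  proof
    assume "dependent (f ` I)"
    then obtain u v where u: "(\<Sum>v\<in>f ` I. scale (u v) v) = 0" "v \<in> f ` I" "u v \<noteq> 0"
      using dependent_finite[of "f ` I"] \<open>finite I\<close> by auto
    have "(\<Sum>i\<in>I. scale (u (f i)) (f i)) = 0" using u(1) by (simp add: sum.reindex[OF inj])
    then show False using zero[of "\<lambda>i. u (f i)"] u(2,3) by blast
  qed
qed

context K_algebra
begin

lemma monomials_upto_mono: "d \<le> d' \<Longrightarrow> monomials_upto S d \<subseteq> monomials_upto S d'"
  unfolding monomials_upto_def by auto

lemma A_upto_mono: "d \<le> d' \<Longrightarrow> A_upto S d \<subseteq> A_upto S d'"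
  unfolding A_upto_def by (intro span_mono monomials_upto_mono)

lemma prod_list_in_A_upto: "set w \<subseteq> S \<Longrightarrow> length w \<le> d \<Longrightarrow> prod_list w \<in> A_upto S d"
  unfolding A_upto_def monomials_upto_def by (intro span_base) blast

lemma generator_in_A_upto: "s \<in> S \<Longrightarrow> 1 \<le> d \<Longrightarrow> s \<in> A_upto S d"
  using prod_list_in_A_upto[of "[s]" S d] by simp

lemma subspace_A_upto: "subspace (A_upto S d)"
  unfolding A_upto_def by (rule subspace_span)

lemma A_upto_exhausts:
  assumes "generating_set S"
  shows "\<exists>d. x \<in> A_upto S d"
proof -
  have "subspace {x. \<exists>d. x \<in> A_upto S d}"
    unfolding subspace_def
  proof (intro conjI ballI allI)
    show "0 \<in> {x. \<exists>d. x \<in> A_upto S d}" using subspace_0[OF subspace_A_upto] by blast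
    fix x y assume "x \<in> {x. \<exists>d. x \<in> A_upto S d}" "y \<in> {x. \<exists>d. x \<in> A_upto S d}"
    then obtain d d' where "x \<in> A_upto S d" "y \<in> A_upto S d'" by blast
    then have "x \<in> A_upto S (max d d')" "y \<in> A_upto S (max d d')"
      using A_upto_mono[of d "max d d'" S] A_upto_mono[of d' "max d d'" S] by auto
    then show "x + y \<in> {x. \<exists>d. x \<in> A_upto S d}" using subspace_add[OF subspace_A_upto] by blast
  next
    fix c x assume "x \<in> {x. \<exists>d. x \<in> A_upto S d}"
    then show "scale c x \<in> {x. \<exists>d. x \<in> A_upto S d}" using subspace_scale[OF subspace_A_upto] by blast
  qed
  moreover have "{prod_list w |w. set w \<subseteq> S} \<subseteq> {x. \<exists>d. x \<in> A_upto S d}"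
    using prod_list_in_A_upto by blast
  ultimately have "span {prod_list w |w. set w \<subseteq> S} \<subseteq> {x. \<exists>d. x \<in> A_upto S d}" by (intro span_minimal)
  then show ?thesis using assms unfolding generating_set_def by blast
qed

lemma finite_subset_A_upto:
  assumes "generating_set S" "finite X"
  obtains d0 where "\<And>d. d \<ge> d0 \<Longrightarrow> X \<subseteq> A_upto S d"
proof -
  have "\<exists>d0. X \<subseteq> A_upto S d0" using \<open>finite X\<close>
  proof (induction X rule: finite_induct)
    case (insert x X)
    then obtain d0 d1 where "X \<subseteq> A_upto S d0" "x \<in> A_upto S d1" using A_upto_exhausts[OF assms(1)] by blast
    then have "insert x X \<subseteq> A_upto S (max d0 d1)"
      using A_upto_mono[of d0 "max d0 d1" S] A_upto_mono[of d1 "max d0 d1" S] by auto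
    then show ?case by blast
  qed simp
  then show ?thesis using that A_upto_mono by (meson subset_trans)
qed

lemma finite_monomials_upto: "finite S \<Longrightarrow> finite (monomials_upto S d)"
proof -
  assume "finite S"
  have "monomials_upto S d = prod_list ` {w. set w \<subseteq> S \<and> length w \<le> d}"
    unfolding monomials_upto_def by auto
  then show ?thesis using finite_lists_length_le[OF \<open>finite S\<close>] by simp
qed

lemma approximation_weaken:
  assumes "approximation_of S d' n \<phi>" "1 \<le> d" "d \<le> d'"
  shows "approximation_of S d n \<phi>"
proof -
  have r: "1 - 1 / real d \<le> 1 - 1 / real d'" using assms(2,3) by (simp add: frac_le)
  then have rn: "(1 - 1 / real d) * real n \<le> (1 - 1 / real d') * real n" by (rule mult_right_mono) simp
  note sub = subsetD[OF A_upto_mono[OF assms(3)]]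
  obtain U where U: "subspace_of_Kn n U"
    "\<And>x y u. x \<in> A_upto S d' \<Longrightarrow> y \<in> A_upto S d' \<Longrightarrow> u \<in> U \<Longrightarrow> \<phi> (x * y) *\<^sub>v u = \<phi> x *\<^sub>v (\<phi> y *\<^sub>v u)"
    "real (subspace_dim n U) \<ge> (1 - 1 / real d') * real n"
    using assms(1) unfolding approximation_of_def by blast
  show ?thesis
    unfolding approximation_of_def
  proof (intro conjI exI[of _ U] ballI impI)
    show "linear_to_mat n \<phi>" using assms(1) unfolding approximation_of_def by blast
    show "(1 - 1 / real d) * real n \<le> real (subspace_dim n U)" using U(3) rn by linarith
    fix a assume "a \<in> A_upto S d" "a \<noteq> 0"
    then have "1 - 1 / real d' \<le> rk n (\<phi> a)" using assms(1) sub unfolding approximation_of_def by blast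
    then show "1 - 1 / real d \<le> rk n (\<phi> a)" using r by linarith
  qed (use U sub in auto)
qed

lemma linear_to_mat_act:
  assumes "linear_to_mat n \<phi>"
  shows "mat_act (\<phi> (x + y)) v = mat_act (\<phi> x) v + mat_act (\<phi> y) v"
    "mat_act (\<phi> (scale c x)) v = scale_fun c (mat_act (\<phi> x) v)"
    "mat_act (\<phi> (\<Sum>i\<in>I. scale (a i) (f i))) v = combine I (\<lambda>i. mat_act (\<phi> (f i))) a v"
proof -
  have car: "\<phi> x \<in> carrier_mat n n" for x using assms unfolding linear_to_mat_def by blast
  show add: "mat_act (\<phi> (x + y)) v = mat_act (\<phi> x) v + mat_act (\<phi> y) v" for x y
    using assms mat_act_plus[OF car car] unfolding linear_to_mat_def by simp
  show sc: "mat_act (\<phi> (scale c x)) v = scale_fun c (mat_act (\<phi> x) v)" for c x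
    using assms mat_act_smult[OF car] unfolding linear_to_mat_def by simp
  have zero: "mat_act (\<phi> 0) v = 0" using sc[of 0 0] by simp
  show "mat_act (\<phi> (\<Sum>i\<in>I. scale (a i) (f i))) v = combine I (\<lambda>i. mat_act (\<phi> (f i))) a v"
    unfolding combine_def
    by (induction I rule: infinite_finite_induct) (simp_all only: sum.infinite sum.empty sum.insert zero add sc not_False_eq_True)
qed

end

abbreviation grp :: "'g \<Rightarrow> 'g::group_add \<Rightarrow>\<^sub>0 'k::field" where
  "grp g \<equiv> Poly_Mapping.single g 1"

lemma group_algebra_expand:
  assumes "finite K" "Poly_Mapping.keys x \<subseteq> K"
  shows "x = (\<Sum>g\<in>K. scale_ga (Poly_Mapping.lookup x g) (grp g))"
proof (rule poly_mapping_eqI)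
  fix h
  have "Poly_Mapping.lookup (\<Sum>g\<in>K. scale_ga (Poly_Mapping.lookup x g) (grp g)) h
      = (\<Sum>g\<in>K. Poly_Mapping.lookup x g * (1 when g = h))"
    by (simp add: lookup_sum lookup_scale_ga lookup_single)
  also have "\<dots> = (if h \<in> K then Poly_Mapping.lookup x h else 0)"
    using assms(1) by (simp add: when_def if_distrib cong: if_cong)
  also have "\<dots> = Poly_Mapping.lookup x h" using assms(2) by (auto simp: in_keys_iff)
  finally show "Poly_Mapping.lookup x h
      = Poly_Mapping.lookup (\<Sum>g\<in>K. scale_ga (Poly_Mapping.lookup x g) (grp g)) h" ..
qed

lemma lookup_combination:
  assumes "finite K"
  shows "Poly_Mapping.lookup (\<Sum>g\<in>K. scale_ga (c g) (grp g)) h = (if h \<in> K then c h else 0)"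
  using assms by (simp add: lookup_sum lookup_scale_ga lookup_single when_def if_distrib cong: if_cong)

lemma lookup_single_mult:
  fixes y :: "'g::group_add \<Rightarrow>\<^sub>0 'k::field"
  shows "Poly_Mapping.lookup (Poly_Mapping.single e a * y) h = a * Poly_Mapping.lookup y (- e + h)"
proof (induction y rule: group_algebra_induct)
  case zero
  show ?case by simp
next
  case (add_single y g b)
  have "e + g = h \<longleftrightarrow> g = - e + h" by (metis add.assoc add.left_neutral left_minus minus_add_cancel)
  then show ?case using add_single
    by (simp add: distrib_left lookup_add mult_single lookup_single when_def)
qed

lemma lookup_mult_single:
  fixes x :: "'g::group_add \<Rightarrow>\<^sub>0 'k::field"
  shows "Poly_Mapping.lookup (x * Poly_Mapping.single g a) h = Poly_Mapping.lookup x (h - g) * a"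
proof (induction x rule: group_algebra_induct)
  case zero
  show ?case by simp
next
  case (add_single x e b)
  have "e + g = h \<longleftrightarrow> e = h - g" by (metis add_diff_cancel diff_add_cancel)
  then show ?case using add_single
    by (simp add: distrib_right lookup_add mult_single lookup_single when_def)
qed

lemma lookup_mult_left_sum:
  fixes a y :: "'g::group_add \<Rightarrow>\<^sub>0 'k::field"
  assumes "finite K" "Poly_Mapping.keys a \<subseteq> K"
  shows "Poly_Mapping.lookup (a * y) h =
    (\<Sum>e\<in>K. Poly_Mapping.lookup a e * Poly_Mapping.lookup y (- e + h))"
proof -
  have "a * y = (\<Sum>e\<in>K. Poly_Mapping.single e (Poly_Mapping.lookup a e)) * y"
    using group_algebra_expand[OF assms] by (simp add: scale_ga_single)
  then show ?thesis by (simp add: sum_distrib_right lookup_sum lookup_single_mult)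
qed

text \<open>
  Only finitely many group elements occur in $A_{\<le> d}$, although the space itself may be infinite;
  bounds that depend on supports only are uniform over $A_{\<le> d}$.
\<close>

lemma A_upto_supported:
  fixes S :: "('g::group_add \<Rightarrow>\<^sub>0 'k::field) set"
  assumes "finite S"
  obtains E where "finite E" "0 \<in> E" "\<And>x. x \<in> group_algebra.A_upto S d \<Longrightarrow> Poly_Mapping.keys x \<subseteq> E"
proof -
  define E where "E = insert 0 (\<Union>x\<in>group_algebra.monomials_upto S d. Poly_Mapping.keys x)"
  have "finite E" unfolding E_def using group_algebra.finite_monomials_upto[OF assms] by simp
  moreover have "Poly_Mapping.keys x \<subseteq> E" if "x \<in> group_algebra.A_upto S d" for x
    using that unfolding group_algebra.A_upto_def
  proof (induction rule: group_algebra.span_induct_alt)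
    case (step c x y)
    have "Poly_Mapping.keys (scale_ga c x) \<subseteq> Poly_Mapping.keys x"
      by (auto simp: in_keys_iff lookup_scale_ga)
    then show ?case using step keys_add[of "scale_ga c x" y] unfolding E_def by blast
  qed simp
  ultimately show ?thesis using that unfolding E_def by blast
qed


section \<open>Permutation representations of residually finite groups\<close>

lemma keys_mult_sumset:
  assumes "Poly_Mapping.keys x \<subseteq> E" "Poly_Mapping.keys y \<subseteq> F"
  shows "Poly_Mapping.keys (x * y) \<subseteq> sumset E F"
proof
  fix h assume "h \<in> Poly_Mapping.keys (x * y)"
  then obtain e f where "e \<in> Poly_Mapping.keys x" "f \<in> Poly_Mapping.keys y" "h = e + f"
    using keys_mult[of x y] by blast
  then show "h \<in> sumset E F" using assms by (auto intro: in_sumset)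
qed

text \<open>
  Columns outside a maximal independent set of columns are combinations of that set. The resulting
  relations form a basis of the kernel that is dual to the coordinates in $P$, so restricting
  kernel vectors to a set of points loses no independence of those whose pivot lies in it.
\<close>

lemma kernel_coordinates:
  fixes X :: "'k::field mat"
  assumes X: "X \<in> carrier_mat n n"
  obtains P b where "P \<subseteq> {..<n}" "n \<le> vec_space.rank n X + card P"
    "\<And>p. p \<in> P \<Longrightarrow> b p \<in> Kn n" "\<And>p. p \<in> P \<Longrightarrow> mat_act X (b p) = 0"
    "\<And>p p'. p \<in> P \<Longrightarrow> p' \<in> P \<Longrightarrow> b p p' = (if p = p' then 1 else 0)"
proof -
  define col where "col j = mat_act X (unit_fun j)" for j
  obtain G where G: "G \<subseteq> col ` {..<n}" "fs.independent G" "col ` {..<n} \<subseteq> fs.span G"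
    using fs.maximal_independent_subset by blast
  define J where "J = inv_into {..<n} col ` G"
  have J: "J \<subseteq> {..<n}" unfolding J_def using G(1) by (meson image_subsetI inv_into_into subsetD)
  have colJ: "col ` J = G" unfolding J_def image_image using G(1)
    by (force simp: f_inv_into_f)
  have injJ: "inj_on col J"
  proof (rule inj_onI)
    fix i j assume "i \<in> J" "j \<in> J" "col i = col j"
    then show "i = j" unfolding J_def using G(1) by (auto simp: f_inv_into_f subset_iff)
  qed
  have finJ: "finite J" using J finite_subset by blast
  define P where "P = {..<n} - J"
  have "\<exists>c. col p = (\<Sum>j\<in>J. scale_fun (c j) (col j))" if p: "p \<in> P" for p
  proof -
    have "col p \<in> fs.span ({} \<union> col ` J)" using G(3) p colJ unfolding P_def by auto
    then show ?thesis using span_union_image[OF finJ, of "col p" "{}" col] by auto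
  qed
  then obtain c where c: "\<And>p. p \<in> P \<Longrightarrow> col p = (\<Sum>j\<in>J. scale_fun (c p j) (col j))" by metis
  define b where "b p = unit_fun p - (\<Sum>j\<in>J. scale_fun (c p j) (unit_fun j))" for p
  show ?thesis
  proof (rule that)
    show "P \<subseteq> {..<n}" unfolding P_def by blast
    have "G \<subseteq> mat_act X ` Kn n" using G(1) unit_fun_in_Kn unfolding col_def by blast
    then have "card G \<le> vec_space.rank n X" using rank_ge_card[OF X G(2)] by blast
    moreover have "card G = card J" using card_image[OF injJ] colJ by simp
    moreover have "card P = n - card J" unfolding P_def using J finJ by (simp add: card_Diff_subset)
    ultimately show "n \<le> vec_space.rank n X + card P" by simp
    fix p assume p: "p \<in> P"
    show "b p \<in> Kn n"
      unfolding b_def using p J subspace_Kn unit_fun_in_Kn unfolding P_def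
      by (intro fs.subspace_diff fs.subspace_sum fs.subspace_scale) auto
    show "mat_act X (b p) = 0"
      unfolding b_def fs.linear_diff[OF linear_mat_act] fs.linear_sum[OF linear_mat_act]
        fs.linear_scale[OF linear_mat_act] col_def[symmetric]
      using c[OF p] by simp
    fix p' assume p': "p' \<in> P"
    have "(\<Sum>j\<in>J. scale_fun (c p j) (unit_fun j)) p' = 0"
      unfolding sum_fun_apply scale_fun_apply unit_fun_def
      using p' unfolding P_def by (intro sum.neutral) auto
    then show "b p p' = (if p = p' then 1 else 0)"
      unfolding b_def by (simp add: unit_fun_def)
  qed
qed

locale action_on =
  fixes n :: nat and act :: "'g::group_add \<Rightarrow> nat \<Rightarrow> nat"
  assumes act_less: "i < n \<Longrightarrow> act g i < n"
    and act_zero: "i < n \<Longrightarrow> act 0 i = i"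
    and act_add: "i < n \<Longrightarrow> act (g + h) i = act g (act h i)"
begin

lemma act_minus [simp]: "i < n \<Longrightarrow> act (- g) (act g i) = i" "i < n \<Longrightarrow> act g (act (- g) i) = i"
  using act_add[of i "- g" g] act_add[of i g "- g"] act_zero by simp_all

lemma act_minus_add: "i < n \<Longrightarrow> act (- (g + h)) i = act (- h) (act (- g) i)"
  unfolding minus_add by (rule act_add)

text \<open>
  The linear extension of $g v = v \<circ> g^{-1}$.
\<close>

definition perm_map :: "('g \<Rightarrow>\<^sub>0 'k::field) \<Rightarrow> (nat \<Rightarrow> 'k) \<Rightarrow> nat \<Rightarrow> 'k" where
  "perm_map x v = (\<lambda>i. if i < n
     then \<Sum>g\<in>Poly_Mapping.keys x. Poly_Mapping.lookup x g * v (act (- g) i) else 0)"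

definition perm_rep :: "('g \<Rightarrow>\<^sub>0 'k::field) \<Rightarrow> 'k mat" where
  "perm_rep x = mat_of n (perm_map x)"

lemma perm_map_superset:
  assumes "finite K" "Poly_Mapping.keys x \<subseteq> K" "i < n"
  shows "perm_map x v i = (\<Sum>g\<in>K. Poly_Mapping.lookup x g * v (act (- g) i))"
  unfolding perm_map_def using assms
  by (simp, intro sum.mono_neutral_left) (auto simp: in_keys_iff)

lemma perm_map_in_Kn: "perm_map x v \<in> Kn n"
  unfolding perm_map_def Kn_def by simp

lemma linear_perm_map: "linear_fun (perm_map x)"
  unfolding Vector_Spaces.linear_iff
  by (intro conjI allI vector_space_scale_fun ext)
     (simp_all add: perm_map_def scale_fun_apply distrib_left sum.distrib sum_distrib_left mult_ac)

lemma perm_map_add: "perm_map (x + y) v = perm_map x v + perm_map y v"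
proof
  fix i
  let ?K = "Poly_Mapping.keys x \<union> Poly_Mapping.keys y"
  show "perm_map (x + y) v i = (perm_map x v + perm_map y v) i"
  proof (cases "i < n")
    case True
    have "perm_map (x + y) v i = (\<Sum>g\<in>?K. Poly_Mapping.lookup (x + y) g * v (act (- g) i))"
      using True keys_add[of x y] by (intro perm_map_superset) auto
    also have "\<dots> = perm_map x v i + perm_map y v i"
      using True perm_map_superset[of ?K x i v] perm_map_superset[of ?K y i v]
      by (simp add: lookup_add distrib_right sum.distrib)
    finally show ?thesis by simp
  qed (simp add: perm_map_def)
qed

lemma perm_map_single:
  "perm_map (Poly_Mapping.single g a) v i = (if i < n then a * v (act (- g) i) else 0)"
proof (cases "i < n")
  case True
  then show ?thesis using perm_map_superset[of "{g}" "Poly_Mapping.single g a" i v]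
    by (simp add: lookup_single)
qed (simp add: perm_map_def)

lemma perm_map_mult: "perm_map (x * y) v = perm_map x (perm_map y v)"
proof (induction x rule: group_algebra_induct)
  case zero
  show ?case by (auto simp: perm_map_def)
next
  case (add_single x g a)
  have single: "perm_map (Poly_Mapping.single g a * y) v = perm_map (Poly_Mapping.single g a) (perm_map y v)"
  proof (induction y rule: group_algebra_induct)
    case zero
    show ?case by (auto simp: perm_map_def)
  next
    case (add_single y h b)
    have "perm_map (Poly_Mapping.single g a * Poly_Mapping.single h b) v =
        perm_map (Poly_Mapping.single g a) (perm_map (Poly_Mapping.single h b) v)"
      unfolding mult_single
      by (rule ext) (simp add: perm_map_single act_minus_add act_less mult_ac)
    then show ?case using add_single
      by (simp only: distrib_left perm_map_add fs.linear_add[OF linear_perm_map])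
  qed
  show ?case by (simp only: distrib_right perm_map_add add_single single)
qed

lemma mat_act_perm_rep: "v \<in> Kn n \<Longrightarrow> mat_act (perm_rep x) v = perm_map x v"
  unfolding perm_rep_def using perm_map_in_Kn by (intro mat_act_mat_of linear_perm_map) auto

lemma perm_map_scale: "perm_map (scale_ga c x) v = scale_fun c (perm_map x v)"
proof -
  have "perm_map (Poly_Mapping.single 0 c) w = scale_fun c w" if "w \<in> Kn n" for w
    using that by (auto simp: fun_eq_iff perm_map_single scale_fun_apply act_zero Kn_def)
  then show ?thesis unfolding scale_ga_eq_single_times perm_map_mult using perm_map_in_Kn by blast
qed

text \<open>
  Let $P$ be a set of pivots for the kernel of $a$. Around a point $i$ look at the pivots in
  $F_1 i$ with $F_1 = -E + F_0$ and pull the corresponding kernel vectors back along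
  $f \<mapsto> f i$ to elements $y_f$ of the group algebra supported on $F_1$. They are independent,
  and since $a$ annihilates the original vectors, $a y_f$ is supported on the boundary
  $D = (E + F_1) - F_0$. Multiplication with $a$ is injective as there are no zero divisors, so at most
  $|D|$ pivots lie in $F_1 i$. Averaging over all $i$ shows that the density of pivots is at most
  $|D| / |F_1| \<le> \<delta>$.
\<close>

lemma perm_rep_rank:
  fixes a :: "'g \<Rightarrow>\<^sub>0 'k::field"
  assumes domain: "\<And>x y :: 'g \<Rightarrow>\<^sub>0 'k. x * y = 0 \<Longrightarrow> x = 0 \<or> y = 0"
    and a: "a \<noteq> 0" "Poly_Mapping.keys a \<subseteq> E" and E: "finite E" "0 \<in> E"
    and F0: "finite F0" "F0 \<noteq> {}" "real (card (sumset (sumset E (uminus ` E)) F0)) \<le> (1 + \<delta>) * real (card F0)"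
    and X0: "X0 \<subseteq> {..<n}" "\<And>g i. i \<in> X0 \<Longrightarrow> act g i \<in> X0"
    and free: "\<And>i. i \<in> X0 \<Longrightarrow> inj_on (\<lambda>f. act f i) (sumset (uminus ` E) F0)"
    and \<delta>: "\<delta> \<ge> 0"
  shows "real n \<le> real (vec_space.rank n (perm_rep a)) + \<delta> * real n + real (n - card X0)"
proof -
  define F1 where "F1 = sumset (uminus ` E) F0"
  define D where "D = sumset E F1 - F0"
  have finF1: "finite F1" unfolding F1_def using E(1) F0(1) by simp
  have finD: "finite D" unfolding D_def using E(1) finF1 by simp
  have "0 \<in> uminus ` E" using E(2) by force
  then have F01: "F0 \<subseteq> F1" unfolding F1_def by (rule subset_sumset)
  have F02: "F0 \<subseteq> sumset E F1" using F01 subset_sumset[OF E(2), of F1] by blast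
  have "card D = card (sumset E F1) - card F0" unfolding D_def using F0(1) F02 by (rule card_Diff_subset)
  then have cardD: "real (card D) \<le> \<delta> * real (card F0)"
    using F0(3) card_mono[OF finite_sumset[OF E(1) finF1] F02] unfolding F1_def sumset_assoc
    by (simp add: algebra_simps of_nat_diff)
  have shift: "- e + h \<in> F1" if "e \<in> E" "h \<in> F0" for e h
    unfolding F1_def using that by (intro in_sumset) auto
  have X: "perm_rep a \<in> carrier_mat n n" unfolding perm_rep_def by simp
  obtain P b where P: "P \<subseteq> {..<n}" "n \<le> vec_space.rank n (perm_rep a) + card P"
    and b: "\<And>p. p \<in> P \<Longrightarrow> b p \<in> Kn n" "\<And>p. p \<in> P \<Longrightarrow> mat_act (perm_rep a) (b p) = 0"
    and dual: "\<And>p p'. p \<in> P \<Longrightarrow> p' \<in> P \<Longrightarrow> b p p' = (if p = p' then 1 else 0)"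
    by (rule kernel_coordinates[OF X]) blast
  have ker: "perm_map a (b p) = 0" if "p \<in> P" for p
    using b(2)[OF that] mat_act_perm_rep[OF b(1)[OF that]] by simp
  define hit where "hit i = {f \<in> F1. act f i \<in> P}" for i
  have finhit: "finite (hit i)" for i unfolding hit_def using finF1 by simp
  have small: "card (hit i) \<le> card D" if i: "i \<in> X0" for i
  proof -
    have inj: "inj_on (\<lambda>f. act f i) F1" using free[OF i] unfolding F1_def .
    have less: "i < n" using i X0(1) by blast
    define y where "y f = (\<Sum>f'\<in>F1. scale_ga (b (act f i) (act f' i)) (grp f'))" for f
    have look: "Poly_Mapping.lookup (y f) h = (if h \<in> F1 then b (act f i) (act h i) else 0)" for f h
      unfolding y_def by (rule lookup_combination[OF finF1])
    have supp: "a * y f \<in> group_algebra.span (grp ` D)" if f: "f \<in> hit i" for f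
    proof -
      have "Poly_Mapping.keys (y f) \<subseteq> F1" by (auto simp: in_keys_iff look split: if_splits)
      then have "Poly_Mapping.keys (a * y f) \<subseteq> sumset E F1" using a(2) by (intro keys_mult_sumset)
      moreover have "Poly_Mapping.lookup (a * y f) h = 0" if h: "h \<in> F0" for h
      proof -
        have "Poly_Mapping.lookup (a * y f) h
            = (\<Sum>e\<in>E. Poly_Mapping.lookup a e * Poly_Mapping.lookup (y f) (- e + h))"
          by (rule lookup_mult_left_sum[OF E(1) a(2)])
        also have "\<dots> = (\<Sum>e\<in>E. Poly_Mapping.lookup a e * b (act f i) (act (- e) (act h i)))"
          using shift[OF _ h] by (intro sum.cong refl) (simp add: look act_add[OF less])
        also have "\<dots> = perm_map a (b (act f i)) (act h i)"
          using perm_map_superset[OF E(1) a(2) act_less[OF less]] by simp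
        also have "\<dots> = 0" using ker f unfolding hit_def by simp
        finally show ?thesis .
      qed
      ultimately have sub: "Poly_Mapping.keys (a * y f) \<subseteq> D" unfolding D_def by (auto simp: in_keys_iff)
      show ?thesis
        by (subst group_algebra_expand[OF finD sub])
           (intro group_algebra.span_sum group_algebra.span_scale group_algebra.span_base, blast)
    qed
    have fam: "\<forall>f\<in>hit i. c f = 0" if zero: "(\<Sum>f\<in>hit i. scale_ga (c f) (a * y f)) = 0" for c
    proof
      fix f assume f: "f \<in> hit i"
      have "a * (\<Sum>f\<in>hit i. scale_ga (c f) (y f)) = 0"
        using zero by (simp add: sum_distrib_left group_algebra.scale_mult_right)
      then have "(\<Sum>f\<in>hit i. scale_ga (c f) (y f)) = 0" using domain a(1) by blast
      then have "0 = Poly_Mapping.lookup (\<Sum>f\<in>hit i. scale_ga (c f) (y f)) f" by simp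
      also have "\<dots> = (\<Sum>f'\<in>hit i. c f' * b (act f' i) (act f i))"
        using f unfolding lookup_sum lookup_scale_ga look hit_def by simp
      also have "\<dots> = (\<Sum>f'\<in>hit i. if f' = f then c f' else 0)"
      proof (intro sum.cong refl)
        fix f' assume f': "f' \<in> hit i"
        have "act f' i = act f i \<longleftrightarrow> f' = f" using inj f f' unfolding hit_def inj_on_def by blast
        then show "c f' * b (act f' i) (act f i) = (if f' = f then c f' else 0)"
          using dual[of "act f' i" "act f i"] f f' unfolding hit_def by simp
      qed
      also have "\<dots> = c f" using f finhit by simp
      finally show "c f = 0" ..
    qed
    note indep = group_algebra.independent_family[of "hit i" "\<lambda>f. a * y f", OF finhit fam]
    have "(\<lambda>f. a * y f) ` hit i \<subseteq> group_algebra.span (grp ` D)" using supp by blast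
    then have "card ((\<lambda>f. a * y f) ` hit i) \<le> card (grp ` D :: ('g \<Rightarrow>\<^sub>0 'k) set)"
      using group_algebra.independent_span_bound[OF _ indep(2)] finD by blast
    also have "\<dots> \<le> card D" using finD by (rule card_image_le)
    finally show ?thesis using card_image[OF indep(1)] by simp
  qed
  have finX0: "finite X0" using X0(1) finite_subset by blast
  have cardsum: "card {i \<in> A. R i} = (\<Sum>i\<in>A. if R i then 1 else 0)" if "finite A" for A and R :: "'x \<Rightarrow> bool"
    using sum.inter_filter[OF that, of "\<lambda>_. 1 :: nat" R] by simp
  \<comment> \<open>double counting of the pairs (f, i) for which f moves i to a pivot\<close>
  have "card F1 * card (P \<inter> X0) = (\<Sum>f\<in>F1. card {i \<in> X0. act f i \<in> P})"
  proof -
    have "card {i \<in> X0. act f i \<in> P} = card (P \<inter> X0)" for f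
    proof (rule bij_betw_same_card[of "act f"])
      show "bij_betw (act f) {i \<in> X0. act f i \<in> P} (P \<inter> X0)"
      proof (rule bij_betw_byWitness[where f' = "act (- f)"])
        show "\<forall>i\<in>{i \<in> X0. act f i \<in> P}. act (- f) (act f i) = i" using X0(1) by auto
        show "\<forall>i\<in>P \<inter> X0. act f (act (- f) i) = i" using X0(1) by auto
        show "act f ` {i \<in> X0. act f i \<in> P} \<subseteq> P \<inter> X0" using X0(2) by auto
        show "act (- f) ` (P \<inter> X0) \<subseteq> {i \<in> X0. act f i \<in> P}" using X0 by auto
      qed
    qed
    then show ?thesis by simp
  qed
  also have "\<dots> = (\<Sum>f\<in>F1. \<Sum>i\<in>X0. if act f i \<in> P then 1 else 0)"
    unfolding cardsum[OF finX0] ..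
  also have "\<dots> = (\<Sum>i\<in>X0. \<Sum>f\<in>F1. if act f i \<in> P then 1 else 0)" by (rule sum.swap)
  also have "\<dots> = (\<Sum>i\<in>X0. card (hit i))"
    unfolding hit_def cardsum[OF finF1] ..
  also have "\<dots> \<le> (\<Sum>i\<in>X0. card D)" by (intro sum_mono small)
  also have "\<dots> = card X0 * card D" by simp
  finally have "real (card F1) * real (card (P \<inter> X0)) \<le> real (card X0) * real (card D)"
    by (metis of_nat_le_iff of_nat_mult)
  also have "\<dots> \<le> real n * (\<delta> * real (card F1))"
  proof (intro mult_mono)
    show "real (card X0) \<le> real n" using card_mono[OF _ X0(1)] by simp
    have "card F0 \<le> card F1" using card_mono[OF finF1 F01] .
    then show "real (card D) \<le> \<delta> * real (card F1)"
      using cardD \<delta> by (meson mult_left_mono of_nat_le_iff order_trans)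
  qed auto
  finally have "real (card F1) * real (card (P \<inter> X0)) \<le> real (card F1) * (\<delta> * real n)"
    by (simp add: mult_ac)
  moreover have "real (card F1) > 0"
    using F01 F0(2) finF1 by (simp add: card_gt_0_iff) blast
  ultimately have PX: "real (card (P \<inter> X0)) \<le> \<delta> * real n" by simp
  have "P \<subseteq> (P \<inter> X0) \<union> ({..<n} - X0)" using P(1) by blast
  then have "card P \<le> card ((P \<inter> X0) \<union> ({..<n} - X0))" using finX0 by (intro card_mono) auto
  also have "\<dots> \<le> card (P \<inter> X0) + card ({..<n} - X0)" by (rule card_Un_le)
  finally have "card P \<le> card (P \<inter> X0) + card ({..<n} - X0)" .
  moreover have "card ({..<n} - X0) = n - card X0" using finX0 X0(1) by (simp add: card_Diff_subset)
  ultimately show ?thesis using P(2) PX by linarith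
qed

end

lemma normal_group_of_type:
  "N \<lhd> (group_of_type :: 'g::group_add monoid) \<longleftrightarrow>
    0 \<in> N \<and> (\<forall>x\<in>N. \<forall>y\<in>N. x + y \<in> N) \<and> (\<forall>x\<in>N. - x \<in> N) \<and> (\<forall>g. \<forall>x\<in>N. g + x + - g \<in> N)"
proof -
  interpret G: group "group_of_type :: 'g monoid" by (rule group_group_of_type)
  have inv: "inv\<^bsub>group_of_type\<^esub> x = - x" for x :: 'g
    by (rule G.inv_equality) (simp_all add: group_of_type_def)
  have "subgroup N group_of_type \<longleftrightarrow> 0 \<in> N \<and> (\<forall>x\<in>N. \<forall>y\<in>N. x + y \<in> N) \<and> (\<forall>x\<in>N. - x \<in> N)"
    unfolding subgroup_def inv by (auto simp: group_of_type_def)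
  then show ?thesis unfolding G.normal_inv_iff inv by (auto simp: group_of_type_def)
qed

lemma coset_eq_iff:
  assumes "N \<lhd> (group_of_type :: 'g::group_add monoid)"
  shows "(+) g ` N = (+) h ` N \<longleftrightarrow> - h + g \<in> N"
proof -
  have N: "0 \<in> N" "\<And>x y. x \<in> N \<Longrightarrow> y \<in> N \<Longrightarrow> x + y \<in> N" "\<And>x. x \<in> N \<Longrightarrow> - x \<in> N"
    using assms unfolding normal_group_of_type by auto
  have sub: "(+) g ` N \<subseteq> (+) h ` N" if "- h + g \<in> N" for g h
  proof clarify
    fix x assume "x \<in> N"
    then have "- h + g + x \<in> N" by (intro N(2) that)
    moreover have "g + x = h + (- h + g + x)" by (simp add: add.assoc)
    ultimately show "g + x \<in> (+) h ` N" by blast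
  qed
  show ?thesis
  proof
    assume "(+) g ` N = (+) h ` N"
    moreover have "g \<in> (+) g ` N" using image_eqI[of g "(+) g" 0 N] N(1) by simp
    ultimately obtain x where "x \<in> N" "g = h + x" by blast
    then show "- h + g \<in> N" by simp
  next
    assume *: "- h + g \<in> N"
    have "- (- h + g) \<in> N" by (rule N(3)[OF *])
    then have "- g + h \<in> N" by (simp add: minus_add)
    then show "(+) g ` N = (+) h ` N" using sub * by blast
  qed
qed

lemma finite_rcosets_iff:
  assumes N: "N \<lhd> (group_of_type :: 'g::group_add monoid)"
  shows "finite (rcosets\<^bsub>group_of_type\<^esub> N) \<longleftrightarrow> finite (range (\<lambda>g. (+) g ` N))"
proof -
  have "N #>\<^bsub>group_of_type\<^esub> g = g <#\<^bsub>group_of_type\<^esub> N" for g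
    using normal.coset_eq[OF N] by (simp add: group_of_type_def)
  also have "g <#\<^bsub>group_of_type\<^esub> N = (+) g ` N" for g
    unfolding l_coset_def by (auto simp: group_of_type_def)
  finally have "rcosets\<^bsub>group_of_type\<^esub> N = range (\<lambda>g. (+) g ` N)"
    unfolding RCOSETS_def by (auto simp: group_of_type_def)
  then show ?thesis by simp
qed

lemma finite_index_avoiding:
  assumes rf: "residually_finite (group_of_type :: 'g::group_add monoid)"
    and "finite D" "0 \<notin> (D :: 'g set)"
  shows "\<exists>N. N \<lhd> (group_of_type :: 'g monoid) \<and> finite (range (\<lambda>g. (+) g ` N)) \<and> D \<inter> N = {}"
  using assms(2,3)
proof (induction D rule: finite_induct)
  case empty
  have "range (\<lambda>g. (+) g ` (UNIV :: 'g set)) = {UNIV}" by (auto simp: surj_plus)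
  moreover have "UNIV \<lhd> (group_of_type :: 'g monoid)" unfolding normal_group_of_type by simp
  ultimately show ?case by (intro exI[of _ UNIV]) simp
next
  case (insert d D)
  then obtain M where M: "M \<lhd> (group_of_type :: 'g monoid)" "finite (range (\<lambda>g. (+) g ` M))" "D \<inter> M = {}"
    by auto
  have "d \<noteq> 0" using insert.prems by auto
  then obtain N where N: "N \<lhd> (group_of_type :: 'g monoid)" "finite (rcosets\<^bsub>group_of_type\<^esub> N)" "d \<notin> N"
    using rf unfolding residually_finite_def by (auto simp: group_of_type_def)
  have finN: "finite (range (\<lambda>g. (+) g ` N))" using N(2) finite_rcosets_iff[OF N(1)] by blast
  have MN: "M \<inter> N \<lhd> (group_of_type :: 'g monoid)"
    using M(1) N(1) unfolding normal_group_of_type by blast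
  have "(+) g ` (M \<inter> N) = ((+) g ` M) \<inter> ((+) g ` N)" for g :: 'g by (rule image_Int) simp
  then have "range (\<lambda>g. (+) g ` (M \<inter> N)) \<subseteq> (\<lambda>(A, B). A \<inter> B) ` (range (\<lambda>g. (+) g ` M) \<times> range (\<lambda>g. (+) g ` N))"
    by auto
  then have "finite (range (\<lambda>g. (+) g ` (M \<inter> N)))"
    using M(2) finN by (meson finite_SigmaI finite_imageI finite_subset)
  then show ?case using MN M(3) N(3) by (intro exI[of _ "M \<inter> N"]) auto
qed

text \<open>
  The action on the cosets of a normal subgroup of finite index that contains none of the differences
  of elements of $F$. The bound on $q$ settles the trivial group, for which dimensions cannot be
  forced to be large.
\<close>

lemma residually_finite_action:
  assumes rf: "residually_finite (group_of_type :: 'g::group_add monoid)" and F: "finite (F :: 'g set)"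
  obtains q act where "q > 0" "action_on q (act :: 'g \<Rightarrow> nat \<Rightarrow> nat)"
    "\<And>i. i < q \<Longrightarrow> inj_on (\<lambda>f. act f i) F" "finite (UNIV :: 'g set) \<Longrightarrow> q \<le> card (UNIV :: 'g set)"
proof -
  define D where "D = (\<lambda>(f, f'). - f' + f) ` (F \<times> F) - {0}"
  have "finite D" "0 \<notin> D" unfolding D_def using F by auto
  then obtain N where N: "N \<lhd> (group_of_type :: 'g monoid)" and fin: "finite (range (\<lambda>g. (+) g ` N))"
    and DN: "D \<inter> N = {}" using finite_index_avoiding[OF rf] by blast
  define Q where "Q = range (\<lambda>g. (+) g ` N)"
  define q where "q = card Q"
  obtain e where e: "bij_betw e {..<q} Q"
    using ex_bij_betw_nat_finite[OF fin] unfolding q_def Q_def atLeast0LessThan by blast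
  define e' where "e' = the_inv_into {..<q} e"
  have e'e: "e' (e i) = i" if "i < q" for i
    unfolding e'_def using e that by (intro the_inv_into_f_f) (auto simp: bij_betw_def)
  have ee': "e (e' A) = A" if "A \<in> Q" for A
    unfolding e'_def using e that by (intro f_the_inv_into_f) (auto simp: bij_betw_def)
  have e'q: "e' A < q" if "A \<in> Q" for A
    using bij_betw_the_inv_into[OF e] that unfolding e'_def bij_betw_def by auto
  have eQ: "e i \<in> Q" if "i < q" for i using e that by (auto simp: bij_betw_def)
  have shift: "(+) g ` A \<in> Q" if A: "A \<in> Q" for g A
  proof -
    obtain h where "A = (+) h ` N" using A unfolding Q_def by blast
    then have "(+) g ` A = (+) (g + h) ` N" by (simp add: image_image add.assoc)
    then show ?thesis unfolding Q_def by blast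
  qed
  define act where "act g i = e' ((+) g ` e i)" for g i
  have "action_on q act"
  proof
    fix i g h assume i: "i < q"
    show "act g i < q" unfolding act_def using e'q shift eQ[OF i] by blast
    show "act 0 i = i" unfolding act_def using e'e[OF i] by simp
    show "act (g + h) i = act g (act h i)"
      unfolding act_def using ee' shift eQ[OF i] by (simp add: image_image add.assoc)
  qed
  moreover have "inj_on (\<lambda>f. act f i) F" if i: "i < q" for i
  proof (rule inj_onI)
    fix f f' assume f: "f \<in> F" "f' \<in> F" "act f i = act f' i"
    obtain h where h: "e i = (+) h ` N" using eQ[OF i] unfolding Q_def by blast
    have "(+) f ` e i = (+) f' ` e i"
      using f(3) ee'[OF shift[OF eQ[OF i]]] unfolding act_def by metis
    then have "(+) (f + h) ` N = (+) (f' + h) ` N" unfolding h by (simp add: image_image add.assoc)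
    then have "- (f' + h) + (f + h) \<in> N" unfolding coset_eq_iff[OF N] .
    then have "h + (- (f' + h) + (f + h)) + - h \<in> N" using N unfolding normal_group_of_type by blast
    moreover have "h + (- (f' + h) + (f + h)) + - h = - f' + f"
      unfolding minus_add by (simp add: add.assoc flip: add_uminus_conv_diff)
    ultimately have "- f' + f \<in> N" by simp
    then have "- f' + f = 0" using DN f(1,2) unfolding D_def by auto
    then show "f = f'" by (metis add.right_neutral add_minus_cancel)
  qed
  moreover have "q > 0" unfolding q_def using fin by (simp add: card_gt_0_iff Q_def)
  moreover have "q \<le> card (UNIV :: 'g set)" if "finite (UNIV :: 'g set)"
    unfolding q_def Q_def using that by (rule card_image_le)
  ultimately show ?thesis using that by blast
qed

text \<open>
  An arbitrary number $m$ of points is filled with disjoint copies of the given action; the remaining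
  $m$ mod $n$ points are fixed.
\<close>

lemma (in action_on) action_on_copies:
  assumes q: "n > 0" and free: "\<And>i. i < n \<Longrightarrow> inj_on (\<lambda>f. act f i) F"
  obtains act' where "action_on m act'" "{..<n * (m div n)} \<subseteq> {..<m}"
    "\<And>g i. i < n * (m div n) \<Longrightarrow> act' g i < n * (m div n)"
    "\<And>i. i < n * (m div n) \<Longrightarrow> inj_on (\<lambda>f. act' f i) F"
proof -
  define M where "M = n * (m div n)"
  have M: "M \<le> m" unfolding M_def by simp
  define act' where "act' g i = (if i < M then n * (i div n) + act g (i mod n) else i)" for g i
  have modn: "i mod n < n" for i using q by simp
  have stay: "act' g i < M" if "i < M" for g i
  proof -
    have "i div n < m div n" using that unfolding M_def by (simp add: less_mult_imp_div_less mult.commute)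
    then have "n * (i div n) + n \<le> M"
      unfolding M_def using mult_le_mono2[of "Suc (i div n)" "m div n" n] by simp
    then show ?thesis unfolding act'_def using that act_less[OF modn[of i], of g] by simp
  qed
  have parts: "act' g i div n = i div n" "act' g i mod n = act g (i mod n)" if "i < M" for g i
    unfolding act'_def using that act_less[OF modn[of i], of g] by simp_all
  have "action_on m act'"
  proof
    fix i g h assume i: "i < m"
    show "act' g i < m" using stay[of i g] M i by (cases "i < M") (auto simp: act'_def)
    show "act' 0 i = i" unfolding act'_def using act_zero[OF modn] by simp
    show "act' (g + h) i = act' g (act' h i)"
    proof (cases "i < M")
      case True
      then show ?thesis using stay[OF True, of h] parts[OF True, of h]
        by (subst (1 2) act'_def) (simp add: act_add[OF modn])
    qed (simp add: act'_def)
  qed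
  moreover have "inj_on (\<lambda>f. act' f i) F" if "i < M" for i
  proof (rule inj_onI)
    fix f f' assume "f \<in> F" "f' \<in> F" "act' f i = act' f' i"
    then show "f = f'" using free[OF modn[of i]] parts(2)[OF that] by (metis inj_onD)
  qed
  ultimately show ?thesis using that stay M unfolding M_def by auto
qed


section \<open>Comparing an approximation with a representation\<close>

lemma rank_plus_kernel_le:
  assumes X: "X \<in> carrier_mat n n" and W: "fs.independent W" "W \<subseteq> Kn n"
    and kill: "\<And>w. w \<in> W \<Longrightarrow> mat_act X w = 0"
  shows "vec_space.rank n X + card W \<le> n"
proof -
  obtain C where C: "C \<subseteq> Kn n" "finite C" "fs.span (W \<union> C) = Kn n" "card W + card C = n"
    using extend_to_basis_Kn[OF W] by metis
  have "mat_act X v \<in> fs.span (mat_act X ` C)" if v: "v \<in> Kn n" for v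
  proof -
    have "mat_act X ` (W \<union> C) \<subseteq> insert 0 (mat_act X ` C)" using kill by auto
    then have "fs.span (mat_act X ` (W \<union> C)) \<subseteq> fs.span (mat_act X ` C)"
      by (metis fs.span_insert_0 fs.span_mono)
    then show ?thesis using v C(3) fs.linear_span_image[OF linear_mat_act] by blast
  qed
  then have "vec_space.rank n X \<le> card (mat_act X ` C)" using C(2) by (intro rank_le_card[OF X]) auto
  also have "\<dots> \<le> card C" using C(2) by (rule card_image_le)
  finally show ?thesis using C(4) by linarith
qed

text \<open>Both families are extended to bases, which are then matched.\<close>

lemma conjugating_maps:
  fixes f1 f2 :: "'i \<Rightarrow> nat \<Rightarrow> 'k::field"
  assumes f1: "inj_on f1 I" "fs.independent (f1 ` I)" "f1 ` I \<subseteq> Kn n"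
    and f2: "inj_on f2 I" "fs.independent (f2 ` I)" "f2 ` I \<subseteq> Kn n"
  obtains P Q where "linear_fun P" "linear_fun Q" "P ` Kn n \<subseteq> Kn n" "Q ` Kn n \<subseteq> Kn n"
    "\<And>v. v \<in> Kn n \<Longrightarrow> P (Q v) = v" "\<And>i. i \<in> I \<Longrightarrow> P (f1 i) = f2 i" "\<And>i. i \<in> I \<Longrightarrow> Q (f2 i) = f1 i"
proof -
  obtain C1 where C1: "finite C1" "f1 ` I \<inter> C1 = {}" "fs.independent (f1 ` I \<union> C1)"
    "fs.span (f1 ` I \<union> C1) = Kn n" "card (f1 ` I) + card C1 = n"
    using extend_to_basis_Kn[OF f1(2,3)] by metis
  obtain C2 where C2: "finite C2" "f2 ` I \<inter> C2 = {}" "fs.independent (f2 ` I \<union> C2)"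
    "fs.span (f2 ` I \<union> C2) = Kn n" "card (f2 ` I) + card C2 = n"
    using extend_to_basis_Kn[OF f2(2,3)] by metis
  have "card C1 = card C2" using C1(5) C2(5) card_image[OF f1(1)] card_image[OF f2(1)] by simp
  then obtain h where h: "bij_betw h C1 C2" using finite_same_card_bij[OF C1(1) C2(1)] by blast
  define \<beta> where "\<beta> v = (if v \<in> C1 then h v else f2 (the_inv_into I f1 v))" for v
  define \<gamma> where "\<gamma> v = (if v \<in> C2 then the_inv_into C1 h v else f1 (the_inv_into I f2 v))" for v
  have \<beta>1: "\<beta> (f1 i) = f2 i" if "i \<in> I" for i
    unfolding \<beta>_def using C1(2) that the_inv_into_f_f[OF f1(1) that] by auto
  have \<gamma>1: "\<gamma> (f2 i) = f1 i" if "i \<in> I" for i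
    unfolding \<gamma>_def using C2(2) that the_inv_into_f_f[OF f2(1) that] by auto
  have hinj: "inj_on h C1" "h ` C1 = C2" using h unfolding bij_betw_def by auto
  have \<beta>2: "\<beta> v = h v" "h v \<in> C2" if "v \<in> C1" for v unfolding \<beta>_def using that hinj by auto
  have \<gamma>2: "\<gamma> v \<in> C1" "h (\<gamma> v) = v" if "v \<in> C2" for v
    unfolding \<gamma>_def using that hinj the_inv_into_into[OF hinj(1), of v C1] f_the_inv_into_f[OF hinj(1)] by auto
  obtain P where P: "linear_fun P" "\<And>v. v \<in> f1 ` I \<union> C1 \<Longrightarrow> P v = \<beta> v"
    using fs.linear_independent_extend[OF C1(3)] by blast
  obtain Q where Q: "linear_fun Q" "\<And>v. v \<in> f2 ` I \<union> C2 \<Longrightarrow> Q v = \<gamma> v"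
    using fs.linear_independent_extend[OF C2(3)] by blast
  have PK: "P ` Kn n \<subseteq> Kn n"
  proof -
    have "P ` (f1 ` I \<union> C1) \<subseteq> f2 ` I \<union> C2" using P(2) \<beta>1 \<beta>2 by auto
    then have "fs.span (P ` (f1 ` I \<union> C1)) \<subseteq> Kn n" using fs.span_mono C2(4) by blast
    then show ?thesis using fs.linear_span_image[OF P(1)] C1(4) by metis
  qed
  have QK: "Q ` Kn n \<subseteq> Kn n"
  proof -
    have "Q ` (f2 ` I \<union> C2) \<subseteq> f1 ` I \<union> C1" using Q(2) \<gamma>1 \<gamma>2 by auto
    then have "fs.span (Q ` (f2 ` I \<union> C2)) \<subseteq> Kn n" using fs.span_mono C1(4) by blast
    then show ?thesis using fs.linear_span_image[OF Q(1)] C2(4) by metis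
  qed
  have lPQ: "linear_fun (\<lambda>v. P (Q v))"
    unfolding Vector_Spaces.linear_iff
    using vector_space_scale_fun fs.linear_add[OF P(1)] fs.linear_add[OF Q(1)]
      fs.linear_scale[OF P(1)] fs.linear_scale[OF Q(1)] by simp
  have PQ: "P (Q v) = v" if v: "v \<in> Kn n" for v
  proof -
    have "P (Q w) = w" if "w \<in> f2 ` I \<union> C2" for w
      using that Q(2)[OF that] P(2) \<gamma>1 \<gamma>2 \<beta>1 \<beta>2 by auto
    then show ?thesis
      using fs.linear_eq_on_span[of "\<lambda>v. P (Q v)" "\<lambda>v. v" "f2 ` I \<union> C2" v] lPQ fs.linear_ident v C2(4) by auto
  qed
  show ?thesis
  proof (rule that[OF P(1) Q(1) PK QK PQ])
    show "P (f1 i) = f2 i" if "i \<in> I" for i using P(2) \<beta>1 that by simp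
    show "Q (f2 i) = f1 i" if "i \<in> I" for i using Q(2) \<gamma>1 that by simp
  qed
qed

text \<open>
  A nontrivial combination of the matrices of the elements of $F$ is the matrix of a nonzero element
  of the group algebra supported on $F$, so the rank condition of \<open>exists_tiles\<close> becomes one on
  such elements.
\<close>

lemma exists_tiles_group_algebra:
  fixes \<phi> :: "('g::group_add \<Rightarrow>\<^sub>0 'k::field) \<Rightarrow> 'k mat"
  assumes \<phi>: "group_algebra.linear_to_mat n \<phi>" and F: "finite F" "F \<noteq> {}"
    and rank: "\<And>a. a \<noteq> 0 \<Longrightarrow> Poly_Mapping.keys a \<subseteq> F \<Longrightarrow> n \<le> vec_space.rank n (\<phi> a) + \<kappa>'"
    and U: "fs.subspace U" "U \<subseteq> Kn n" and C: "finite C" "card C \<le> \<kappa>" "fs.span (U \<union> C) = Kn n"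
  obtains k u where "tiles F (\<lambda>f. mat_act (\<phi> (grp f))) k u" "\<And>i. i < k \<Longrightarrow> u i \<in> U"
    "n \<le> k * card F + card F * (card F - 1) + \<kappa> + \<kappa>'"
proof (rule exists_tiles[OF F _ _ U C])
  fix k u
  assume "tiles F (\<lambda>f. mat_act (\<phi> (grp f))) k u" "\<And>i. i < k \<Longrightarrow> u i \<in> U"
    "n \<le> k * card F + card F * (card F - 1) + \<kappa> + \<kappa>'"
  then show thesis by (rule that)
next
  have car: "\<phi> x \<in> carrier_mat n n" for x using \<phi> unfolding group_algebra.linear_to_mat_def by blast
  show "linear_fun (mat_act (\<phi> (grp f)))" for f by (rule linear_mat_act)
  show "mat_act (\<phi> (grp f)) v \<in> Kn n" for f v by (rule mat_act_in_Kn[OF car])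
  fix c :: "'g \<Rightarrow> 'k" and G :: "(nat \<Rightarrow> 'k) set"
  assume c: "\<exists>f\<in>F. c f \<noteq> 0" and G: "finite G"
    and span: "\<And>v. v \<in> Kn n \<Longrightarrow> combine F (\<lambda>f. mat_act (\<phi> (grp f))) c v \<in> fs.span G"
  define a :: "'g \<Rightarrow>\<^sub>0 'k" where "a = (\<Sum>f\<in>F. scale_ga (c f) (grp f))"
  have look: "Poly_Mapping.lookup a h = (if h \<in> F then c h else 0)" for h
    unfolding a_def by (rule lookup_combination[OF F(1)])
  have "a \<noteq> 0" using c look by (metis lookup_zero)
  moreover have "Poly_Mapping.keys a \<subseteq> F" by (auto simp: in_keys_iff look split: if_splits)
  ultimately have "n \<le> vec_space.rank n (\<phi> a) + \<kappa>'" by (rule rank)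
  moreover have "vec_space.rank n (\<phi> a) \<le> card G"
    using span unfolding group_algebra.linear_to_mat_act(3)[OF \<phi>, symmetric] a_def[symmetric]
    by (intro rank_le_card[OF car G])
  ultimately show "n \<le> card G + \<kappa>'" by linarith
qed

lemma approximation_rank:
  assumes "group_algebra.approximation_of S d n \<phi>" "n \<ge> 1" "a \<in> group_algebra.A_upto S d" "a \<noteq> 0"
  shows "real n \<le> real (vec_space.rank n (\<phi> a)) + real n / real d"
proof -
  have "1 - 1 / real d \<le> real (vec_space.rank n (\<phi> a)) / real n"
    using assms unfolding group_algebra.approximation_of_def rk_def by blast
  then have "(1 - 1 / real d) * real n \<le> real (vec_space.rank n (\<phi> a))"
    using assms(2) by (simp add: pos_le_divide_eq)
  then show ?thesis by (simp add: left_diff_distrib)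
qed

lemma approximation_tiles:
  fixes \<phi> :: "('g::group_add \<Rightarrow>\<^sub>0 'k::field) \<Rightarrow> 'k mat"
  assumes approx: "group_algebra.approximation_of S d n \<phi>" and n: "n \<ge> 1"
    and F: "finite F" "F \<noteq> {}" "grp ` F \<subseteq> group_algebra.A_upto S d"
  obtains k u where "tiles F (\<lambda>f. mat_act (\<phi> (grp f))) k u"
    "\<And>i x y. i < k \<Longrightarrow> x \<in> group_algebra.A_upto S d \<Longrightarrow> y \<in> group_algebra.A_upto S d \<Longrightarrow>
       mat_act (\<phi> (x * y)) (u i) = mat_act (\<phi> x) (mat_act (\<phi> y) (u i))"
    "real n \<le> real (k * card F) + real (card F * (card F - 1)) + 2 * (real n / real d)"
proof -
  have \<phi>: "group_algebra.linear_to_mat n \<phi>" using approx unfolding group_algebra.approximation_of_def by blast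
  have car: "\<phi> x \<in> carrier_mat n n" for x using \<phi> unfolding group_algebra.linear_to_mat_def by blast
  obtain U where U: "subspace_of_Kn n U"
    and mult: "\<And>x y u. x \<in> group_algebra.A_upto S d \<Longrightarrow> y \<in> group_algebra.A_upto S d \<Longrightarrow> u \<in> U \<Longrightarrow>
       \<phi> (x * y) *\<^sub>v u = \<phi> x *\<^sub>v (\<phi> y *\<^sub>v u)"
    and dim: "real (subspace_dim n U) \<ge> (1 - 1 / real d) * real n"
    using approx unfolding group_algebra.approximation_of_def by blast
  have Uc: "U \<subseteq> carrier_vec n" using U unfolding subspace_def submodule_def by (auto simp: module_vec_simps)
  obtain C where C: "finite C" "subspace_dim n U + card C = n" "fs.span (of_vec ` U \<union> C) = Kn n"
    using subspace_complement[OF U] by metis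
  define \<kappa>' where "\<kappa>' = nat \<lfloor>real n / real d\<rfloor>"
  have \<kappa>': "real \<kappa>' \<le> real n / real d" unfolding \<kappa>'_def by simp
  have rank: "n \<le> vec_space.rank n (\<phi> a) + \<kappa>'" if a: "a \<noteq> 0" "Poly_Mapping.keys a \<subseteq> F" for a
  proof -
    have "a \<in> group_algebra.A_upto S d"
      by (subst group_algebra_expand[OF F(1) a(2)])
         (use F(3) in \<open>intro group_algebra.subspace_sum group_algebra.subspace_scale
           group_algebra.subspace_A_upto, blast\<close>)
    then have "real n \<le> real (vec_space.rank n (\<phi> a)) + real n / real d"
      using approximation_rank[OF approx n] a(1) by blast
    then have "int n - int (vec_space.rank n (\<phi> a)) \<le> \<lfloor>real n / real d\<rfloor>" by (simp add: le_floor_iff)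
    then show ?thesis unfolding \<kappa>'_def by linarith
  qed
  obtain k u where ku: "tiles F (\<lambda>f. mat_act (\<phi> (grp f))) k u" "\<And>i. i < k \<Longrightarrow> u i \<in> of_vec ` U"
    "n \<le> k * card F + card F * (card F - 1) + card C + \<kappa>'"
    using exists_tiles_group_algebra[OF \<phi> F(1,2) rank subspace_of_vec[OF U] C(1) order_refl C(3)] by blast
  show ?thesis
  proof (rule that[OF ku(1)])
    fix i x y assume i: "i < k" and xy: "x \<in> group_algebra.A_upto S d" "y \<in> group_algebra.A_upto S d"
    obtain w where w: "w \<in> U" "u i = of_vec w" using ku(2)[OF i] by blast
    have wc: "w \<in> carrier_vec n" using w(1) Uc by blast
    have "mat_act (\<phi> (x * y)) (u i) = of_vec (\<phi> x *\<^sub>v (\<phi> y *\<^sub>v w))"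
      unfolding w(2) of_vec_mult[OF car wc, symmetric] mult[OF xy w(1)] ..
    also have "\<dots> = mat_act (\<phi> x) (mat_act (\<phi> y) (u i))"
      unfolding w(2) of_vec_mult[OF car wc, symmetric]
      by (rule of_vec_mult[OF car mult_mat_vec_carrier[OF car wc]])
    finally show "mat_act (\<phi> (x * y)) (u i) = mat_act (\<phi> x) (mat_act (\<phi> y) (u i))" .
  next
    have "real (card C) \<le> real n / real d" using dim C(2) by (simp add: left_diff_distrib)
    moreover have "real n \<le> real (k * card F) + real (card F * (card F - 1)) + real (card C) + real \<kappa>'"
      using ku(3) by linarith
    ultimately show "real n \<le> real (k * card F) + real (card F * (card F - 1)) + 2 * (real n / real d)"
      using \<kappa>' by linarith
  qed
qed

lemma (in action_on) perm_rep_representation: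
  "group_algebra.algebra_representation n (perm_rep :: ('g \<Rightarrow>\<^sub>0 'k::field) \<Rightarrow> 'k mat)"
proof -
  have sc: "perm_rep (scale_ga c x) = c \<cdot>\<^sub>m perm_rep x" for c and x :: "'g \<Rightarrow>\<^sub>0 'k"
    unfolding perm_rep_def mat_of_def by (rule eq_matI) (auto simp: perm_map_scale scale_fun_apply)
  have add: "perm_rep (x + y) = perm_rep x + perm_rep y" for x y :: "'g \<Rightarrow>\<^sub>0 'k"
    unfolding perm_rep_def mat_of_def by (rule eq_matI) (auto simp: perm_map_add)
  have mult: "perm_rep (x * y) = perm_rep x * perm_rep y" for x y :: "'g \<Rightarrow>\<^sub>0 'k"
  proof -
    have "perm_rep (x * y) = mat_of n (\<lambda>v. perm_map x (perm_map y v))"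
      unfolding perm_rep_def by (rule mat_of_cong) (rule perm_map_mult)
    then show ?thesis unfolding perm_rep_def
      using mat_of_mult[OF linear_perm_map, of x n "perm_map y"] perm_map_in_Kn by auto
  qed
  show ?thesis
    unfolding group_algebra.algebra_representation_def group_algebra.linear_to_mat_def
    using sc add mult by (auto simp: perm_rep_def)
qed

lemma conjugate_representation:
  fixes \<rho> :: "('g::group_add \<Rightarrow>\<^sub>0 'k::field) \<Rightarrow> 'k mat"
  assumes \<rho>: "group_algebra.algebra_representation n \<rho>"
    and P: "linear_fun P" "P ` Kn n \<subseteq> Kn n" and Q: "linear_fun Q" "Q ` Kn n \<subseteq> Kn n"
    and PQ: "\<And>v. v \<in> Kn n \<Longrightarrow> P (Q v) = v"
  defines "\<psi> \<equiv> \<lambda>x. mat_of n (\<lambda>v. Q (mat_act (\<rho> x) (P v)))"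
  shows "group_algebra.algebra_representation n \<psi>"
    "v \<in> Kn n \<Longrightarrow> mat_act (\<psi> x) v = Q (mat_act (\<rho> x) (P v))"
proof -
  have lin: "group_algebra.linear_to_mat n \<rho>" and mult: "\<And>x y. \<rho> (x * y) = \<rho> x * \<rho> y"
    using \<rho> unfolding group_algebra.algebra_representation_def by auto
  have car: "\<rho> x \<in> carrier_mat n n" for x using lin unfolding group_algebra.linear_to_mat_def by blast
  define L where "L x v = Q (mat_act (\<rho> x) (P v))" for x v
  have linL: "linear_fun (L x)" for x
    unfolding L_def Vector_Spaces.linear_iff
    by (simp add: vector_space_scale_fun fs.linear_add[OF P(1)] fs.linear_add[OF Q(1)] mat_act_add
        fs.linear_scale[OF P(1)] fs.linear_scale[OF Q(1)] mat_act_scale)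
  have LK: "L x ` Kn n \<subseteq> Kn n" for x unfolding L_def using Q(2) mat_act_in_Kn[OF car] by blast
  have \<psi>: "\<psi> x = mat_of n (L x)" for x unfolding \<psi>_def L_def ..
  show "mat_act (\<psi> x) v = Q (mat_act (\<rho> x) (P v))" if "v \<in> Kn n"
    using mat_act_mat_of[OF linL LK that] unfolding \<psi> L_def .
  have "\<psi> (x * y) = \<psi> x * \<psi> y" for x y
  proof -
    have "mat_of n (L (x * y)) = mat_of n (\<lambda>v. L x (L y v))"
      unfolding L_def mult by (rule mat_of_cong) (simp add: mat_act_mult[OF car car] PQ mat_act_in_Kn[OF car])
    then show ?thesis unfolding \<psi> mat_of_mult[OF linL LK LK] .
  qed
  moreover have "\<psi> (x + y) = \<psi> x + \<psi> y" for x y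
    unfolding \<psi> mat_of_def L_def
    by (rule eq_matI) (auto simp: group_algebra.linear_to_mat_act(1)[OF lin] fs.linear_add[OF Q(1)])
  moreover have "\<psi> (scale_ga c x) = c \<cdot>\<^sub>m \<psi> x" for c x
    unfolding \<psi> mat_of_def L_def
    by (rule eq_matI) (auto simp: group_algebra.linear_to_mat_act(2)[OF lin] fs.linear_scale[OF Q(1)] scale_fun_apply)
  ultimately show "group_algebra.algebra_representation n \<psi>"
    unfolding group_algebra.algebra_representation_def group_algebra.linear_to_mat_def by (auto simp: \<psi>)
qed

text \<open>
  Two maps that have equally many tiles over $F$ are almost conjugate. Transport $\<rho>$ by a linear
  isomorphism that matches the tiles. As long as $f \<in> F_0$, multiplication with $s$ does not leave
  the tile, and there both maps are given by the multiplication of the group algebra; hence they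
  agree on the $k |F_0|$ independent vectors $\<phi>(f) u_i$.
\<close>

lemma matching_tiles_close:
  fixes \<phi> \<rho> :: "('g::group_add \<Rightarrow>\<^sub>0 'k::field) \<Rightarrow> 'k mat"
  assumes \<phi>: "group_algebra.linear_to_mat n \<phi>" and \<rho>: "group_algebra.algebra_representation n \<rho>"
    and tu: "tiles F (\<lambda>f. mat_act (\<phi> (grp f))) k u" and tv: "tiles F (\<lambda>f. mat_act (\<rho> (grp f))) k v"
    and T: "finite T" "\<And>s. s \<in> S \<Longrightarrow> Poly_Mapping.keys s \<subseteq> T"
    and F0: "F0 \<subseteq> F" "sumset T F0 \<subseteq> F" "finite F0"
    and mult: "\<And>i s f. i < k \<Longrightarrow> s \<in> S \<Longrightarrow> f \<in> F0 \<Longrightarrow>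
      mat_act (\<phi> (s * grp f)) (u i) = mat_act (\<phi> s) (mat_act (\<phi> (grp f)) (u i))"
  obtains \<psi> where "group_algebra.algebra_representation n \<psi>"
    "\<And>s. s \<in> S \<Longrightarrow> vec_space.rank n (\<phi> s - \<psi> s) + k * card F0 \<le> n"
proof -
  have lin: "group_algebra.linear_to_mat n \<rho>" and \<rho>mult: "\<And>x y. \<rho> (x * y) = \<rho> x * \<rho> y"
    using \<rho> unfolding group_algebra.algebra_representation_def by auto
  have car: "\<phi> x \<in> carrier_mat n n" "\<rho> x \<in> carrier_mat n n" for x
    using \<phi> lin unfolding group_algebra.linear_to_mat_def by auto
  define f1 where "f1 = (\<lambda>(f, i). mat_act (\<phi> (grp f)) (u i))"
  define f2 where "f2 = (\<lambda>(f, i). mat_act (\<rho> (grp f)) (v i))"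
  have f1: "inj_on f1 (F \<times> {..<k})" "fs.independent (f1 ` (F \<times> {..<k}))" "f1 ` (F \<times> {..<k}) \<subseteq> Kn n"
    using tu mat_act_in_Kn[OF car(1)] unfolding f1_def tiles_def by auto
  have f2: "inj_on f2 (F \<times> {..<k})" "fs.independent (f2 ` (F \<times> {..<k}))" "f2 ` (F \<times> {..<k}) \<subseteq> Kn n"
    using tv mat_act_in_Kn[OF car(2)] unfolding f2_def tiles_def by auto
  obtain P Q where PQ: "linear_fun P" "linear_fun Q" "P ` Kn n \<subseteq> Kn n" "Q ` Kn n \<subseteq> Kn n"
    "\<And>v. v \<in> Kn n \<Longrightarrow> P (Q v) = v" "\<And>p. p \<in> F \<times> {..<k} \<Longrightarrow> P (f1 p) = f2 p"
    "\<And>p. p \<in> F \<times> {..<k} \<Longrightarrow> Q (f2 p) = f1 p"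
    using conjugating_maps[OF f1 f2] by blast
  define \<psi> where "\<psi> x = mat_of n (\<lambda>v. Q (mat_act (\<rho> x) (P v)))" for x
  note rep = conjugate_representation[OF \<rho> PQ(1,3,2,4,5), folded \<psi>_def]
  have "vec_space.rank n (\<phi> s - \<psi> s) + k * card F0 \<le> n" if s: "s \<in> S" for s
  proof -
    define W where "W = f1 ` (F0 \<times> {..<k})"
    have sub: "F0 \<times> {..<k} \<subseteq> F \<times> {..<k}" using F0(1) by blast
    have \<psi>c: "\<psi> s \<in> carrier_mat n n" unfolding \<psi>_def by simp
    have "mat_act (\<phi> s - \<psi> s) w = 0" if w: "w \<in> W" for w
    proof -
      obtain f i where fi: "f \<in> F0" "i < k" "w = f1 (f, i)" using w unfolding W_def by auto
      have in_F: "t + f \<in> F" if "t \<in> T" for t using F0(2) in_sumset[OF that fi(1)] by blast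
      have "s * grp f = (\<Sum>t\<in>T. scale_ga (Poly_Mapping.lookup s t) (grp t)) * grp f"
        using group_algebra_expand[OF T(1) T(2)[OF s]] by simp
      then have prod: "s * grp f = (\<Sum>t\<in>T. scale_ga (Poly_Mapping.lookup s t) (grp (t + f)))"
        by (simp add: sum_distrib_right group_algebra.scale_mult_left mult_single)
      have "mat_act (\<phi> s) w = mat_act (\<phi> (s * grp f)) (u i)"
        unfolding fi(3) f1_def by (simp add: mult[OF fi(2) s fi(1)])
      also have "\<dots> = (\<Sum>t\<in>T. scale_fun (Poly_Mapping.lookup s t) (f1 (t + f, i)))"
        unfolding prod group_algebra.linear_to_mat_act(3)[OF \<phi>] combine_def f1_def by simp
      also have "\<dots> = Q (\<Sum>t\<in>T. scale_fun (Poly_Mapping.lookup s t) (f2 (t + f, i)))"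
        unfolding fs.linear_sum[OF PQ(2)] fs.linear_scale[OF PQ(2)]
        using PQ(7) in_F fi(2) by (intro sum.cong refl) simp
      also have "(\<Sum>t\<in>T. scale_fun (Poly_Mapping.lookup s t) (f2 (t + f, i))) = mat_act (\<rho> (s * grp f)) (v i)"
        unfolding prod group_algebra.linear_to_mat_act(3)[OF lin] combine_def f2_def by simp
      also have "\<dots> = mat_act (\<rho> s) (f2 (f, i))"
        unfolding \<rho>mult mat_act_mult[OF car(2) car(2)] f2_def by simp
      also have "f2 (f, i) = P w" using PQ(6)[of "(f, i)"] fi F0(1) by auto
      also have "Q (mat_act (\<rho> s) (P w)) = mat_act (\<psi> s) w"
        using rep(2) f1(3) w sub unfolding W_def by (metis image_mono subsetD)
      finally show ?thesis unfolding mat_act_minus[OF car(1) \<psi>c] by simp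
    qed
    moreover have "fs.independent W" "W \<subseteq> Kn n"
      using f1 sub unfolding W_def by (metis fs.independent_mono image_mono, meson image_mono subset_trans)
    ultimately have "vec_space.rank n (\<phi> s - \<psi> s) + card W \<le> n"
      using car \<psi>c by (intro rank_plus_kernel_le) auto
    moreover have "card W = k * card F0"
      unfolding W_def using card_image[OF inj_on_subset[OF f1(1) sub]]
      by (simp add: card_cartesian_product mult.commute)
    ultimately show ?thesis by simp
  qed
  then show ?thesis using that rep(1) by blast
qed

lemma tiles_fewer: "tiles F Y k u \<Longrightarrow> k' \<le> k \<Longrightarrow> tiles F Y k' u"
  unfolding tiles_def
proof safe
  assume "k' \<le> k" and inj: "inj_on (\<lambda>(f, i). Y f (u i)) (F \<times> {..<k})"
    and indep: "fs.independent ((\<lambda>(f, i). Y f (u i)) ` (F \<times> {..<k}))"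
  then have sub: "F \<times> {..<k'} \<subseteq> F \<times> {..<k}" by auto
  show "inj_on (\<lambda>(f, i). Y f (u i)) (F \<times> {..<k'})" using inj sub by (rule inj_on_subset)
  assume "fs.dependent ((\<lambda>(f, i). Y f (u i)) ` (F \<times> {..<k'}))"
  then show False using indep fs.dependent_mono[OF _ image_mono[OF sub]] by blast
qed

lemma torsion_free_finite_trivial:
  assumes tf: "torsion_free (group_of_type :: 'g::group_add monoid)" and fin: "finite (UNIV :: 'g set)"
  shows "card (UNIV :: 'g set) = 1"
proof -
  interpret G: group "group_of_type :: 'g monoid" by (rule group_group_of_type)
  have "x = 0" for x :: 'g
  proof -
    let ?pow = "\<lambda>k::nat. x [^]\<^bsub>group_of_type\<^esub> k"
    have carrier: "y \<in> carrier group_of_type" for y :: 'g by (simp add: group_of_type_def)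
    have "\<not> inj ?pow" using range_inj_infinite finite_subset[OF subset_UNIV fin] by metis
    then obtain k l where kl: "?pow k = ?pow l" "k < l"
      unfolding inj_def by (metis linorder_neq_iff)
    have "?pow l = ?pow k \<otimes>\<^bsub>group_of_type\<^esub> ?pow (l - k)"
      using G.nat_pow_mult[OF carrier, of x k "l - k"] kl(2) by simp
    then have "?pow (l - k) = \<one>\<^bsub>group_of_type\<^esub>"
      using kl(1) G.l_cancel_one'[OF carrier carrier] by metis
    then have "x = \<one>\<^bsub>group_of_type\<^esub>"
      using tf kl(2) carrier unfolding torsion_free_def by (metis zero_less_diff)
    then show ?thesis by (simp add: group_of_type_def)
  qed
  then have "(UNIV :: 'g set) = {0}" by auto
  then have "card (UNIV :: 'g set) = card {0 :: 'g}" by (rule arg_cong)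
  then show ?thesis by simp
qed

text \<open>
  If $n < d$, then a rank of at least $(1 - 1/d) n$ is full rank, so evaluation of
  $\<phi>$ at a fixed nonzero vector is injective on the span of $F$.
\<close>

lemma approximation_size:
  fixes \<phi> :: "('g::group_add \<Rightarrow>\<^sub>0 'k::field) \<Rightarrow> 'k mat"
  assumes approx: "group_algebra.approximation_of S d n \<phi>" and n: "n \<ge> 1"
    and F: "finite F" "grp ` F \<subseteq> group_algebra.A_upto S d" "card F \<le> d"
  shows "card F \<le> n"
proof (cases "d \<le> n")
  case False
  have \<phi>: "group_algebra.linear_to_mat n \<phi>" using approx unfolding group_algebra.approximation_of_def by blast
  have car: "\<phi> x \<in> carrier_mat n n" for x using \<phi> unfolding group_algebra.linear_to_mat_def by blast
  define w :: "nat \<Rightarrow> 'k" where "w = unit_fun 0"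
  have w: "w \<in> Kn n" "w \<noteq> 0"
    using n unit_fun_in_Kn[of 0 n] unfolding w_def by (auto simp: unit_fun_def fun_eq_iff)
  have "\<forall>f\<in>F. c f = 0" if zero: "(\<Sum>f\<in>F. scale_fun (c f) (mat_act (\<phi> (grp f)) w)) = 0" for c
  proof (rule ccontr)
    assume nonzero: "\<not> ?thesis"
    define a :: "'g \<Rightarrow>\<^sub>0 'k" where "a = (\<Sum>f\<in>F. scale_ga (c f) (grp f))"
    have "a \<noteq> 0" using nonzero lookup_combination[OF F(1), of c] unfolding a_def by (metis lookup_zero)
    moreover have "a \<in> group_algebra.A_upto S d"
      unfolding a_def using F(2)
      by (intro group_algebra.subspace_sum group_algebra.subspace_scale group_algebra.subspace_A_upto) blast
    ultimately have "real n \<le> real (vec_space.rank n (\<phi> a)) + real n / real d"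
      using approximation_rank[OF approx n] by blast
    moreover have "real n / real d < 1" using False by simp
    moreover have "vec_space.rank n (\<phi> a) + card {w} \<le> n"
    proof (rule rank_plus_kernel_le[OF car])
      show "fs.independent {w}" using w(2) by simp
      show "mat_act (\<phi> a) w' = 0" if "w' \<in> {w}" for w'
        using that zero unfolding a_def group_algebra.linear_to_mat_act(3)[OF \<phi>] combine_def by simp
    qed (use w in simp)
    ultimately show False by simp
  qed
  note indep = fs.independent_family[OF F(1) this]
  have "card ((\<lambda>f. mat_act (\<phi> (grp f)) w) ` F) \<le> n"
    by (intro card_le_Kn(2)[OF indep(2)]) (auto intro: mat_act_in_Kn[OF car])
  then show ?thesis using card_image[OF indep(1)] by simp
qed (use F(3) in simp)


section \<open>Residual finiteness implies weak stability\<close>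

text \<open>
  Take finite actions of the group that are free on a large finite set. By \<open>perm_rep_rank\<close> their
  permutation representations have almost full rank, so they admit as many tiles over a Folner
  set $F$ as any approximation $\<phi>$ of the same size; matching the tiles gives the representation
  close to $\<phi>$. The number $M$ collects the errors that do not depend on $n$; a nontrivial
  torsion-free group is infinite, and then a large $d$ forces $n$ to be large compared with $M$.
\<close>

theorem weakly_stable_if_residually_finite:
  fixes S :: "('g::group_add \<Rightarrow>\<^sub>0 'k::field) set"
  assumes tf: "torsion_free (group_of_type :: 'g monoid)"
    and am: "amenable (group_of_type :: 'g monoid)"
    and domain: "\<And>x y :: 'g \<Rightarrow>\<^sub>0 'k. x * y = 0 \<Longrightarrow> x = 0 \<or> y = 0"
    and S: "finite S" "group_algebra.generating_set S"
    and rf: "residually_finite (group_of_type :: 'g monoid)"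
  shows "group_algebra.weakly_stable S"
  unfolding group_algebra.weakly_stable_def
proof (intro allI impI)
  fix \<epsilon> :: real assume \<epsilon>: "\<epsilon> > 0"
  \<comment> \<open>the three losses of at most \<delta>n each add up to less than \<epsilon>n\<close>
  define \<delta> where "\<delta> = \<epsilon> / 4"
  have \<delta>: "\<delta> > 0" unfolding \<delta>_def using \<epsilon> by simp
  define T where "T = insert 0 (\<Union>s\<in>S. Poly_Mapping.keys s)"
  have T: "finite T" "0 \<in> T" "\<And>s. s \<in> S \<Longrightarrow> Poly_Mapping.keys s \<subseteq> T" unfolding T_def using S(1) by auto
  obtain F0 where F0: "finite F0" "F0 \<noteq> {}" "real (card (sumset T F0)) \<le> (1 + \<delta>) * real (card F0)"
    using amenable_folner[OF am T(1) \<delta>] by blast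
  define F where "F = sumset T F0"
  have F: "finite F" "F0 \<subseteq> F" "F \<noteq> {}" "real (card F) \<le> (1 + \<delta>) * real (card F0)"
    unfolding F_def using F0 T subset_sumset[OF T(2), of F0] by auto
  define E where "E = insert 0 F"
  have E: "finite E" "0 \<in> E" unfolding E_def using F(1) by auto
  obtain H where H: "finite H" "H \<noteq> {}"
    "real (card (sumset (sumset E (uminus ` E)) H)) \<le> (1 + \<delta>) * real (card H)"
    using amenable_folner[OF am _ \<delta>, of "sumset E (uminus ` E)"] E(1) by auto
  define H1 where "H1 = sumset (uminus ` E) H"
  obtain q act where q: "q > 0" and act: "action_on q (act :: 'g \<Rightarrow> nat \<Rightarrow> nat)"
    and free: "\<And>i. i < q \<Longrightarrow> inj_on (\<lambda>f. act f i) H1"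
    and qcard: "finite (UNIV :: 'g set) \<Longrightarrow> q \<le> card (UNIV :: 'g set)"
    using residually_finite_action[OF rf, of H1] E(1) H(1) unfolding H1_def by auto
  define M where "M = card F * (card F - 1) + (q - 1)"
  obtain N :: "'g set" where N: "finite N" "M = 0 \<or> real M / \<delta> \<le> real (card N)"
  proof (cases "finite (UNIV :: 'g set)")
    case True
    have one: "card (UNIV :: 'g set) = 1" by (rule torsion_free_finite_trivial[OF tf True])
    have "card F \<le> 1" using card_mono[OF True subset_UNIV, of F] one by simp
    moreover have "q \<le> 1" using qcard[OF True] one by simp
    ultimately have "M = 0" unfolding M_def by auto
    then show ?thesis using that[of "{}"] by simp
  next
    case False
    obtain N :: "'g set" where "finite N" "card N = nat \<lceil>real M / \<delta>\<rceil>"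
      using infinite_arbitrarily_large[OF False] by blast
    then show ?thesis using that[of N] by (simp add: of_nat_ceiling)
  qed
  obtain d0 where d0: "\<And>d. d \<ge> d0 \<Longrightarrow> grp ` (F \<union> N) \<subseteq> group_algebra.A_upto S d"
    using group_algebra.finite_subset_A_upto[OF S(2), of "grp ` (F \<union> N)"] F(1) N(1) by auto
  \<comment> \<open>2/d \<le> \<delta> bounds the loss in the tiling of the approximation, and d \<ge> |N| gives n \<ge> |N| \<ge> M/\<delta>\<close>
  define d where "d = max (max d0 1) (max (card N) (nat \<lceil>2 / \<delta>\<rceil>))"
  have d: "d \<ge> 1" "d \<ge> d0" "card N \<le> d" unfolding d_def by auto
  have "nat \<lceil>2 / \<delta>\<rceil> \<le> d"
    unfolding d_def by (rule max.coboundedI2[OF max.cobounded2])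
  then have "2 / \<delta> \<le> real d" using real_nat_ceiling_ge[of "2 / \<delta>"] by linarith
  then have d2: "2 / real d \<le> \<delta>" using d(1) \<delta> by (simp add: field_simps)
  note basic = d0[OF d(2)]
  show "\<exists>d\<ge>1. \<forall>n\<ge>1. \<forall>\<phi>. group_algebra.approximation_of S d n \<phi> \<longrightarrow>
    (\<exists>\<psi>. group_algebra.algebra_representation n \<psi> \<and> (\<forall>s\<in>S. rk n (\<phi> s - \<psi> s) < \<epsilon>))"
  proof (intro exI[of _ d] conjI allI impI)
    show "1 \<le> d" by (rule d(1))
    fix n :: nat and \<phi> assume n: "1 \<le> n" and approx: "group_algebra.approximation_of S d n \<phi>"
    have lin: "group_algebra.linear_to_mat n \<phi>" using approx unfolding group_algebra.approximation_of_def by blast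
    have "card N \<le> n" using approximation_size[OF approx n N(1)] basic d(3) by auto
    then have Mn: "real M \<le> \<delta> * real n"
      using N(2) \<delta> by (auto simp: pos_divide_le_eq mult.commute intro: order_trans)
    obtain k1 u where t1: "tiles F (\<lambda>f. mat_act (\<phi> (grp f))) k1 u"
      and mult: "\<And>i x y. i < k1 \<Longrightarrow> x \<in> group_algebra.A_upto S d \<Longrightarrow> y \<in> group_algebra.A_upto S d \<Longrightarrow>
         mat_act (\<phi> (x * y)) (u i) = mat_act (\<phi> x) (mat_act (\<phi> y) (u i))"
      and n1: "real n \<le> real (k1 * card F) + real (card F * (card F - 1)) + 2 * (real n / real d)"
      by (rule approximation_tiles[OF approx n F(1,3)]) (use basic in blast)+
    interpret A: action_on q act by (rule act)
    define X0 where "X0 = {..<q * (n div q)}"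
    obtain act' where act': "action_on n act'" "X0 \<subseteq> {..<n}" "\<And>g i. i \<in> X0 \<Longrightarrow> act' g i \<in> X0"
      "\<And>i. i \<in> X0 \<Longrightarrow> inj_on (\<lambda>f. act' f i) H1"
      using A.action_on_copies[OF q free, where m = n] unfolding X0_def by (auto simp only: lessThan_iff)
    interpret B: action_on n act' by (rule act'(1))
    have rep: "group_algebra.algebra_representation n (B.perm_rep :: ('g \<Rightarrow>\<^sub>0 'k) \<Rightarrow> 'k mat)"
      by (rule B.perm_rep_representation)
    have linB: "group_algebra.linear_to_mat n (B.perm_rep :: ('g \<Rightarrow>\<^sub>0 'k) \<Rightarrow> 'k mat)"
      using rep unfolding group_algebra.algebra_representation_def by blast
    define \<kappa> where "\<kappa> = nat \<lfloor>\<delta> * real n + real (q - 1)\<rfloor>"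
    have \<kappa>: "real \<kappa> \<le> \<delta> * real n + real (q - 1)" unfolding \<kappa>_def using \<delta> by simp
    have "n - card X0 = n mod q" unfolding X0_def by (simp add: minus_mult_div_eq_mod)
    moreover have "n mod q < q" using q by simp
    ultimately have rest: "real (n - card X0) \<le> real (q - 1)" by linarith
    have rankB: "n \<le> vec_space.rank n (B.perm_rep a) + \<kappa>"
      if a: "a \<noteq> 0" "Poly_Mapping.keys a \<subseteq> F" for a :: "'g \<Rightarrow>\<^sub>0 'k"
    proof -
      have "real n \<le> real (vec_space.rank n (B.perm_rep a)) + \<delta> * real n + real (n - card X0)"
        using B.perm_rep_rank[OF domain a(1) _ E H act'(2,3) act'(4)[unfolded H1_def]] a(2) \<delta>
        unfolding E_def by (meson less_imp_le subset_insertI2)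
      then have "real n - real (vec_space.rank n (B.perm_rep a)) \<le> \<delta> * real n + real (q - 1)"
        using rest by linarith
      then have "int n - int (vec_space.rank n (B.perm_rep a)) \<le> \<lfloor>\<delta> * real n + real (q - 1)\<rfloor>"
        unfolding le_floor_iff by simp
      then show ?thesis unfolding \<kappa>_def by linarith
    qed
    have spanK: "fs.span (Kn n \<union> {}) = (Kn n :: (nat \<Rightarrow> 'k) set)"
      using fs.span_eq_iff[THEN iffD2, OF subspace_Kn] by simp
    obtain k2 v where t2: "tiles F (\<lambda>f. mat_act (B.perm_rep (grp f) :: 'k mat)) k2 v"
      and n2: "n \<le> k2 * card F + card F * (card F - 1) + 0 + \<kappa>"
      by (rule exists_tiles_group_algebra[OF linB F(1,3) rankB subspace_Kn order_refl finite.emptyI _ spanK, of 0])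
         (auto simp only: card.empty)
    define k where "k = min k1 k2"
    have small: "(1 - 2 * \<delta>) * real n \<le> real (k' * card F)" if "k' = k1 \<or> k' = k2" for k'
    proof -
      have expand: "(1 - 2 * \<delta>) * real n = real n - 2 * (\<delta> * real n)" by (simp add: algebra_simps)
      have M: "real M = real (card F * (card F - 1)) + real (q - 1)" unfolding M_def by (rule of_nat_add)
      have "2 * (real n / real d) = (2 / real d) * real n" by simp
      also have "\<dots> \<le> \<delta> * real n" using d2 by (intro mult_right_mono) auto
      finally have "(1 - 2 * \<delta>) * real n \<le> real (k1 * card F)"
        unfolding expand using n1 Mn M by linarith
      moreover have "real n \<le> real (k2 * card F) + real (card F * (card F - 1)) + real \<kappa>" using n2 by linarith
      then have "(1 - 2 * \<delta>) * real n \<le> real (k2 * card F)"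
        unfolding expand using \<kappa> Mn M by linarith
      ultimately show ?thesis using that by blast
    qed
    have "(1 - 2 * \<delta>) * real n \<le> real k * real (card F)"
      using small[of k] unfolding k_def by (metis min_def of_nat_mult)
    also have "\<dots> \<le> real k * ((1 + \<delta>) * real (card F0))" using F(4) by (intro mult_left_mono) auto
    also have "\<dots> = (1 + \<delta>) * real (k * card F0)" by simp
    finally have main: "(1 - 2 * \<delta>) * real n \<le> (1 + \<delta>) * real (k * card F0)" .
    have "(1 - 3 * \<delta>) * (1 + \<delta>) * real n \<le> (1 - 2 * \<delta>) * real n"
      by (intro mult_right_mono) (auto simp: algebra_simps)
    then have "(1 + \<delta>) * ((1 - 3 * \<delta>) * real n) \<le> (1 + \<delta>) * real (k * card F0)"
      using main by (simp add: mult_ac)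
    then have large: "(1 - 3 * \<delta>) * real n \<le> real (k * card F0)"
      using \<delta> by (simp add: mult_le_cancel_left_pos)
    obtain \<psi> where \<psi>: "group_algebra.algebra_representation n \<psi>"
      "\<And>s. s \<in> S \<Longrightarrow> vec_space.rank n (\<phi> s - \<psi> s) + k * card F0 \<le> n"
    proof (rule matching_tiles_close[OF lin rep tiles_fewer[OF t1, of k] tiles_fewer[OF t2, of k] T(1,3) F(2) _ F0(1)])
      fix i s f assume i: "i < k" and s: "s \<in> S" and f: "f \<in> F0"
      have "s \<in> group_algebra.A_upto S d" using s d(1) by (rule group_algebra.generator_in_A_upto)
      moreover have "grp f \<in> group_algebra.A_upto S d" using basic f F(2) by blast
      moreover have "i < k1" using i unfolding k_def by simp
      ultimately show "mat_act (\<phi> (s * grp f)) (u i) = mat_act (\<phi> s) (mat_act (\<phi> (grp f)) (u i))"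
        using mult by blast
    qed (auto simp: k_def F_def)
    have "rk n (\<phi> s - \<psi> s) < \<epsilon>" if s: "s \<in> S" for s
    proof -
      have "real (vec_space.rank n (\<phi> s - \<psi> s)) + real (k * card F0) \<le> real n"
        using \<psi>(2)[OF s] by linarith
      then have "real (vec_space.rank n (\<phi> s - \<psi> s)) \<le> 3 * \<delta> * real n"
        using large by (simp add: left_diff_distrib)
      also have "\<dots> < \<epsilon> * real n" unfolding \<delta>_def using \<epsilon> n by (intro mult_strict_right_mono) auto
      finally show ?thesis unfolding rk_def using n by (simp add: pos_divide_less_eq)
    qed
    then show "\<exists>\<psi>. group_algebra.algebra_representation n \<psi> \<and> (\<forall>s\<in>S. rk n (\<phi> s - \<psi> s) < \<epsilon>)"
      using \<psi>(1) by blast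
  qed
qed


section \<open>Weak stability implies residual finiteness\<close>

text \<open>
  Compress the left multiplications of the group algebra to the span of a Folner set $F = E + F_0$,
  where $E$ supports $A_{\<le> d}$. On vectors supported on $F_0$ nothing is cut off; this yields the
  multiplicativity, and, as there are no zero divisors, the injectivity of $\<phi>(a)$ on a subspace
  of dimension $|F_0|$.
\<close>

lemma exists_approximation:
  fixes S :: "('g::group_add \<Rightarrow>\<^sub>0 'k::field) set"
  assumes am: "amenable (group_of_type :: 'g monoid)"
    and domain: "\<And>x y :: 'g \<Rightarrow>\<^sub>0 'k. x * y = 0 \<Longrightarrow> x = 0 \<or> y = 0"
    and S: "finite S" and d: "d \<ge> 1"
  obtains n \<phi> where "n \<ge> 1" "group_algebra.approximation_of S d n \<phi>"
proof -
  obtain E where E: "finite E" "0 \<in> E"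
    and supp: "\<And>x. x \<in> group_algebra.A_upto S d \<Longrightarrow> Poly_Mapping.keys x \<subseteq> E"
    using A_upto_supported[OF S] by blast
  obtain F0 where F0: "finite F0" "F0 \<noteq> {}" "real (card (sumset E F0)) \<le> (1 + 1 / real d) * real (card F0)"
    using amenable_folner[OF am E(1), of "1 / real d"] d by auto
  define F where "F = sumset E F0"
  have F: "finite F" "F0 \<subseteq> F" unfolding F_def using E F0(1) subset_sumset[OF E(2)] by auto
  define n where "n = card F"
  have n: "n \<ge> 1" unfolding n_def using F F0(2) by (simp add: Suc_le_eq card_gt_0_iff) blast
  have "(1 - 1 / real d) * real n \<le> (1 - 1 / real d) * ((1 + 1 / real d) * real (card F0))"
    unfolding n_def F_def using F0(3) d by (intro mult_left_mono) auto
  also have "\<dots> = (1 - (1 / real d)\<^sup>2) * real (card F0)"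
  proof -
    have "(1 - r) * ((1 + r) * y) = (1 - r\<^sup>2) * y" for r y :: real
      by (simp add: algebra_simps power2_eq_square)
    then show ?thesis .
  qed
  also have "\<dots> \<le> 1 * real (card F0)" by (intro mult_right_mono) auto
  finally have cardF0: "(1 - 1 / real d) * real n \<le> real (card F0)" by simp
  obtain h where h: "bij_betw h {..<n} F"
    using ex_bij_betw_nat_finite[OF F(1)] unfolding n_def atLeast0LessThan by blast
  have hinj: "inj_on h {..<n}" and himg: "h ` {..<n} = F" using h unfolding bij_betw_def by auto
  define J where "J = {j. j < n \<and> h j \<in> F0}"
  have "h ` J = F0" unfolding J_def using himg F(2) by auto
  moreover have "J \<subseteq> {..<n}" unfolding J_def by auto
  ultimately have cardJ: "card J = card F0"
    using card_image[OF inj_on_subset[OF hinj, of J]] by simp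
  have finJ: "finite J" unfolding J_def by simp
  define \<phi> :: "('g \<Rightarrow>\<^sub>0 'k) \<Rightarrow> 'k mat" where
    "\<phi> x = mat n n (\<lambda>(i, j). Poly_Mapping.lookup x (h i - h j))" for x
  have car: "\<phi> x \<in> carrier_mat n n" for x unfolding \<phi>_def by simp
  have lin: "group_algebra.linear_to_mat n \<phi>"
    unfolding group_algebra.linear_to_mat_def
    by (intro conjI allI car; rule eq_matI) (auto simp: \<phi>_def lookup_add lookup_scale_ga)
  \<comment> \<open>the enumeration h of F identifies sequences with elements of the group algebra supported on F\<close>
  define emb :: "(nat \<Rightarrow> 'k) \<Rightarrow> 'g \<Rightarrow>\<^sub>0 'k" where "emb v = (\<Sum>j<n. Poly_Mapping.single (h j) (v j))" for v
  have act: "mat_act (\<phi> x) v i = (if i < n then Poly_Mapping.lookup (x * emb v) (h i) else 0)" for x v i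
    unfolding mat_act_def \<phi>_def emb_def
    by (simp add: sum_distrib_left lookup_sum lookup_mult_single)
  have lookup_emb: "Poly_Mapping.lookup (emb v) (h i) = v i" if "i < n" for v i
  proof -
    have "Poly_Mapping.lookup (emb v) (h i) = (\<Sum>j<n. if j = i then v j else 0)"
      unfolding emb_def lookup_sum lookup_single
      using hinj that by (intro sum.cong refl) (auto simp: when_def inj_on_def)
    also have "\<dots> = v i" using that by simp
    finally show ?thesis .
  qed
  have keys_emb: "Poly_Mapping.keys (emb v) \<subseteq> h ` {j. j < n \<and> v j \<noteq> 0}" for v
  proof
    fix g assume "g \<in> Poly_Mapping.keys (emb v)"
    then have "(\<Sum>j<n. v j when h j = g) \<noteq> 0" by (simp add: in_keys_iff emb_def lookup_sum lookup_single)
    then obtain j where "j < n" "(v j when h j = g) \<noteq> 0" by (meson lessThan_iff sum.not_neutral_contains_not_neutral)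
    then show "g \<in> h ` {j. j < n \<and> v j \<noteq> 0}" by (auto simp: when_def split: if_splits)
  qed
  have emb_act: "emb (mat_act (\<phi> x) v) = x * emb v" if "Poly_Mapping.keys (x * emb v) \<subseteq> F" for x v
  proof (rule poly_mapping_eqI)
    fix g
    show "Poly_Mapping.lookup (emb (mat_act (\<phi> x) v)) g = Poly_Mapping.lookup (x * emb v) g"
    proof (cases "g \<in> F")
      case True
      then obtain i where "i < n" "g = h i" using himg by auto
      then show ?thesis by (simp add: lookup_emb act)
    next
      case False
      then have "g \<notin> Poly_Mapping.keys (emb (mat_act (\<phi> x) v))" "g \<notin> Poly_Mapping.keys (x * emb v)"
        using keys_emb himg that by blast+
      then show ?thesis by (simp add: in_keys_iff)
    qed
  qed
  have interior: "Poly_Mapping.keys (x * emb v) \<subseteq> F"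
    if "x \<in> group_algebra.A_upto S d" "\<And>j. j < n \<Longrightarrow> v j \<noteq> 0 \<Longrightarrow> j \<in> J" for x v
  proof -
    have "Poly_Mapping.keys (emb v) \<subseteq> F0" using keys_emb[of v] that(2) unfolding J_def by blast
    then show ?thesis using keys_mult_sumset[OF supp[OF that(1)]] unfolding F_def by blast
  qed
  define U where "U = {u :: 'k vec. u \<in> carrier_vec n \<and> (\<forall>j<n. j \<notin> J \<longrightarrow> u $ j = 0)}"
  interpret V: vec_space "TYPE('k)" n .
  have "LinearCombinations.submodule class_ring U V.V"
    unfolding LinearCombinations.submodule_def U_def
    using V.module_axioms by (auto simp: module_vec_simps)
  then have U: "subspace_of_Kn n U" unfolding VectorSpace.subspace_def using vec_vs by blast
  have "unit_fun ` J \<subseteq> of_vec ` U"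
  proof
    fix w :: "nat \<Rightarrow> 'k" assume "w \<in> unit_fun ` J"
    then obtain j where j: "j \<in> J" "w = unit_fun j" by blast
    then have "j < n" unfolding J_def by simp
    then have "of_vec (vec n w) = w" unfolding j(2) by (intro of_vec_vec unit_fun_in_Kn)
    moreover have "vec n w \<in> U" using j unfolding U_def unit_fun_def by auto
    ultimately show "w \<in> of_vec ` U" by (metis imageI)
  qed
  then have "card (unit_fun ` J :: (nat \<Rightarrow> 'k) set) \<le> subspace_dim n U"
    using subspace_dim_ge_card[OF U independent_unit_fun] by blast
  moreover have "card (unit_fun ` J :: (nat \<Rightarrow> 'k) set) = card J"
    by (rule card_image) (rule inj_on_subset[OF inj_unit_fun subset_UNIV])
  ultimately have dimU: "card F0 \<le> subspace_dim n U" using cardJ by simp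
  have "group_algebra.approximation_of S d n \<phi>"
    unfolding group_algebra.approximation_of_def
  proof (intro conjI exI[of _ U] ballI impI)
    show "group_algebra.linear_to_mat n \<phi>" by (rule lin)
    show "subspace_of_Kn n U" by (rule U)
    show "(1 - 1 / real d) * real n \<le> real (subspace_dim n U)" using cardF0 dimU by linarith
    fix x y and u :: "'k vec"
    assume xy: "x \<in> group_algebra.A_upto S d" "y \<in> group_algebra.A_upto S d" and u: "u \<in> U"
    have uc: "u \<in> carrier_vec n" using u unfolding U_def by blast
    have supp_u: "j \<in> J" if "j < n" "of_vec u j \<noteq> 0" for j
      using that u unfolding U_def of_vec_def by auto
    have inner: "emb (mat_act (\<phi> y) (of_vec u)) = y * emb (of_vec u)"
      by (rule emb_act[OF interior[OF xy(2) supp_u]])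
    have "mat_act (\<phi> (x * y)) (of_vec u) = mat_act (\<phi> x) (mat_act (\<phi> y) (of_vec u))"
      by (rule ext) (simp add: act inner mult.assoc)
    then have "of_vec (\<phi> (x * y) *\<^sub>v u) = of_vec (\<phi> x *\<^sub>v (\<phi> y *\<^sub>v u))"
      using of_vec_mult[OF car mult_mat_vec_carrier[OF car uc]] of_vec_mult[OF car uc] by simp
    then show "\<phi> (x * y) *\<^sub>v u = \<phi> x *\<^sub>v (\<phi> y *\<^sub>v u)"
      using mult_mat_vec_carrier[OF car] uc by (intro of_vec_inj[of _ n]) auto
  next
    fix a assume a: "a \<in> group_algebra.A_upto S d" "a \<noteq> 0"
    have unitJ: "j' \<in> J" if "j \<in> J" "unit_fun j j' \<noteq> (0::'k)" for j j'
      using that unfolding unit_fun_def by (auto split: if_splits)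
    have fam: "\<forall>j\<in>J. c j = 0" if zero: "(\<Sum>j\<in>J. scale_fun (c j) (mat_act (\<phi> a) (unit_fun j))) = 0" for c
    proof
      fix j assume j: "j \<in> J"
      define v where "v = (\<Sum>j\<in>J. scale_fun (c j) (unit_fun j))"
      have v: "v i = (if i \<in> J then c i else 0)" for i
        unfolding v_def using finJ
        by (simp add: sum_fun_apply scale_fun_apply unit_fun_def if_distrib cong: if_cong)
      have "mat_act (\<phi> a) v = 0"
        unfolding v_def using zero by (simp add: fs.linear_sum[OF linear_mat_act] fs.linear_scale[OF linear_mat_act])
      moreover have "emb (mat_act (\<phi> a) v) = a * emb v"
        using v by (intro emb_act interior[OF a(1)]) (auto split: if_splits)
      moreover have "emb 0 = 0" unfolding emb_def by simp
      ultimately have "emb v = 0" using domain[of a "emb v"] a(2) by simp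
      then have "v j = 0" using lookup_emb[of j v] j unfolding J_def by simp
      then show "c j = 0" using v j by simp
    qed
    note indep = fs.independent_family[OF finJ fam]
    have "card ((\<lambda>j. mat_act (\<phi> a) (unit_fun j)) ` J) \<le> vec_space.rank n (\<phi> a)"
      using unit_fun_in_Kn unfolding J_def
      by (intro rank_ge_card[OF car] indep(2)[unfolded J_def]) auto
    then have "card F0 \<le> vec_space.rank n (\<phi> a)" using card_image[OF indep(1)] cardJ by simp
    then have "(1 - 1 / real d) * real n \<le> real (vec_space.rank n (\<phi> a))" using cardF0 by linarith
    then show "1 - 1 / real d \<le> rk n (\<phi> a)" unfolding rk_def using n by (simp add: pos_le_divide_eq)
  qed
  then show ?thesis using that n by blast
qed

lemma rank_add_le:
  assumes "X \<in> carrier_mat n n" "Y \<in> carrier_mat n n"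
  shows "vec_space.rank n (X + Y) \<le> vec_space.rank n X + vec_space.rank n (Y :: 'k::field mat)"
  using vec_space.rank_subadditive[OF assms] .

lemma rank_mult_le:
  fixes X Y :: "'k::field mat"
  assumes X: "X \<in> carrier_mat n n" and Y: "Y \<in> carrier_mat n n"
  shows "vec_space.rank n (X * Y) \<le> vec_space.rank n X" "vec_space.rank n (X * Y) \<le> vec_space.rank n Y"
proof -
  obtain G where G: "finite G" "card G = vec_space.rank n X" "\<And>v. v \<in> Kn n \<Longrightarrow> mat_act X v \<in> fs.span G"
    using rank_basis[OF X] by metis
  show "vec_space.rank n (X * Y) \<le> vec_space.rank n X"
    unfolding G(2)[symmetric]
    using X Y G(1,3) mat_act_in_Kn[OF Y] by (intro rank_le_card) (auto simp: mat_act_mult)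
  obtain H where H: "finite H" "card H = vec_space.rank n Y" "\<And>v. v \<in> Kn n \<Longrightarrow> mat_act Y v \<in> fs.span H"
    using rank_basis[OF Y] by metis
  have "mat_act X (mat_act Y v) \<in> fs.span (mat_act X ` H)" if "v \<in> Kn n" for v
    using H(3)[OF that] fs.linear_span_image[OF linear_mat_act] by blast
  then have "vec_space.rank n (X * Y) \<le> card (mat_act X ` H)"
    using X Y H(1) by (intro rank_le_card) (auto simp: mat_act_mult)
  also have "\<dots> \<le> card H" using H(1) by (rule card_image_le)
  finally show "vec_space.rank n (X * Y) \<le> vec_space.rank n Y" using H(2) by simp
qed

lemma rank_smult_le:
  fixes X :: "'k::field mat"
  assumes X: "X \<in> carrier_mat n n"
  shows "vec_space.rank n (c \<cdot>\<^sub>m X) \<le> vec_space.rank n X"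
proof -
  obtain G where G: "finite G" "card G = vec_space.rank n X" "\<And>v. v \<in> Kn n \<Longrightarrow> mat_act X v \<in> fs.span G"
    using rank_basis[OF X] by metis
  show ?thesis
    unfolding G(2)[symmetric] using X G(1,3)
    by (intro rank_le_card) (auto simp: mat_act_smult[OF X] intro: fs.span_scale)
qed

lemma rank_le_codim:
  fixes X :: "'k::field mat"
  assumes X: "X \<in> carrier_mat n n" and U: "subspace_of_Kn n U" and kill: "\<And>u. u \<in> U \<Longrightarrow> X *\<^sub>v u = 0\<^sub>v n"
  shows "vec_space.rank n X + subspace_dim n U \<le> n"
proof -
  obtain B where B: "fs.independent B" "fs.span B = of_vec ` U" "card B = subspace_dim n U"
    using subspace_basis[OF U] .
  have Uc: "U \<subseteq> carrier_vec n" using U unfolding subspace_def submodule_def by (auto simp: module_vec_simps)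
  have BU: "B \<subseteq> of_vec ` U" using fs.span_superset B(2) by blast
  have "mat_act X w = 0" if w: "w \<in> B" for w
  proof -
    obtain u where u: "u \<in> U" "w = of_vec u" using BU w by blast
    have "mat_act X w = of_vec (X *\<^sub>v u)" unfolding u(2) using of_vec_mult[OF X] u(1) Uc by auto
    also have "\<dots> = 0" unfolding kill[OF u(1)] by (auto simp: of_vec_def)
    finally show ?thesis .
  qed
  then show ?thesis
    using rank_plus_kernel_le[OF X B(1)] BU subspace_of_vec(2)[OF U] B(3) by (metis subset_trans)
qed

text \<open>
  The distance of $\<phi>(x)$ and $\<psi>(x)$ is linear in the distance on generators and in $1/d$, with
  constants that depend only on $x$ and $S$.
\<close>

definition distance_bound ::
  "('g::group_add \<Rightarrow>\<^sub>0 'k::field) set \<Rightarrow> ('g \<Rightarrow>\<^sub>0 'k) \<Rightarrow> real \<Rightarrow> nat \<Rightarrow> bool" where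
  "distance_bound S x c d0 \<longleftrightarrow> c \<ge> 0 \<and> (\<forall>\<epsilon> d n \<phi> \<psi>. \<epsilon> > 0 \<longrightarrow> d \<ge> d0 \<longrightarrow> d \<ge> 1 \<longrightarrow> n \<ge> 1 \<longrightarrow>
    group_algebra.approximation_of S d n \<phi> \<longrightarrow> group_algebra.algebra_representation n \<psi> \<longrightarrow>
    (\<forall>s\<in>S. rk n (\<phi> s - \<psi> s) < \<epsilon>) \<longrightarrow>
    real (vec_space.rank n (\<phi> x - \<psi> x)) \<le> c * (\<epsilon> + 1 / real d) * real n)"

lemma distance_boundD:
  assumes "distance_bound S x c d0" "\<epsilon> > 0" "d \<ge> d0" "d \<ge> 1" "n \<ge> 1"
    "group_algebra.approximation_of S d n \<phi>" "group_algebra.algebra_representation n \<psi>"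
    "\<forall>s\<in>S. rk n (\<phi> s - \<psi> s) < \<epsilon>"
  shows "real (vec_space.rank n (\<phi> x - \<psi> x)) \<le> c * (\<epsilon> + 1 / real d) * real n"
  using assms unfolding distance_bound_def by blast

text \<open>
  For a word $s w$ split the difference into $\<phi>(s w) - \<phi>(s) \<phi>(w)$, which vanishes on a subspace
  of codimension at most $n/d$, and $(\<phi>(s) - \<psi>(s)) \<phi>(w) + \<psi>(s) (\<phi>(w) - \<psi>(w))$. Induction on the length
  of words treats all words, and words span the algebra.
\<close>

lemma exists_distance_bound:
  fixes S :: "('g::group_add \<Rightarrow>\<^sub>0 'k::field) set"
  assumes S: "1 \<in> S" "group_algebra.generating_set S"
  shows "\<exists>c d0. distance_bound S x c d0"
proof -
  have car: "\<phi> x \<in> carrier_mat n n" "\<psi> x \<in> carrier_mat n n"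
    if "group_algebra.approximation_of S d n \<phi>" "group_algebra.algebra_representation n \<psi>" for \<phi> \<psi> d n x
    using that unfolding group_algebra.approximation_of_def group_algebra.algebra_representation_def
      group_algebra.linear_to_mat_def by auto
  have lin: "\<phi> (x + y) = \<phi> x + \<phi> y" "\<psi> (x + y) = \<psi> x + \<psi> y"
     "\<phi> (scale_ga c x) = c \<cdot>\<^sub>m \<phi> x" "\<psi> (scale_ga c x) = c \<cdot>\<^sub>m \<psi> x"
    if "group_algebra.approximation_of S d n \<phi>" "group_algebra.algebra_representation n \<psi>" for \<phi> \<psi> d n x y c
    using that unfolding group_algebra.approximation_of_def group_algebra.algebra_representation_def
      group_algebra.linear_to_mat_def by auto
  have word: "real (vec_space.rank n (\<phi> (prod_list w) - \<psi> (prod_list w))) \<le>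
      (real (length w) + 1) * (\<epsilon> + 1 / real d) * real n"
    if \<epsilon>: "\<epsilon> > 0" and d: "d \<ge> 1" and n: "n \<ge> 1" and approx: "group_algebra.approximation_of S d n \<phi>"
      and rep: "group_algebra.algebra_representation n \<psi>"
      and close: "\<forall>s\<in>S. rk n (\<phi> s - \<psi> s) < \<epsilon>"
      and w: "set w \<subseteq> S" "length w \<le> d" for \<epsilon> :: real and d n \<phi> \<psi> w
    using w
  proof (induction w)
    case Nil
    have "rk n (\<phi> 1 - \<psi> 1) < \<epsilon>" using close S(1) by blast
    then have "real (vec_space.rank n (\<phi> 1 - \<psi> 1)) \<le> \<epsilon> * real n"
      unfolding rk_def using n by (simp add: pos_divide_less_eq)
    also have "\<dots> \<le> (\<epsilon> + 1 / real d) * real n" by (intro mult_right_mono) auto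
    finally show ?case by simp
  next
    case (Cons s w)
    note C = car[OF approx rep]
    have s: "s \<in> S" and wS: "set w \<subseteq> S" "length w \<le> d" using Cons.prems by auto
    define x where "x = prod_list w"
    define D where "D = \<phi> (s * x) - \<phi> s * \<phi> x"
    have Dc: "D \<in> carrier_mat n n" unfolding D_def using C by (intro minus_carrier_mat mult_carrier_mat)
    have \<psi>mult: "\<psi> (s * x) = \<psi> s * \<psi> x" using rep unfolding group_algebra.algebra_representation_def by blast
    have "\<phi> (s * x) - \<psi> (s * x) = D + ((\<phi> s - \<psi> s) * \<phi> x + \<psi> s * (\<phi> x - \<psi> x))"
      unfolding D_def \<psi>mult
      using C[of s] C[of x] C[of "s * x"] by (simp add: minus_mult_distrib_mat mult_minus_distrib_mat) (rule eq_matI; simp)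
    then have "vec_space.rank n (\<phi> (s * x) - \<psi> (s * x))
        \<le> vec_space.rank n D + vec_space.rank n ((\<phi> s - \<psi> s) * \<phi> x + \<psi> s * (\<phi> x - \<psi> x))"
      using rank_add_le[OF Dc, of "(\<phi> s - \<psi> s) * \<phi> x + \<psi> s * (\<phi> x - \<psi> x)"] C
      by (metis add_carrier_mat minus_carrier_mat mult_carrier_mat)
    moreover have "vec_space.rank n ((\<phi> s - \<psi> s) * \<phi> x + \<psi> s * (\<phi> x - \<psi> x))
        \<le> vec_space.rank n ((\<phi> s - \<psi> s) * \<phi> x) + vec_space.rank n (\<psi> s * (\<phi> x - \<psi> x))"
      using C by (intro rank_add_le mult_carrier_mat minus_carrier_mat)
    moreover have "vec_space.rank n ((\<phi> s - \<psi> s) * \<phi> x) \<le> vec_space.rank n (\<phi> s - \<psi> s)"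
      using C by (intro rank_mult_le minus_carrier_mat)
    moreover have "vec_space.rank n (\<psi> s * (\<phi> x - \<psi> x)) \<le> vec_space.rank n (\<phi> x - \<psi> x)"
      using C by (intro rank_mult_le minus_carrier_mat)
    moreover have "real (vec_space.rank n D) \<le> 1 / real d * real n"
    proof -
      obtain U where U: "subspace_of_Kn n U"
        and mult: "\<And>x y u. x \<in> group_algebra.A_upto S d \<Longrightarrow> y \<in> group_algebra.A_upto S d \<Longrightarrow> u \<in> U \<Longrightarrow>
           \<phi> (x * y) *\<^sub>v u = \<phi> x *\<^sub>v (\<phi> y *\<^sub>v u)"
        and dim: "real (subspace_dim n U) \<ge> (1 - 1 / real d) * real n"
        using approx unfolding group_algebra.approximation_of_def by blast
      have Uc: "U \<subseteq> carrier_vec n" using U unfolding subspace_def submodule_def by (auto simp: module_vec_simps)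
      have A: "s \<in> group_algebra.A_upto S d" "x \<in> group_algebra.A_upto S d"
        unfolding x_def using s wS d
        by (auto intro: group_algebra.generator_in_A_upto group_algebra.prod_list_in_A_upto)
      have "D *\<^sub>v u = 0\<^sub>v n" if u: "u \<in> U" for u
      proof -
        have uc: "u \<in> carrier_vec n" using u Uc by blast
        have "D *\<^sub>v u = \<phi> (s * x) *\<^sub>v u - (\<phi> s * \<phi> x) *\<^sub>v u"
          unfolding D_def using C uc by (intro minus_mult_distrib_mat_vec mult_carrier_mat)
        also have "(\<phi> s * \<phi> x) *\<^sub>v u = \<phi> s *\<^sub>v (\<phi> x *\<^sub>v u)" using C uc by (intro assoc_mult_mat_vec)
        finally show ?thesis 
          unfolding mult[OF A u] by (simp only: minus_cancel_vec[OF mult_mat_vec_carrier[OF C(1)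
              mult_mat_vec_carrier[OF C(1) uc]]])
      qed
      then have "vec_space.rank n D + subspace_dim n U \<le> n" by (rule rank_le_codim[OF Dc U])
      then have "real (vec_space.rank n D) + real (subspace_dim n U) \<le> real n" by linarith
      then show ?thesis using dim by (simp add: left_diff_distrib)
    qed
    moreover have "real (vec_space.rank n (\<phi> s - \<psi> s)) \<le> \<epsilon> * real n"
      using close s n unfolding rk_def by (simp add: pos_divide_less_eq less_imp_le)
    moreover have "real (vec_space.rank n (\<phi> x - \<psi> x)) \<le> (real (length w) + 1) * (\<epsilon> + 1 / real d) * real n"
      unfolding x_def by (rule Cons.IH[OF wS])
    moreover have "(real (length (s # w)) + 1) * (\<epsilon> + 1 / real d) * real n =
        1 / real d * real n + \<epsilon> * real n + (real (length w) + 1) * (\<epsilon> + 1 / real d) * real n"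
      by (simp add: algebra_simps)
    ultimately show ?case unfolding x_def[symmetric] prod_list.Cons by linarith
  qed
  have "group_algebra.subspace {x. \<exists>c d0. distance_bound S x c d0}"
    unfolding group_algebra.subspace_def
  proof (intro conjI ballI allI)
    have zero: "\<chi> 0 = 0\<^sub>m n n" if "group_algebra.linear_to_mat n \<chi>" for n and \<chi> :: "('g \<Rightarrow>\<^sub>0 'k) \<Rightarrow> 'k mat"
    proof -
      have "\<chi> (scale_ga 0 0) = 0 \<cdot>\<^sub>m \<chi> 0" "\<chi> 0 \<in> carrier_mat n n"
        using that unfolding group_algebra.linear_to_mat_def by blast+
      moreover have "0 \<cdot>\<^sub>m A = 0\<^sub>m n n" if "A \<in> carrier_mat n n" for A :: "'k mat"
        using that by (intro eq_matI) auto
      ultimately show ?thesis by (simp only: scale_ga_zero)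
    qed
    have "real (vec_space.rank n (\<phi> 0 - \<psi> 0)) = 0"
      if "group_algebra.approximation_of S d n \<phi>" "group_algebra.algebra_representation n \<psi>"
      for d n and \<phi> \<psi> :: "('g \<Rightarrow>\<^sub>0 'k) \<Rightarrow> 'k mat"
    proof -
      have "\<phi> 0 - \<psi> 0 = 0\<^sub>m n n"
        using zero[of n \<phi>] zero[of n \<psi>] that
        unfolding group_algebra.approximation_of_def group_algebra.algebra_representation_def by simp
      then show ?thesis using vec_space.rank_0I by simp
    qed
    then have "distance_bound S 0 0 0" unfolding distance_bound_def by auto
    then show "0 \<in> {x. \<exists>c d0. distance_bound S x c d0}" by blast
  next
    fix x y
    assume "x \<in> {x. \<exists>c d0. distance_bound S x c d0}" "y \<in> {x. \<exists>c d0. distance_bound S x c d0}"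
    then obtain c1 d1 c2 d2 where 1: "distance_bound S x c1 d1" and 2: "distance_bound S y c2 d2"
      by auto
    have "distance_bound S (x + y) (c1 + c2) (max d1 d2)"
      unfolding distance_bound_def
    proof (intro conjI allI impI)
      show "0 \<le> c1 + c2" using 1 2 unfolding distance_bound_def by auto
      fix \<epsilon> :: real and d n \<phi> \<psi>
      assume h: "\<epsilon> > 0" "d \<ge> max d1 d2" "d \<ge> 1" "n \<ge> 1"
        and approx: "group_algebra.approximation_of S d n \<phi>"
        and rep: "group_algebra.algebra_representation n \<psi>" and close: "\<forall>s\<in>S. rk n (\<phi> s - \<psi> s) < \<epsilon>"
      note C = car[OF approx rep]
      have "\<phi> (x + y) - \<psi> (x + y) = (\<phi> x - \<psi> x) + (\<phi> y - \<psi> y)"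
        unfolding lin[OF approx rep] using C[of x] C[of y] by (intro eq_matI) auto
      then have "vec_space.rank n (\<phi> (x + y) - \<psi> (x + y))
          \<le> vec_space.rank n (\<phi> x - \<psi> x) + vec_space.rank n (\<phi> y - \<psi> y)"
        using rank_add_le[of "\<phi> x - \<psi> x" n "\<phi> y - \<psi> y"] C by (simp add: minus_carrier_mat)
      moreover have "real (vec_space.rank n (\<phi> x - \<psi> x)) \<le> c1 * (\<epsilon> + 1 / real d) * real n"
        using h by (intro distance_boundD[OF 1 _ _ _ _ approx rep close]) auto
      moreover have "real (vec_space.rank n (\<phi> y - \<psi> y)) \<le> c2 * (\<epsilon> + 1 / real d) * real n"
        using h by (intro distance_boundD[OF 2 _ _ _ _ approx rep close]) auto
      moreover have "(c1 + c2) * (\<epsilon> + 1 / real d) * real n =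
          c1 * (\<epsilon> + 1 / real d) * real n + c2 * (\<epsilon> + 1 / real d) * real n"
        by (simp only: distrib_right)
      ultimately show "real (vec_space.rank n (\<phi> (x + y) - \<psi> (x + y))) \<le> (c1 + c2) * (\<epsilon> + 1 / real d) * real n"
        by linarith
    qed
    then show "x + y \<in> {x. \<exists>c d0. distance_bound S x c d0}" by blast
  next
    fix b x assume "x \<in> {x. \<exists>c d0. distance_bound S x c d0}"
    then obtain c d0 where 1: "distance_bound S x c d0" by auto
    have "distance_bound S (scale_ga b x) c d0"
      unfolding distance_bound_def
    proof (intro conjI allI impI)
      show "0 \<le> c" using 1 unfolding distance_bound_def by auto
      fix \<epsilon> :: real and d n \<phi> \<psi>
      assume h: "\<epsilon> > 0" "d \<ge> d0" "d \<ge> 1" "n \<ge> 1"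
        and approx: "group_algebra.approximation_of S d n \<phi>"
        and rep: "group_algebra.algebra_representation n \<psi>" and close: "\<forall>s\<in>S. rk n (\<phi> s - \<psi> s) < \<epsilon>"
      note C = car[OF approx rep]
      have "\<phi> (scale_ga b x) - \<psi> (scale_ga b x) = b \<cdot>\<^sub>m (\<phi> x - \<psi> x)"
        unfolding lin[OF approx rep] using C[of x] by (intro eq_matI) (auto simp: right_diff_distrib)
      then have "vec_space.rank n (\<phi> (scale_ga b x) - \<psi> (scale_ga b x)) \<le> vec_space.rank n (\<phi> x - \<psi> x)"
        using rank_smult_le[of "\<phi> x - \<psi> x" n b] C by (simp add: minus_carrier_mat)
      moreover have "real (vec_space.rank n (\<phi> x - \<psi> x)) \<le> c * (\<epsilon> + 1 / real d) * real n"
        by (rule distance_boundD[OF 1 h approx rep close])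
      ultimately show "real (vec_space.rank n (\<phi> (scale_ga b x) - \<psi> (scale_ga b x))) \<le> c * (\<epsilon> + 1 / real d) * real n"
        by linarith
    qed
    then show "scale_ga b x \<in> {x. \<exists>c d0. distance_bound S x c d0}" by blast
  qed
  moreover have "{prod_list w |w. set w \<subseteq> S} \<subseteq> {x. \<exists>c d0. distance_bound S x c d0}"
  proof clarify
    fix w assume w: "set w \<subseteq> S"
    have "distance_bound S (prod_list w) (real (length w) + 1) (length w)"
      unfolding distance_bound_def by (intro conjI allI impI word w) auto
    then show "\<exists>c d0. distance_bound S (prod_list w) c d0" by blast
  qed
  ultimately have "group_algebra.span {prod_list w |w. set w \<subseteq> S} \<subseteq> {x. \<exists>c d0. distance_bound S x c d0}"
    by (intro group_algebra.span_minimal)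
  then show ?thesis using S(2) unfolding group_algebra.generating_set_def by blast
qed

text \<open>
  Malcev's theorem, for matrices that may be singular: all matrix entries of the group lie in a finitely
  generated subring $A$ of the field. An entry in which $\<psi>(\<gamma>)$ and $\<psi>(0)$ differ remains
  nonzero modulo an ideal $I$ of finite index, and congruence modulo $I$ defines the subgroup. The
  matrix $\<psi>(0)$ of the neutral element is an idempotent that need not be the identity; congruence to it works as well,
  because congruence is compatible with multiplication from both sides.
\<close>

lemma malcev:
  fixes \<psi> :: "'g::group_add \<Rightarrow> 'k::field mat"
  assumes fg: "finitely_generated (group_of_type :: 'g monoid)"
    and car: "\<And>g. \<psi> g \<in> carrier_mat n n" and mult: "\<And>g h. \<psi> (g + h) = \<psi> g * \<psi> h"
    and \<gamma>: "\<psi> \<gamma> \<noteq> \<psi> 0"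
  shows "\<exists>N. N \<lhd> (group_of_type :: 'g monoid) \<and> finite (rcosets\<^bsub>group_of_type\<^esub> N) \<and> \<gamma> \<notin> N"
proof -
  interpret G: group "group_of_type :: 'g monoid" by (rule group_group_of_type)
  obtain T :: "'g set" where T: "finite T" "generate group_of_type T = UNIV"
    using fg unfolding finitely_generated_def by (auto simp: group_of_type_def)
  define X where "X = (\<Union>t\<in>insert 0 (T \<union> uminus ` T). \<Union>i<n. (\<lambda>j. \<psi> t $$ (i, j)) ` {..<n})"
  have "finite X" unfolding X_def using T(1) by auto
  then obtain A where A: "finite_quotients_detect_units A" "X \<subseteq> A" using finitely_generated_subring by blast
  have ring: "subring_of A" using A(1) unfolding finite_quotients_detect_units_def by blast
  have prod: "\<psi> (g + h) $$ (i, j) = (\<Sum>k<n. \<psi> g $$ (i, k) * \<psi> h $$ (k, j))" if "i < n" "j < n" for g h i j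
    unfolding mult using car[of g] car[of h] that by (simp add: scalar_prod_def atLeast0LessThan)
  have gen: "\<psi> t $$ (i, j) \<in> A" if "t \<in> insert 0 (T \<union> uminus ` T)" "i < n" "j < n" for t i j
    using that A(2) unfolding X_def by blast
  have inv: "inv\<^bsub>group_of_type\<^esub> x = - x" for x :: 'g
    by (rule G.inv_equality) (simp_all add: group_of_type_def)
  have entries: "\<psi> g $$ (i, j) \<in> A" if "i < n" "j < n" for g i j
  proof -
    have "g \<in> generate group_of_type T" using T(2) by simp
    then have "\<forall>i<n. \<forall>j<n. \<psi> g $$ (i, j) \<in> A"
    proof (induction rule: generate.induct)
      case one
      then show ?case using gen[of 0] by (simp add: group_of_type_def)
    next
      case (incl h)
      then show ?case using gen[of h] by simp
    next
      case (inv h)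
      then show ?case using gen[of "- h"] unfolding \<open>\<And>x. inv\<^bsub>group_of_type\<^esub> x = - x\<close> by simp
    next
      case (eng h1 h2)
      have "h1 \<otimes>\<^bsub>group_of_type\<^esub> h2 = h1 + h2" by (simp add: group_of_type_def)
      then show ?case using eng.IH
        by (auto simp: prod intro!: sum_in_ideal[OF subring_ideal_self[OF ring]] subring_ofD(6)[OF ring])
    qed
    then show ?thesis using that by blast
  qed
  obtain i0 j0 where ij: "i0 < n" "j0 < n" "\<psi> \<gamma> $$ (i0, j0) \<noteq> \<psi> 0 $$ (i0, j0)"
    using \<gamma> eq_matI[of "\<psi> 0" "\<psi> \<gamma>"] car[of \<gamma>] car[of 0] by auto
  define r where "r = \<psi> \<gamma> $$ (i0, j0) - \<psi> 0 $$ (i0, j0)"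
  have "r \<in> A" "r \<noteq> 0" unfolding r_def using entries ij subring_ofD(5)[OF ring] by auto
  then obtain I b where I: "ideal_of I A" "1 \<notin> I" "finite_index_in I A" and b: "b \<in> A" "b * r - 1 \<in> I"
    using A(1) unfolding finite_quotients_detect_units_def by meson
  have "r \<notin> I"
  proof
    assume "r \<in> I"
    then have "b * r - (b * r - 1) \<in> I" using b ideal_ofD(5,6)[OF I(1)] by blast
    then show False using I(2) by simp
  qed
  define congruent_mod where "congruent_mod g h \<longleftrightarrow> (\<forall>i<n. \<forall>j<n. \<psi> g $$ (i, j) - \<psi> h $$ (i, j) \<in> I)" for g h
  have left: "congruent_mod (k + g) (k + h)" if "congruent_mod g h" for g h k
    unfolding congruent_mod_def
  proof (intro allI impI)
    fix i j assume "i < n" "j < n"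
    then have "\<psi> (k + g) $$ (i, j) - \<psi> (k + h) $$ (i, j)
        = (\<Sum>l<n. \<psi> k $$ (i, l) * (\<psi> g $$ (l, j) - \<psi> h $$ (l, j)))"
      by (simp add: prod right_diff_distrib sum_subtractf)
    also have "\<dots> \<in> I" using that \<open>i < n\<close> \<open>j < n\<close> unfolding congruent_mod_def
      by (intro sum_in_ideal[OF I(1)] ideal_ofD(6)[OF I(1)] entries) auto
    finally show "\<psi> (k + g) $$ (i, j) - \<psi> (k + h) $$ (i, j) \<in> I" .
  qed
  have right: "congruent_mod (g + k) (h + k)" if "congruent_mod g h" for g h k
    unfolding congruent_mod_def
  proof (intro allI impI)
    fix i j assume "i < n" "j < n"
    then have "\<psi> (g + k) $$ (i, j) - \<psi> (h + k) $$ (i, j)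
        = (\<Sum>l<n. (\<psi> g $$ (i, l) - \<psi> h $$ (i, l)) * \<psi> k $$ (l, j))"
      by (simp add: prod left_diff_distrib sum_subtractf)
    also have "\<dots> \<in> I" using that \<open>i < n\<close> \<open>j < n\<close> unfolding congruent_mod_def
      by (intro sum_in_ideal[OF I(1)] ideal_ofD(7)[OF I(1)] entries) auto
    finally show "\<psi> (g + k) $$ (i, j) - \<psi> (h + k) $$ (i, j) \<in> I" .
  qed
  have refl: "congruent_mod g g" for g unfolding congruent_mod_def using ideal_ofD(2)[OF I(1)] by simp
  have sym: "congruent_mod h g" if "congruent_mod g h" for g h
    using that ideal_ofD(3)[OF I(1)] unfolding congruent_mod_def by (metis minus_diff_eq)
  have trans: "congruent_mod g k" if "congruent_mod g h" "congruent_mod h k" for g h k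
    unfolding congruent_mod_def
  proof (intro allI impI)
    fix i j assume "i < n" "j < n"
    then have "(\<psi> g $$ (i, j) - \<psi> h $$ (i, j)) + (\<psi> h $$ (i, j) - \<psi> k $$ (i, j)) \<in> I"
      using that unfolding congruent_mod_def by (intro ideal_ofD(4)[OF I(1)]) auto
    then show "\<psi> g $$ (i, j) - \<psi> k $$ (i, j) \<in> I" by simp
  qed
  define N where "N = {g. congruent_mod g 0}"
  have inN: "g \<in> N \<longleftrightarrow> congruent_mod g 0" for g unfolding N_def by simp
  have normal: "N \<lhd> (group_of_type :: 'g monoid)"
    unfolding normal_group_of_type
  proof (intro conjI ballI allI; unfold inN)
    show "congruent_mod 0 0" by (rule refl)
    show "congruent_mod (x + y) 0" if "congruent_mod x 0" "congruent_mod y 0" for x y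
      using trans[OF left[of y 0 x]] that by simp
    show "congruent_mod (- x) 0" if "congruent_mod x 0" for x
      using sym[OF left[of x 0 "- x"]] that by simp
    show "congruent_mod (g + x + - g) 0" if "congruent_mod x 0" for g x
      using right[OF left[of x 0 g], of "- g"] that by simp
  qed
  obtain R where R: "finite R" "\<And>a. a \<in> A \<Longrightarrow> \<exists>r\<in>R. a - r \<in> I"
    using I(3) unfolding finite_index_in_def by blast
  obtain rep where rep: "\<And>a. a \<in> A \<Longrightarrow> rep a \<in> R \<and> a - rep a \<in> I" using R(2) by metis
  define code where "code g = restrict (\<lambda>(i, j). rep (\<psi> g $$ (i, j))) ({..<n} \<times> {..<n})" for g
  have "range code \<subseteq> ({..<n} \<times> {..<n}) \<rightarrow>\<^sub>E R"
    unfolding code_def using rep entries by (auto simp: split: if_splits)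
  then have fincode: "finite (range code)" using R(1) finite_PiE[of "{..<n} \<times> {..<n}" "\<lambda>_. R"] finite_subset by blast
  have same: "(+) g ` N = (+) h ` N" if eq: "code g = code h" for g h
  proof -
    have "congruent_mod g h"
      unfolding congruent_mod_def
    proof (intro allI impI)
      fix i j assume "i < n" "j < n"
      then have "rep (\<psi> g $$ (i, j)) = rep (\<psi> h $$ (i, j))"
        using fun_cong[OF eq, of "(i, j)"] unfolding code_def by simp
      moreover have "(\<psi> g $$ (i, j) - rep (\<psi> g $$ (i, j))) - (\<psi> h $$ (i, j) - rep (\<psi> h $$ (i, j))) \<in> I"
        by (rule ideal_ofD(5)[OF I(1) conjunct2[OF rep[OF entries[OF \<open>i < n\<close> \<open>j < n\<close>]]]
              conjunct2[OF rep[OF entries[OF \<open>i < n\<close> \<open>j < n\<close>]]]])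
      ultimately show "\<psi> g $$ (i, j) - \<psi> h $$ (i, j) \<in> I" by simp
    qed
    then have "congruent_mod (- h + g) (- h + h)" by (rule left)
    then show ?thesis unfolding coset_eq_iff[OF normal] inN by simp
  qed
  have "range (\<lambda>g. (+) g ` N) \<subseteq> (\<lambda>c. (+) (inv_into UNIV code c) ` N) ` range code"
  proof clarify
    fix g
    have "code (inv_into UNIV code (code g)) = code g" by (rule f_inv_into_f) simp
    then have "(+) g ` N = (+) (inv_into UNIV code (code g)) ` N" by (intro same) simp
    then show "(+) g ` N \<in> (\<lambda>c. (+) (inv_into UNIV code c) ` N) ` range code" by blast
  qed
  then have "finite (range (\<lambda>g. (+) g ` N))" 
    by (rule finite_subset[OF _ finite_imageI[OF fincode]])
  moreover have "\<gamma> \<notin> N" using \<open>r \<notin> I\<close> ij(1,2) unfolding N_def congruent_mod_def r_def by blast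
  ultimately show ?thesis using normal finite_rcosets_iff[OF normal] by blast
qed

text \<open>
  Let $\<gamma> \<noteq> 0$ and $x = \<gamma> - 1$ in the group algebra. Stability replaces an approximation
  $\<phi>$ by a representation $\<psi>$ such that $\<psi>(x)$ differs from $\<phi>(x)$ by at most half of the full
  rank. Since $\<phi>(x)$ has almost full rank, $\<psi>(x) \<noteq> 0$.
\<close>

theorem residually_finite_if_weakly_stable:
  fixes S :: "('g::group_add \<Rightarrow>\<^sub>0 'k::field) set"
  assumes fg: "finitely_generated (group_of_type :: 'g monoid)"
    and am: "amenable (group_of_type :: 'g monoid)"
    and domain: "\<And>x y :: 'g \<Rightarrow>\<^sub>0 'k. x * y = 0 \<Longrightarrow> x = 0 \<or> y = 0"
    and S: "finite S" "1 \<in> S" "group_algebra.generating_set S"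
    and stable: "group_algebra.weakly_stable S"
  shows "residually_finite (group_of_type :: 'g monoid)"
  unfolding residually_finite_def
proof (intro ballI impI)
  fix \<gamma> :: 'g assume "\<gamma> \<noteq> \<one>\<^bsub>group_of_type\<^esub>"
  then have \<gamma>: "\<gamma> \<noteq> 0" by (simp add: group_of_type_def)
  define x :: "'g \<Rightarrow>\<^sub>0 'k" where "x = grp \<gamma> - grp 0"
  have "Poly_Mapping.lookup x \<gamma> = 1" unfolding x_def using \<gamma> by (simp add: lookup_minus lookup_single lookup_one when_def)
  then have "x \<noteq> 0" by auto
  obtain c d0 where bound: "distance_bound S x c d0" using exists_distance_bound[OF S(2,3)] by blast
  then have c: "c \<ge> 0" unfolding distance_bound_def by blast
  \<comment> \<open>makes the distance at most c (2\<epsilon>) n, hence at most n / 2\<close>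
  define \<epsilon> where "\<epsilon> = 1 / (4 * (c + 1))"
  have \<epsilon>: "\<epsilon> > 0" unfolding \<epsilon>_def using c by simp
  obtain d1 where d1: "d1 \<ge> 1" and stab: "\<And>n \<phi>. n \<ge> 1 \<Longrightarrow> group_algebra.approximation_of S d1 n \<phi> \<Longrightarrow>
     \<exists>\<psi>. group_algebra.algebra_representation n \<psi> \<and> (\<forall>s\<in>S. rk n (\<phi> s - \<psi> s) < \<epsilon>)"
    using stable \<epsilon> unfolding group_algebra.weakly_stable_def by meson
  obtain d2 where d2: "x \<in> group_algebra.A_upto S d2" using group_algebra.A_upto_exhausts[OF S(3)] by blast
  define d where "d = max (max d0 d1) (max d2 (nat \<lceil>1 / \<epsilon>\<rceil>))"
  have d: "d \<ge> d0" "d \<ge> d1" "d \<ge> d2" "d \<ge> nat \<lceil>1 / \<epsilon>\<rceil>"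
    unfolding d_def by (simp_all only: max.coboundedI1 max.coboundedI2 max.cobounded1 max.cobounded2)
  have d_ge: "d \<ge> 1" using d(2) d1 by simp
  have "1 / \<epsilon> \<le> real d" using d(4) real_nat_ceiling_ge[of "1 / \<epsilon>"] by linarith
  then have d\<epsilon>: "1 / real d \<le> \<epsilon>" using \<epsilon> d_ge by (simp add: field_simps)
  obtain n \<phi> where n: "n \<ge> 1" and approx: "group_algebra.approximation_of S d n \<phi>"
    using exists_approximation[OF am domain S(1) d_ge] by blast
  obtain \<psi> where rep: "group_algebra.algebra_representation n \<psi>" and near: "\<forall>s\<in>S. rk n (\<phi> s - \<psi> s) < \<epsilon>"
    using stab[OF n group_algebra.approximation_weaken[OF approx d1 d(2)]] by blast
  have lin: "group_algebra.linear_to_mat n \<psi>" and mult: "\<And>x y. \<psi> (x * y) = \<psi> x * \<psi> y"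
    using rep unfolding group_algebra.algebra_representation_def by auto
  have car: "\<psi> y \<in> carrier_mat n n" "\<phi> y \<in> carrier_mat n n" for y
    using lin approx unfolding group_algebra.linear_to_mat_def group_algebra.approximation_of_def by auto
  have "\<psi> (grp \<gamma>) \<noteq> \<psi> (grp 0)"
  proof
    assume eq: "\<psi> (grp \<gamma>) = \<psi> (grp 0)"
    have "\<psi> (x + grp 0) = \<psi> x + \<psi> (grp 0)" using lin unfolding group_algebra.linear_to_mat_def by blast
    then have eq': "\<psi> (grp 0) = \<psi> x + \<psi> (grp 0)" using eq unfolding x_def by simp
    have "\<phi> x - \<psi> x = \<phi> x"
    proof (rule eq_matI)
      fix i j assume "i < dim_row (\<phi> x)" "j < dim_col (\<phi> x)"
      then have ij: "i < n" "j < n" using car(2)[of x] by auto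
      have "\<psi> (grp 0) $$ (i, j) = (\<psi> x + \<psi> (grp 0)) $$ (i, j)" by (simp only: eq'[symmetric])
      then have "\<psi> x $$ (i, j) = 0" using ij car[of "grp 0"] by simp
      then show "(\<phi> x - \<psi> x) $$ (i, j) = \<phi> x $$ (i, j)" using ij car[of x] by simp
    qed (use car[of x] in auto)
    then have "real (vec_space.rank n (\<phi> x)) \<le> c * (\<epsilon> + 1 / real d) * real n"
      using distance_boundD[OF bound \<epsilon> d(1) d_ge n approx rep near] by simp
    also have "\<dots> \<le> c * (2 * \<epsilon>) * real n" using d\<epsilon> c by (intro mult_right_mono mult_left_mono) auto
    also have "\<dots> \<le> 1 / 2 * real n"
      unfolding \<epsilon>_def using c by (intro mult_right_mono) (auto simp: field_simps)
    finally have "real (vec_space.rank n (\<phi> x)) \<le> 1 / 2 * real n" .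
    moreover have "x \<in> group_algebra.A_upto S d" using d2 group_algebra.A_upto_mono[OF d(3)] by blast
    then have "real n \<le> real (vec_space.rank n (\<phi> x)) + real n / real d"
      using approximation_rank[OF approx n] \<open>x \<noteq> 0\<close> by blast
    moreover have "real n / real d \<le> 1 / 4 * real n"
    proof -
      have "\<epsilon> \<le> 1 / 4" unfolding \<epsilon>_def using c by (simp add: field_simps)
      then have "1 / real d * real n \<le> 1 / 4 * real n" using d\<epsilon> by (intro mult_right_mono) auto
      then show ?thesis by simp
    qed
    ultimately show False using n by simp
  qed
  moreover have "\<psi> (grp (g + h)) = \<psi> (grp g) * \<psi> (grp h)" for g h
    unfolding mult[symmetric] mult_single by simp
  ultimately show "\<exists>N. N \<lhd> (group_of_type :: 'g monoid) \<and> finite (rcosets\<^bsub>group_of_type\<^esub> N) \<and> \<gamma> \<notin> N"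
    using malcev[OF fg, of "\<lambda>g. \<psi> (grp g)"] car by blast
qed

theorem theorem1p2:
  fixes S :: "('g::group_add \<Rightarrow>\<^sub>0 'k::field) set"
  assumes "finitely_generated (group_of_type :: 'g monoid)"
    and "torsion_free (group_of_type :: 'g monoid)"
    and "amenable (group_of_type :: 'g monoid)"
    and "\<And>x y :: 'g \<Rightarrow>\<^sub>0 'k. x * y = 0 \<Longrightarrow> x = 0 \<or> y = 0"
    and "finite S" and "1 \<in> S" and "group_algebra.generating_set S"
  shows "group_algebra.weakly_stable S \<longleftrightarrow> residually_finite (group_of_type :: 'g monoid)"
proof
  show "residually_finite (group_of_type :: 'g monoid)" if "group_algebra.weakly_stable S"
    using residually_finite_if_weakly_stable[OF assms(1,3,4,5,6,7) that] .
  show "group_algebra.weakly_stable S" if "residually_finite (group_of_type :: 'g monoid)"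
    using weakly_stable_if_residually_finite[OF assms(2,3,4,5,7) that] .
qed

end
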